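(* For all irreducible polynomials $Q\in\mathbb{F}_q[x]$, \[ \frac{1}{\phi(Q)}\sum_{\chi\neq\chi_{0}}\left|L\left(\tfrac{1}{2},\chi\right)\right|^{4}=\frac{q-1}{12q}\left(\deg Q\right)^{4}+O\left(\left(\deg Q\right)^{3}\right), \] where the sum is over all nontrivial Dirichlet characters $\chi$ modulo $Q$, and the implied constant depends at most on $q$.
   Context: $\mathbb{F}_q$ is a fixed finite field with $q$ elements and $\mathcal{A}=\mathbb{F}_q[x]$. For nonzero $N\in\mathcal{A}$, $|N|=q^{\deg N}$. $\phi(Q)=\#(\mathcal{A}/Q\mathcal{A})^{*}$, which equals $|Q|-1$ for irreducible $Q$. A Dirichlet character modulo $Q$ is a function $\chi:\mathcal{A}\to\mathbb{C}$ with $\chi(A+BQ)=\chi(A)$ and $\chi(AB)=\chi(A)\chi(B)$ for all $A,B\in\mathcal{A}$, and $\chi(A)\neq0$ if and only if $(A,Q)=1$; $\chi_0$ is the trivial character ($\chi_0(A)=1$ whenever $(A,Q)=1$). The L-function is $L(s,\chi)=\sum_{N\text{ monic}}\chi(N)|N|^{-s}$ for $\Re(s)>1$. For $\chi\neq\chi_0$ one has $\sum_{N\text{ monic},\,\deg N=n}\chi(N)=0$ for $n\ge\deg Q$, so $L(s,\chi)$ is a polynomial in $q^{-s}$, which gives its value for all $s$; in particular $L(\tfrac12,\chi)=\sum_{n=0}^{\deg Q-1}q^{-n/2}\sum_{N\text{ monic},\,\deg N=n}\chi(N)$. *)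

theory Defs
  imports "HOL-Analysis.Analysis" "HOL-Computational_Algebra.Polynomial"
begin

text \<open>
  Throughout, \<open>F\<^sub>q\<close> is an arbitrary type \<open>'a\<close> of sort \<open>{field, finite}\<close>, \<open>q = CARD('a)\<close>,
  and \<open>F\<^sub>q[x]\<close> is \<open>'a poly\<close>.
\<close>

definition poly_abs :: "'a::{field,finite} poly \<Rightarrow> real" where
  "poly_abs N = (if N = 0 then 0 else real CARD('a) ^ degree N)"

text \<open>The residue classes \<open>A + Q F\<^sub>q[x]\<close> are the elements of the quotient set below; such a class
  is a unit of the quotient ring iff some representative has an inverse modulo \<open>Q\<close>.\<close>

definition poly_phi :: "'a::{field,finite} poly \<Rightarrow> nat" where
  "poly_phi Q =
     card {X \<in> UNIV // {(A, B). Q dvd A - B}. \<exists>A\<in>X. \<exists>B. Q dvd A * B - 1}"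

definition dirichlet_character :: "'a::{field,finite} poly \<Rightarrow> ('a poly \<Rightarrow> complex) \<Rightarrow> bool" where
  "dirichlet_character Q \<psi> \<longleftrightarrow>
     (\<forall>A B. \<psi> (A + B * Q) = \<psi> A) \<and>
     (\<forall>A B. \<psi> (A * B) = \<psi> A * \<psi> B) \<and>
     (\<forall>A. \<psi> A \<noteq> 0 \<longleftrightarrow> coprime A Q)"

definition trivial_character :: "'a::{field,finite} poly \<Rightarrow> 'a poly \<Rightarrow> complex" where
  "trivial_character Q A = (if coprime A Q then 1 else 0)"

definition monic_polys :: "nat \<Rightarrow> 'a::{field,finite} poly set" where
  "monic_polys n = {N. lead_coeff N = 1 \<and> degree N = n}"

text \<open>
  The Dirichlet series of \<open>\<psi>\<close>, with its terms collected by degree. For \<open>Re s > 1\<close> this is the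
  absolutely convergent sum over all monic polynomials (\<open>dirichlet_L_eq_infsum\<close>). For nontrivial
  \<open>\<psi>\<close> the terms with \<open>n \<ge> degree Q\<close> vanish, so that at every \<open>s\<close> it is the value of the
  polynomial in \<open>q\<^bsup>-s\<^esup>\<close> that continues the series (\<open>dirichlet_L_nontrivial\<close>).
\<close>

definition dirichlet_L :: "('a::{field,finite} poly \<Rightarrow> complex) \<Rightarrow> complex \<Rightarrow> complex" where
  "dirichlet_L \<psi> s = (\<Sum>n. \<Sum>N\<in>monic_polys n. \<psi> N * complex_of_real (poly_abs N) powr (- s))"


lemma monic_polys_finite_card:
  "finite (monic_polys n :: 'a::{field,finite} poly set) \<and>
   card (monic_polys n :: 'a poly set) \<le> CARD('a) ^ n"
proof -
  let ?S = "monic_polys n :: 'a poly set"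
  let ?L = "{xs :: 'a list. set xs \<subseteq> UNIV \<and> length xs = n}"
  let ?f = "\<lambda>N::'a poly. map (coeff N) [0..<n]"
  have inj: "inj_on ?f ?S"
  proof (rule inj_onI, rule poly_eqI)
    fix N M :: "'a poly" and i
    assume a: "N \<in> ?S" "M \<in> ?S" "?f N = ?f M"
    show "coeff N i = coeff M i"
    proof (cases i n rule: linorder_cases)
      case less
      then show ?thesis using a(3) by auto
    next
      case equal
      then show ?thesis using a by (auto simp: monic_polys_def)
    next
      case greater
      then show ?thesis using a by (auto simp: monic_polys_def coeff_eq_0)
    qed
  qed
  have L: "finite ?L" "card ?L = CARD('a) ^ n"
    using finite_lists_length_eq[of "UNIV :: 'a set" n] card_lists_length_eq[of "UNIV :: 'a set" n] by auto
  have sub: "?f ` ?S \<subseteq> ?L" by auto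
  show ?thesis
    using inj_on_finite[OF inj sub L(1)] card_inj_on_le[OF inj sub L(1)] L(2) by simp
qed

lemma finite_monic_polys [simp]: "finite (monic_polys n)"
  using monic_polys_finite_card by blast

lemma poly_abs_monic: "N \<in> monic_polys n \<Longrightarrow> poly_abs N = real CARD('a) ^ n"
  for N :: "'a::{field,finite} poly"
  by (auto simp: monic_polys_def poly_abs_def)

lemma finite_degree_le: "finite {R :: 'a::{field,finite} poly. degree R \<le> m}"
proof (rule finite_subset)
  show "{R :: 'a poly. degree R \<le> m} \<subseteq> Poly ` {xs. set xs \<subseteq> UNIV \<and> length xs \<le> Suc m}"
  proof
    fix R :: "'a poly" assume "R \<in> {R. degree R \<le> m}"
    then have "length (coeffs R) \<le> Suc m" by (cases "R = 0") (auto simp: length_coeffs)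
    then show "R \<in> Poly ` {xs. set xs \<subseteq> UNIV \<and> length xs \<le> Suc m}"
      by (intro image_eqI[of _ _ "coeffs R"]) auto
  qed
  show "finite (Poly ` {xs :: 'a list. set xs \<subseteq> UNIV \<and> length xs \<le> Suc m})"
    by (intro finite_imageI finite_lists_length_le) simp
qed

lemma dirichlet_character_cong:
  assumes "dirichlet_character Q \<psi>" "Q dvd A - B"
  shows "\<psi> A = \<psi> B"
proof -
  from assms(2) obtain C where "A - B = Q * C" by (elim dvdE)
  then have "A = B + C * Q" by (simp add: algebra_simps)
  then show ?thesis using assms(1) by (simp add: dirichlet_character_def)
qed

lemma dirichlet_character_bounded:
  assumes "dirichlet_character Q \<psi>" "Q \<noteq> 0"
  obtains B where "B \<ge> 0" "\<And>A. norm (\<psi> A) \<le> B"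
proof
  let ?R = "{R :: 'a poly. degree R \<le> degree Q}"
  let ?B = "\<Sum>R\<in>?R. norm (\<psi> R)"
  show "?B \<ge> 0" by (simp add: sum_nonneg)
  fix A
  have "A mod Q \<in> ?R"
    using degree_mod_less[of Q A] assms(2) by auto
  then have "norm (\<psi> (A mod Q)) \<le> ?B"
    by (intro member_le_sum) (auto simp: finite_degree_le)
  moreover have "\<psi> (A mod Q) = \<psi> A"
    by (rule dirichlet_character_cong[OF assms(1)]) (metis dvd_minus_mod dvd_diff_commute)
  ultimately show "norm (\<psi> A) \<le> ?B" by simp
qed

lemma powr_of_real_power:
  fixes q :: real
  assumes "q > 0"
  shows "complex_of_real (q ^ n) powr s = (complex_of_real q powr s) ^ n"
proof (induction n)
  case (Suc n)
  have "complex_of_real (q ^ Suc n) powr s = (complex_of_real q * complex_of_real (q ^ n)) powr s"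
    by simp
  also have "\<dots> = complex_of_real q powr s * complex_of_real (q ^ n) powr s"
    by (rule powr_times_real) (use assms in auto)
  finally show ?case by (simp only: Suc.IH power_Suc)
qed simp

theorem dirichlet_L_eq_infsum:
  fixes \<psi> :: "'a::{field,finite} poly \<Rightarrow> complex"
  assumes \<psi>: "dirichlet_character Q \<psi>" and Q: "Q \<noteq> 0" and s: "Re s > 1"
  shows "(\<lambda>N. norm (\<psi> N * complex_of_real (poly_abs N) powr (- s))) summable_on {N. lead_coeff N = 1}"
    and "dirichlet_L \<psi> s =
           (\<Sum>\<^sub>\<infinity>N\<in>{N. lead_coeff N = 1}. \<psi> N * complex_of_real (poly_abs N) powr (- s))"
proof -
  let ?M = "{N :: 'a poly. lead_coeff N = 1}"
  let ?S = "Sigma UNIV (monic_polys :: nat \<Rightarrow> 'a poly set)"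
  define f where "f N = \<psi> N * complex_of_real (poly_abs N) powr (- s)" for N
  define q where "q = real CARD('a)"
  define r where "r = q powr (1 - Re s)"
  have "card {0, 1 :: 'a} \<le> CARD('a)" by (rule card_mono) auto
  then have q: "q \<ge> 2" by (simp add: q_def)
  have r: "0 < r" "r < 1"
    using q s by (auto simp: r_def intro: powr_less_one)
  have inj: "inj_on snd ?S" by (auto simp: inj_on_def monic_polys_def)
  have img: "snd ` ?S = ?M" by (force simp: monic_polys_def image_iff)
  obtain B where B: "B \<ge> 0" "\<And>A. norm (\<psi> A) \<le> B"
    using dirichlet_character_bounded[OF \<psi> Q] by blast
  have nf: "norm (f N) \<le> B * (q ^ n) powr (- Re s)" if "N \<in> monic_polys n" for N n
  proof -
    have "norm (complex_of_real (q ^ n) powr (- s)) = (q ^ n) powr (- Re s)"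
      using q by (subst norm_powr_real_powr) (auto simp del: of_real_power)
    then show ?thesis
      using B(2)[of N] unfolding f_def norm_mult poly_abs_monic[OF that] q_def[symmetric]
      by (simp add: mult_right_mono del: of_real_power)
  qed
  have bound: "(\<Sum>N\<in>monic_polys n. norm (f N)) \<le> B * r ^ n" for n
  proof -
    have "(\<Sum>N\<in>monic_polys n. norm (f N)) \<le> real (card (monic_polys n :: 'a poly set)) * (B * (q ^ n) powr (- Re s))"
      by (rule sum_bounded_above) (rule nf)
    also have "\<dots> \<le> q ^ n * (B * (q ^ n) powr (- Re s))"
    proof (rule mult_right_mono)
      show "real (card (monic_polys n :: 'a poly set)) \<le> q ^ n"
        using monic_polys_finite_card[where 'a = 'a, of n] unfolding q_def
        by (metis of_nat_le_iff of_nat_power)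
    qed (use B in auto)
    also have "\<dots> = B * r ^ n"
      using q by (simp add: r_def powr_realpow[symmetric] powr_powr powr_add[symmetric] algebra_simps)
    finally show ?thesis .
  qed
  have geo: "(\<lambda>n. B * r ^ n) summable_on (UNIV :: nat set)"
    by (rule summable_nonneg_imp_summable_on)
       (use r B in \<open>auto intro!: summable_mult summable_geometric\<close>)
  have "(\<lambda>n. \<Sum>N\<in>monic_polys n. norm (f N)) summable_on (UNIV :: nat set)"
    by (rule summable_on_comparison_test[OF geo]) (use bound in \<open>auto intro: sum_nonneg\<close>)
  then have "(\<lambda>p. norm (f (snd p))) summable_on ?S"
    by (intro summable_on_SigmaI[where g = "\<lambda>n. \<Sum>N\<in>monic_polys n. norm (f N)"]) auto
  then have "(\<lambda>N. norm (f N)) summable_on ?M"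
    unfolding img[symmetric] by (subst summable_on_reindex[OF inj]) (simp add: o_def)
  then show "(\<lambda>N. norm (\<psi> N * complex_of_real (poly_abs N) powr (- s))) summable_on ?M"
    by (simp add: f_def)
  then have "f summable_on ?M"
    unfolding f_def[symmetric] by (rule abs_summable_summable)
  then have "(f has_sum infsum f ?M) (snd ` ?S)"
    by (simp add: img)
  then have "((\<lambda>p. f (snd p)) has_sum infsum f ?M) ?S"
    by (subst (asm) has_sum_reindex[OF inj]) (simp add: o_def)
  then have "((\<lambda>n. \<Sum>N\<in>monic_polys n. f N) has_sum infsum f ?M) UNIV"
    by (rule has_sum_Sigma') auto
  then have "(\<lambda>n. \<Sum>N\<in>monic_polys n. f N) sums infsum f ?M"
    by (rule has_sum_imp_sums)
  then show "dirichlet_L \<psi> s = (\<Sum>\<^sub>\<infinity>N\<in>?M. \<psi> N * complex_of_real (poly_abs N) powr (- s))"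
    unfolding f_def[abs_def] dirichlet_L_def by (rule sums_unique[symmetric])
qed

lemma poly_bezout:
  fixes A B :: "'a::field poly"
  assumes "coprime A B"
  shows "\<exists>U V. U * A + V * B = 1"
  using assms
proof (induction B arbitrary: A rule: measure_induct_rule[where f = euclidean_size])
  case (less B)
  show ?case
  proof (cases "B = 0")
    case True
    then have "A dvd 1" using less.prems by simp
    then obtain U where "1 = A * U" by (elim dvdE)
    then have "U * A + 0 * B = 1" by (simp add: mult.commute)
    then show ?thesis by blast
  next
    case False
    have "coprime B (A mod B)"
    proof (rule coprimeI)
      fix C assume "C dvd B" "C dvd A mod B"
      then have "C dvd A" using dvd_mod_iff by blast
      then show "is_unit C" using less.prems \<open>C dvd B\<close> by (meson coprime_common_divisor)
    qed
    moreover have "euclidean_size (A mod B) < euclidean_size B"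
      using False by (rule mod_size_less)
    ultimately obtain U V where "U * B + V * (A mod B) = 1"
      using less.IH by blast
    moreover have "A mod B = A - A div B * B"
      by (rule minus_div_mult_eq_mod[symmetric])
    ultimately have "V * A + (U - V * (A div B)) * B = 1"
      by (simp only:) (simp only: algebra_simps)
    then show ?thesis by blast
  qed
qed

theorem dirichlet_L_nontrivial:
  fixes Q :: "'a::{field,finite} poly"
  assumes \<psi>: "dirichlet_character Q \<psi>" and nontriv: "\<psi> \<noteq> trivial_character Q" and Q: "Q \<noteq> 0"
  shows "n \<ge> degree Q \<Longrightarrow> (\<Sum>N\<in>monic_polys n. \<psi> N) = 0"
    and "dirichlet_L \<psi> s =
           (\<Sum>n<degree Q. (complex_of_real (real CARD('a)) powr (- s)) ^ n * (\<Sum>N\<in>monic_polys n. \<psi> N))"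
proof -
  have mult: "\<psi> (A * B) = \<psi> A * \<psi> B" for A B
    using \<psi> by (simp add: dirichlet_character_def)
  have nz: "\<psi> A \<noteq> 0 \<longleftrightarrow> coprime A Q" for A
    using \<psi> by (simp add: dirichlet_character_def)
  obtain A where A: "coprime A Q" "\<psi> A \<noteq> 1"
    using nontriv nz unfolding fun_eq_iff trivial_character_def by metis
  obtain U V where UV: "U * A + V * Q = 1"
    using poly_bezout[OF A(1)] by blast
  have vanish: "(\<Sum>N\<in>monic_polys n. \<psi> N) = 0" if n: "n \<ge> degree Q" for n
  proof -
    let ?S = "monic_polys n :: 'a poly set"
    define h where "h N = N + ((A * N) mod Q - N mod Q)" for N
    have h_alt: "h N = N div Q * Q + (A * N) mod Q" for N
    proof -
      have "h N = (N - N mod Q) + (A * N) mod Q" by (simp only: h_def algebra_simps)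
      then show ?thesis by (simp only: minus_mod_eq_div_mult)
    qed
    have cong: "Q dvd h N - A * N" for N
    proof -
      have "h N - A * N = (N - N mod Q) - (A * N - (A * N) mod Q)"
        by (simp only: h_def algebra_simps)
      then show ?thesis by (metis dvd_diff dvd_minus_mod)
    qed
    have h_in: "h N \<in> ?S" if N: "N \<in> ?S" for N
    proof (cases "degree Q = 0")
      case True
      then have "is_unit Q" using Q by (simp add: is_unit_iff_degree)
      then show ?thesis using N by (simp add: h_def unit_imp_mod_eq_0)
    next
      case False
      have d: "degree (R mod Q) < degree Q" for R
        using degree_mod_less'[of Q R] Q False by (cases "R mod Q = 0") auto
      have "degree ((A * N) mod Q - N mod Q) < degree Q"
        by (rule degree_diff_less) (use d in auto)
      then have lt: "degree ((A * N) mod Q - N mod Q) < degree N"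
        using N n by (simp add: monic_polys_def)
      then have "degree (h N) = degree N"
        unfolding h_def by (rule degree_add_eq_left)
      moreover have "coeff (h N) (degree N) = coeff N (degree N)"
        unfolding h_def coeff_add coeff_eq_0[OF lt] by simp
      ultimately show ?thesis using N by (auto simp: monic_polys_def)
    qed
    have inj: "inj_on h ?S"
    proof (rule inj_onI)
      fix N M assume "h N = h M"
      have h_div: "h R div Q = R div Q" for R
        unfolding h_alt using Q by simp
      have "Q dvd (h M - A * M) - (h N - A * N)" by (rule dvd_diff[OF cong cong])
      moreover have "(h M - A * M) - (h N - A * N) = A * (N - M)"
        using \<open>h N = h M\<close> by (simp add: algebra_simps)
      ultimately have "Q dvd A * (N - M)" by simp
      then have "Q dvd U * (A * (N - M)) + V * Q * (N - M)" by simp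
      also have "U * (A * (N - M)) + V * Q * (N - M) = (U * A + V * Q) * (N - M)"
        by (simp add: algebra_simps)
      finally have "Q dvd N - M" using UV by simp
      then have "N mod Q = M mod Q" by (simp add: mod_eq_dvd_iff)
      moreover have "N div Q = M div Q" using h_div \<open>h N = h M\<close> by metis
      ultimately show "N = M" by (metis div_mult_mod_eq)
    qed
    have "h ` ?S = ?S"
      by (rule endo_inj_surj) (use h_in inj in auto)
    then have "(\<Sum>N\<in>?S. \<psi> N) = (\<Sum>N\<in>?S. \<psi> (h N))"
      using sum.reindex[OF inj, of \<psi>] by (simp add: o_def)
    also have "\<dots> = (\<Sum>N\<in>?S. \<psi> A * \<psi> N)"
      using dirichlet_character_cong[OF \<psi> cong] by (simp add: mult)
    also have "\<dots> = \<psi> A * (\<Sum>N\<in>?S. \<psi> N)"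
      by (rule sum_distrib_left[symmetric])
    finally show ?thesis using A(2) by simp
  qed
  then show "n \<ge> degree Q \<Longrightarrow> (\<Sum>N\<in>monic_polys n. \<psi> N) = 0" .
  define q where "q = real CARD('a)"
  have q: "q > 0" by (simp add: q_def)
  have inner: "(\<Sum>N\<in>monic_polys n. \<psi> N * complex_of_real (poly_abs N) powr (- s)) =
      (complex_of_real q powr (- s)) ^ n * (\<Sum>N\<in>monic_polys n. \<psi> N)" for n
    unfolding sum_distrib_left
    by (intro sum.cong refl)
       (simp add: poly_abs_monic q_def[symmetric] powr_of_real_power[OF q] del: of_real_power)
  have "dirichlet_L \<psi> s =
      (\<Sum>n<degree Q. (complex_of_real q powr (- s)) ^ n * (\<Sum>N\<in>monic_polys n. \<psi> N))"
    unfolding dirichlet_L_def inner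
    by (rule suminf_finite) (use vanish in auto)
  then show "dirichlet_L \<psi> s =
      (\<Sum>n<degree Q. (complex_of_real (real CARD('a)) powr (- s)) ^ n * (\<Sum>N\<in>monic_polys n. \<psi> N))"
    by (simp add: q_def)
qed

end

theory Submission
  imports Defs "HOL-Algebra.Multiplicative_Group"
begin

text \<open>
  For \<open>\<psi> \<noteq> \<chi>\<^sub>0\<close> the square \<open>|L(1/2, \<psi>)|\<^sup>2\<close> equals \<open>\<Sum>r. \<psi>(r) w(r)\<close>, where \<open>w(r)\<close> weighs the pairs of monic
  \<open>A, B\<close> of degree less than \<open>d = degree Q\<close> with \<open>A \<equiv> r B\<close> by \<open>|A B|\<^sup>-\<^sup>1\<^sup>/\<^sup>2\<close>. These pairs lie in the rank-two lattice
  \<open>{(A, B). Q dvd A - r B}\<close>, which is its own dual; comparing a box with its dual box expresses the number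
  of pairs with \<open>degree A + degree B \<ge> d\<close> by the number with \<open>degree A + degree B \<le> d - 2\<close>. This plays the role
  of the functional equation, and replaces \<open>w(r)\<close>, up to a constant that nontrivial characters do not see, by
  a sum over the coprime pairs with \<open>degree A + degree B < d\<close> (the convergents of \<open>r / Q\<close>), in which a pair
  with monic \<open>A\<close> has coefficient \<open>d - degree A - degree B + O(1)\<close>, any other pair \<open>O(1)\<close>.

  Parseval's identity turns the fourth moment into the mean square of this sum. The diagonal yields
  \<open>(1 - 1/q) \<Sum>a, b. (d - a - b)\<^sup>2\<close>, summed over \<open>a + b < d\<close>, hence the main term. An off-diagonal pair
  \<open>(A, B), (A', B')\<close> satisfies \<open>A B' = A' B + Q E\<close> with \<open>E \<noteq> 0\<close>; put \<open>e = d - degree A - degree B\<close>, and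
  define \<open>e'\<close> likewise. If the smaller of \<open>e, e'\<close> is at most \<open>d\<^sup>1\<^sup>/\<^sup>3\<close>, it suffices that one pair and the degrees
  determine the other; otherwise Landreau's inequality for the divisor function bounds the
  number of solutions up to a power of \<open>d\<close>, which is harmless against the exponential gain in \<open>e'\<close>.
\<close>

text \<open>About \<open>d^4\<close> quadruples of degrees occur off the diagonal, and together they
  may cost only \<open>O(d^3)\<close>. The pointwise bound for the divisor function, exponential in
  \<open>d / log d\<close>, would swamp the gain \<open>u ^ e'\<close> when \<open>e'\<close> is
  near \<open>d^(1/3)\<close>; an inequality that can be averaged over all values
  \<open>A' B + Q E\<close> loses only a power of \<open>d\<close>, which \<open>u ^ e'\<close>
  absorbs there. The threshold comes from the other range: for fixed \<open>degree B\<close> and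
  \<open>degree B'\<close> it contributes a constant times the sum of \<open>e'^2\<close> over
  \<open>e'^3 \<le> d\<close>, which is at most \<open>d\<close>, and there are \<open>d^2\<close>
  choices of these two degrees. The coefficient \<open>d - degree A - degree B\<close> counts the
  monic multiples of a primitive pair in a triangle of degrees and in the dual triangle, about half
  in each. In the main term, \<open>1 - 1/q\<close> is the density of coprime pairs of monic
  polynomials and \<open>1/12\<close> the leading coefficient of the sum of the squared gaps.
  Parseval's identity runs over all characters; removing the trivial one costs
  \<open>O(d^2)\<close>.\<close>

hide_const (open) up_ring.coeff up_ring.monom module.smult

section \<open>Polynomials over a finite field\<close>

text \<open>Stated through coefficients because \<open>degree 0 = 0\<close>: zero lies in each of
  these sets, so each is closed under linear combinations, has \<open>q ^ n\<close> elements over a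
  field of \<open>q\<close> elements, and is \<open>{0}\<close> for \<open>n = 0\<close>.\<close>

definition polys_below :: "nat \<Rightarrow> 'a::zero poly set" where
  "polys_below n = {A. \<forall>i\<ge>n. coeff A i = 0}"

lemma polys_below_iff: "A \<in> polys_below n \<longleftrightarrow> A = 0 \<or> degree A < n"
proof
  assume "A \<in> polys_below n"
  then have *: "n \<le> degree A \<Longrightarrow> lead_coeff A = 0"
    unfolding polys_below_def by blast
  show "A = 0 \<or> degree A < n"
  proof (rule disjCI)
    assume "\<not> degree A < n"
    then show "A = 0" using * by simp
  qed
next
  assume "A = 0 \<or> degree A < n"
  then show "A \<in> polys_below n"
    unfolding polys_below_def by (auto simp: coeff_eq_0)
qed

lemma polys_below_zero [simp]: "0 \<in> polys_below n"
  by (simp add: polys_below_iff)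

lemma polys_below_add: "A \<in> polys_below n \<Longrightarrow> B \<in> polys_below n \<Longrightarrow> A + B \<in> polys_below n"
  for A B :: "'a::comm_monoid_add poly"
  by (simp add: polys_below_def)

lemma polys_below_diff: "A \<in> polys_below n \<Longrightarrow> B \<in> polys_below n \<Longrightarrow> A - B \<in> polys_below n"
  for A B :: "'a::ab_group_add poly"
  by (simp add: polys_below_def)

lemma polys_below_smult: "A \<in> polys_below n \<Longrightarrow> smult c A \<in> polys_below n"
  by (simp add: polys_below_def)

lemma polys_below_mono: "m \<le> n \<Longrightarrow> A \<in> polys_below m \<Longrightarrow> A \<in> polys_below n"
  by (simp add: polys_below_def)

lemma polys_below_0 [simp]: "polys_below 0 = {0}"
  by (auto simp: polys_below_iff)

lemma polys_below_Suc:
  "polys_below (Suc n) = (\<lambda>(c, A). monom c n + A) ` (UNIV \<times> polys_below n)"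
  for n :: nat
proof (intro equalityI subsetI)
  fix A :: "'a::comm_monoid_add poly" assume A: "A \<in> polys_below (Suc n)"
  define B where "B = Abs_poly (\<lambda>i. if i < n then coeff A i else 0)"
  have B: "coeff B i = (if i < n then coeff A i else 0)" for i
    unfolding B_def by (rule fun_cong[OF Abs_poly_inverse])
      (auto simp: MOST_nat intro!: exI[of _ n])
  have "A = monom (coeff A n) n + B"
    by (rule poly_eqI) (use A in \<open>auto simp: B polys_below_def\<close>)
  moreover have "B \<in> polys_below n" by (simp add: polys_below_def B)
  ultimately show "A \<in> (\<lambda>(c, A). monom c n + A) ` (UNIV \<times> polys_below n)"
    by (intro image_eqI[of _ _ "(coeff A n, B)"]) auto
qed (auto simp: polys_below_def)

lemma finite_polys_below [simp]: "finite (polys_below n :: 'a::{field,finite} poly set)"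
  by (induction n) (auto simp: polys_below_Suc)

lemma card_polys_below: "card (polys_below n :: 'a::{field,finite} poly set) = CARD('a) ^ n"
proof (induction n)
  case (Suc n)
  have "inj_on (\<lambda>(c, A). monom c n + A) (UNIV \<times> (polys_below n :: 'a poly set))"
  proof (rule inj_onI, clarify)
    fix c d and A B :: "'a poly"
    assume *: "A \<in> polys_below n" "B \<in> polys_below n" "monom c n + A = monom d n + B"
    have "c = d"
      using arg_cong[OF *(3), of "\<lambda>P. coeff P n"] *(1,2) by (simp add: polys_below_def)
    then show "c = d \<and> A = B" using * by simp
  qed
  then show ?case unfolding polys_below_Suc by (simp add: card_image card_cartesian_product Suc)
qed simp

lemma monic_polys_eq: "monic_polys n = (\<lambda>A. monom 1 n + A) ` (polys_below n :: 'a::{field,finite} poly set)"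
proof (intro equalityI subsetI)
  fix A :: "'a poly" assume A: "A \<in> monic_polys n"
  then have "A - monom 1 n \<in> polys_below n"
    by (auto simp: polys_below_def monic_polys_def coeff_eq_0)
  then show "A \<in> (\<lambda>A. monom 1 n + A) ` polys_below n"
    by (intro image_eqI[of _ _ "A - monom 1 n"]) auto
next
  fix B :: "'a poly" assume "B \<in> (\<lambda>A. monom 1 n + A) ` polys_below n"
  then obtain A where A: "B = monom 1 n + A" "A \<in> polys_below n" by auto
  have c: "coeff B n = 1" using A by (simp add: polys_below_def)
  have "degree B \<le> n"
    by (rule degree_le) (use A in \<open>auto simp: polys_below_def\<close>)
  moreover have "n \<le> degree B" by (rule le_degree) (simp add: c)
  ultimately show "B \<in> monic_polys n" using c by (simp add: monic_polys_def)
qed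

lemma card_monic_polys: "card (monic_polys n :: 'a::{field,finite} poly set) = CARD('a) ^ n"
  unfolding monic_polys_eq by (subst card_image) (auto simp: card_polys_below inj_on_def)

lemma monic_polys_iff: "A \<in> monic_polys n \<longleftrightarrow> A \<in> polys_below (Suc n) \<and> coeff A n = 1"
  for A :: "'a::{field,finite} poly"
proof
  assume "A \<in> polys_below (Suc n) \<and> coeff A n = 1"
  then have "degree A = n" "coeff A n = 1"
    using le_degree[of A n] by (auto simp: polys_below_iff)
  then show "A \<in> monic_polys n" by (simp add: monic_polys_def)
qed (auto simp: monic_polys_def polys_below_iff)

lemma monic_polys_nonzero: "A \<in> monic_polys n \<Longrightarrow> A \<noteq> 0"
  by (auto simp: monic_polys_def)

lemma card_field_ge_2: "CARD('a::{field,finite}) \<ge> 2"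
proof -
  have "card {0, 1 :: 'a} \<le> CARD('a)" by (rule card_mono) auto
  then show ?thesis by simp
qed

section \<open>Coprimality and common factors in a polynomial ring over a field\<close>

lemma coprime_dvd_multD:
  fixes A B C :: "'a::field poly"
  assumes "coprime A B" "A dvd B * C"
  shows "A dvd C"
proof -
  obtain U V where "U * A + V * B = 1" using poly_bezout[OF assms(1)] by blast
  then have "(U * A + V * B) * C = C" by simp
  then have "C = A * (U * C) + V * (B * C)" by (simp add: algebra_simps)
  moreover have "A dvd A * (U * C) + V * (B * C)" using assms(2) by (meson dvd_add dvd_mult dvd_triv_left)
  ultimately show ?thesis by simp
qed

lemma irreducible_not_dvd_coprime:
  fixes A Q :: "'a::field poly"
  assumes "irreducible Q" "\<not> Q dvd A"
  shows "coprime A Q"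
proof (rule coprimeI)
  fix D assume D: "D dvd A" "D dvd Q"
  then obtain E where E: "Q = D * E" by (elim dvdE)
  show "is_unit D"
  proof (rule ccontr)
    assume "\<not> is_unit D"
    then have "is_unit E" using assms(1) E by (auto simp: irreducible_def)
    then have "Q dvd D" using E by (metis dvd_mult_unit_iff dvd_refl)
    then show False using D(1) assms(2) by (meson dvd_trans)
  qed
qed

lemma irreducible_dvd_multD:
  fixes A B Q :: "'a::field poly"
  assumes "irreducible Q" "Q dvd A * B"
  shows "Q dvd A \<or> Q dvd B"
  using irreducible_not_dvd_coprime[OF assms(1)] coprime_dvd_multD[of Q A B] assms(2)
  by (metis coprime_commute)

text \<open>\<open>G\<close> is the monic common divisor of greatest degree: a common factor
  \<open>D\<close> of the cofactors would make \<open>G D\<close> a common divisor too, so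
  \<open>degree D = 0\<close>.\<close>

lemma ex_coprime_decomposition:
  fixes A B :: "'a::field poly"
  assumes "B \<noteq> 0"
  obtains G A' B' where "lead_coeff G = 1" "A = G * A'" "B = G * B'" "coprime A' B'"
proof -
  let ?P = "\<lambda>G. G dvd A \<and> G dvd B"
  have "\<exists>G. ?P G \<and> (\<forall>H. ?P H \<longrightarrow> degree H \<le> degree G)"
    by (rule ex_has_greatest_nat[where k = 1 and b = "Suc (degree B)"])
       (use assms dvd_imp_degree_le in \<open>auto simp: less_Suc_eq_le\<close>)
  then obtain G where G: "G dvd A" "G dvd B" and max: "\<And>H. H dvd A \<Longrightarrow> H dvd B \<Longrightarrow> degree H \<le> degree G"
    by blast
  have G0: "G \<noteq> 0" using G(2) assms by auto
  define G1 where "G1 = smult (inverse (lead_coeff G)) G"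
  have G1: "G1 dvd A" "G1 dvd B" "lead_coeff G1 = 1"
    using G G0 by (auto simp: G1_def smult_dvd_iff)
  have dG: "degree G1 = degree G" using G0 by (simp add: G1_def)
  obtain A' B' where AB: "A = G1 * A'" "B = G1 * B'" using G1 by (meson dvdE)
  have B0: "B' \<noteq> 0" "G1 \<noteq> 0" using AB assms by auto
  have "coprime A' B'"
  proof (rule coprimeI)
    fix D assume D: "D dvd A'" "D dvd B'"
    then have "G1 * D dvd A" "G1 * D dvd B" using AB by auto
    then have "degree (G1 * D) \<le> degree G1" using max dG by auto
    moreover have D0: "D \<noteq> 0" using D B0 by auto
    ultimately have "degree D = 0" using B0 by (simp add: degree_mult_eq)
    then show "is_unit D" using D0 by (simp add: is_unit_iff_degree)
  qed
  then show ?thesis using that G1(3) AB by blast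
qed

section \<open>Characters modulo an irreducible polynomial\<close>

text \<open>Multiplication by a primitive root \<open>w\<close> permutes the roots of unity and
  scales the sum by \<open>w ^ i * cnj w ^ j\<close>, which differs from 1 unless
  \<open>i = j\<close>. Conjugation plays the part of inversion.\<close>

lemma sum_roots_unity_character:
  assumes "i < N" "j < N"
  shows "(\<Sum>z | z ^ N = 1. z ^ i * cnj z ^ j) = (if i = j then of_nat N else 0)"
proof -
  let ?R = "{z::complex. z ^ N = 1}"
  have N: "N > 0" using assms by simp
  have unit: "z * cnj z = 1" if "z \<in> ?R" for z
  proof -
    have "norm (z ^ N) = 1" using that by simp
    then have "norm z ^ N = 1" by (simp add: norm_power)
    then have "norm z = 1" using N power_eq_imp_eq_base[of "norm z" N 1] by simp
    then show ?thesis using complex_norm_square[of z] by simp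
  qed
  show ?thesis
  proof (cases "i = j")
    case True
    have "(\<Sum>z\<in>?R. z ^ i * cnj z ^ j) = (\<Sum>z\<in>?R. 1)"
      by (rule sum.cong) (use unit True in \<open>auto simp flip: power_mult_distrib\<close>)
    then show ?thesis using Complex.card_roots_unity_eq[OF N] True by simp
  next
    case False
    define w where "w = cis (2 * pi / real N)"
    have wpow: "w ^ k = cis (2 * pi * real k / real N)" for k
      using Complex.DeMoivre[of "2 * pi / real N" k] by (simp add: w_def mult_ac)
    have wR: "w ^ N = 1" using N by (simp add: wpow)
    have w1: "w * cnj w = 1" using unit wR by simp
    have w0: "w \<noteq> 0" using w1 by auto
    have "w ^ i \<noteq> w ^ j"
      using bij_betw_imp_inj_on[OF Complex.bij_betw_roots_unity[OF N]] assms False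
      unfolding wpow inj_on_def by auto
    moreover have "w ^ i * cnj w ^ j * w ^ j = w ^ i"
      using w1 by (simp add: mult.assoc mult.commute flip: power_mult_distrib)
    ultimately have c: "w ^ i * cnj w ^ j \<noteq> 1" by (metis mult_1)
    have "bij_betw ((*) w) ?R ?R"
    proof (rule bij_betwI[where g = "(*) (cnj w)"])
      show "(*) w \<in> ?R \<rightarrow> ?R" using wR by (auto simp: power_mult_distrib)
      have "cnj w ^ N = 1" using wR by (metis complex_cnj_one complex_cnj_power)
      then show "(*) (cnj w) \<in> ?R \<rightarrow> ?R" by (auto simp: power_mult_distrib)
      show "cnj w * (w * x) = x" for x using w1 by (metis mult.assoc mult.commute mult_1)
      show "w * (cnj w * x) = x" for x using w1 by (metis mult.assoc mult_1)
    qed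
    then have "(\<Sum>z\<in>?R. z ^ i * cnj z ^ j) = (\<Sum>z\<in>?R. (w * z) ^ i * cnj (w * z) ^ j)"
      by (rule sum.reindex_bij_betw[symmetric])
    also have "\<dots> = (\<Sum>z\<in>?R. (w ^ i * cnj w ^ j) * (z ^ i * cnj z ^ j))"
      by (simp add: power_mult_distrib mult_ac)
    also have "\<dots> = (w ^ i * cnj w ^ j) * (\<Sum>z\<in>?R. z ^ i * cnj z ^ j)"
      by (simp only: sum_distrib_left)
    finally show ?thesis using c False by simp
  qed
qed

lemma parseval_roots_unity:
  fixes c :: "nat \<Rightarrow> complex"
  shows "(\<Sum>z | z ^ N = 1. (cmod (\<Sum>i<N. c i * z ^ i))\<^sup>2) = real N * (\<Sum>i<N. (cmod (c i))\<^sup>2)"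
proof -
  have "complex_of_real (\<Sum>z | z ^ N = 1. (cmod (\<Sum>i<N. c i * z ^ i))\<^sup>2)
      = (\<Sum>z | z ^ N = 1. \<Sum>i<N. \<Sum>j<N. c i * cnj (c j) * (z ^ i * cnj z ^ j))"
    unfolding of_real_sum complex_norm_square cnj_sum sum_product
    by (intro sum.cong refl) (simp add: mult_ac)
  also have "\<dots> = (\<Sum>i<N. \<Sum>z | z ^ N = 1. \<Sum>j<N. c i * cnj (c j) * (z ^ i * cnj z ^ j))"
    by (rule sum.swap)
  also have "\<dots> = (\<Sum>i<N. \<Sum>j<N. \<Sum>z | z ^ N = 1. c i * cnj (c j) * (z ^ i * cnj z ^ j))"
    by (intro sum.cong refl sum.swap)
  also have "\<dots> = (\<Sum>i<N. \<Sum>j<N. c i * cnj (c j) * (if i = j then of_nat N else 0))"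
    by (intro sum.cong refl) (simp add: sum_roots_unity_character flip: sum_distrib_left)
  also have "\<dots> = (\<Sum>i<N. of_nat N * (c i * cnj (c i)))"
    by (intro sum.cong refl) (simp add: sum.delta if_distrib mult_ac cong: if_cong)
  also have "\<dots> = complex_of_real (real N * (\<Sum>i<N. (cmod (c i))\<^sup>2))"
    by (simp add: complex_norm_square sum_distrib_left del: of_real_power)
  finally show ?thesis by (simp only: of_real_eq_iff)
qed

section \<open>The residue field modulo \<open>Q\<close> and its cyclic unit group\<close>

locale irreducible_modulus =
  fixes Q :: "'a::{field,finite} poly"
  assumes irr: "irreducible Q"
begin

abbreviation "d \<equiv> degree Q"

text \<open>Representatives of the unit group modulo \<open>Q\<close>: by irreducibility every
  nonzero residue is invertible.\<close>

definition res :: "'a poly set" where "res = polys_below d - {0}"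

lemma Q_nonzero: "Q \<noteq> 0"
  using irr by (auto simp: irreducible_def)

lemma d_pos: "d > 0"
  using irr Q_nonzero by (auto simp: irreducible_def is_unit_iff_degree)

lemma mod_in_polys_below: "A mod Q \<in> polys_below d"
  using degree_mod_less[OF Q_nonzero, of A] by (auto simp: polys_below_iff)

lemma mod_eq_self: "A \<in> polys_below d \<Longrightarrow> A mod Q = A"
  by (auto simp: polys_below_iff mod_poly_less)

lemma dvd_polys_below: "A \<in> polys_below d \<Longrightarrow> Q dvd A \<Longrightarrow> A = 0"
  using mod_eq_self[of A] by (simp add: mod_eq_0_iff_dvd)

lemma dvd_multD: "Q dvd A * B \<Longrightarrow> Q dvd A \<or> Q dvd B"
  using irreducible_dvd_multD[OF irr] .

lemma coprime_Q_iff: "coprime A Q \<longleftrightarrow> \<not> Q dvd A"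
proof
  assume "coprime A Q"
  show "\<not> Q dvd A"
  proof
    assume "Q dvd A"
    then have "is_unit Q" using \<open>coprime A Q\<close> by (meson coprime_common_divisor dvd_refl)
    then show False using irr by (simp add: irreducible_def)
  qed
qed (rule irreducible_not_dvd_coprime[OF irr])

lemma finite_res [simp]: "finite res" by (simp add: res_def)

lemma card_res: "card res = CARD('a) ^ d - 1"
  by (simp add: res_def card_polys_below)

lemma card_res_pos: "card res > 0"
  using card_field_ge_2[where 'a='a] d_pos unfolding card_res
  by (metis zero_less_diff one_less_power less_le_trans one_less_numeral_iff semiring_norm(76))

lemma res_not_dvd: "r \<in> res \<Longrightarrow> \<not> Q dvd r"
  using dvd_polys_below by (auto simp: res_def)

lemma mod_in_res: "\<not> Q dvd A \<Longrightarrow> A mod Q \<in> res"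
  using mod_in_polys_below by (auto simp: res_def mod_eq_0_iff_dvd)

lemma res_inverse:
  assumes "\<not> Q dvd A"
  obtains B where "B \<in> res" "Q dvd A * B - 1"
proof -
  obtain U V where UV: "U * A + V * Q = 1"
    using poly_bezout[of A Q] assms coprime_Q_iff by blast
  have "A * (U mod Q) - 1 = (A * (U mod Q) - A * U) - V * Q" using UV by (simp add: algebra_simps)
  moreover have "Q dvd A * (U mod Q) - A * U"
    by (metis dvd_diff_commute dvd_minus_mod dvd_mult right_diff_distrib)
  ultimately have 1: "Q dvd A * (U mod Q) - 1" by (metis dvd_diff dvd_triv_right)
  have "\<not> Q dvd U"
  proof
    assume "Q dvd U"
    then have "Q dvd U * A + V * Q" by simp
    then have "Q dvd 1" by (simp add: UV)
    then show False using irr by (simp add: irreducible_def)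
  qed
  then show ?thesis using that 1 mod_in_res by blast
qed

text \<open>Built to bring in the theorem that the unit group of a finite field is cyclic.\<close>

definition residue_field :: "'a poly ring" where
  "residue_field = \<lparr>carrier = polys_below d, mult = (\<lambda>A B. A * B mod Q), one = 1, zero = 0, add = (+)\<rparr>"

lemma one_in: "1 \<in> polys_below d"
  using d_pos by (simp add: polys_below_iff)

lemma field_residue_field: "field residue_field"
proof -
  interpret cring residue_field
  proof (rule cringI)
    show "abelian_group residue_field"
    proof (rule abelian_groupI)
      fix x assume "x \<in> carrier residue_field"
      then have "- x \<in> carrier residue_field"
        using polys_below_diff[of 0 d x] by (simp add: residue_field_def)
      then show "\<exists>y\<in>carrier residue_field. y \<oplus>\<^bsub>residue_field\<^esub> x = \<zero>\<^bsub>residue_field\<^esub>"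
        by (intro bexI[of _ "- x"]) (simp_all add: residue_field_def)
    qed (auto simp: residue_field_def polys_below_add add_ac)
    show "comm_monoid residue_field"
      by (rule comm_monoidI)
        (auto simp: residue_field_def mod_in_polys_below one_in mod_eq_self mod_mult_left_eq
          mod_mult_right_eq mult_ac)
  qed (auto simp: residue_field_def poly_mod_add_left distrib_right)
  show ?thesis
  proof (rule cring_fieldI2)
    show "\<zero>\<^bsub>residue_field\<^esub> \<noteq> \<one>\<^bsub>residue_field\<^esub>" by (simp add: residue_field_def)
    fix a assume a: "a \<in> carrier residue_field" "a \<noteq> \<zero>\<^bsub>residue_field\<^esub>"
    then have "a \<in> res" by (simp add: residue_field_def res_def)
    then obtain b where b: "b \<in> res" "Q dvd a * b - 1" using res_inverse res_not_dvd by metis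
    then have "a * b mod Q = 1 mod Q" by (simp add: mod_eq_dvd_iff)
    then have "a * b mod Q = 1" using mod_eq_self[OF one_in] by simp
    then show "\<exists>b\<in>carrier residue_field. a \<otimes>\<^bsub>residue_field\<^esub> b = \<one>\<^bsub>residue_field\<^esub>"
      using b by (intro bexI[of _ b]) (auto simp: residue_field_def res_def)
  qed
qed

lemma residue_field_pow: "A [^]\<^bsub>residue_field\<^esub> (n::nat) = A ^ n mod Q"
proof (induction n)
  case (Suc n)
  have "(A ^ n mod Q) * A mod Q = A ^ n * A mod Q" by (rule mod_mult_left_eq)
  with Suc show ?case by (simp add: nat_pow_def residue_field_def mult.commute)
qed (simp add: nat_pow_def residue_field_def mod_eq_self[OF one_in])

text \<open>A generator of the unit group reaches every residue with an exponent below
  \<open>card res\<close>; a surjection between finite sets of equal size is injective.\<close>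

lemma primitive_root:
  obtains g where "\<not> Q dvd g" "bij_betw (\<lambda>i. g ^ i mod Q) {..<card res} res" "g ^ card res mod Q = 1"
proof -
  interpret R: field residue_field by (rule field_residue_field)
  have fin: "finite (carrier residue_field)" by (simp add: residue_field_def)
  obtain g where g: "g \<in> carrier (mult_of residue_field)"
    "carrier (mult_of residue_field) = {g [^]\<^bsub>residue_field\<^esub> i | i::nat. i \<in> UNIV}"
    using R.finite_field_mult_group_has_gen[OF fin] by blast
  have carr: "carrier (mult_of residue_field) = res" by (auto simp: residue_field_def res_def)
  interpret G: group "mult_of residue_field" by (rule R.field_mult_group)
  have "g [^]\<^bsub>mult_of residue_field\<^esub> order (mult_of residue_field) = \<one>\<^bsub>mult_of residue_field\<^esub>"
    by (rule G.pow_order_eq_1[OF g(1)])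
  then have pow1: "g ^ card res mod Q = 1"
    by (simp add: nat_pow_mult_of residue_field_pow order_def carr one_mult_of del: carrier_mult_of)
       (simp add: residue_field_def)
  have "res \<subseteq> (\<lambda>i. g ^ i mod Q) ` {..<card res}"
  proof
    fix r assume "r \<in> res"
    then have "r \<in> {g [^]\<^bsub>residue_field\<^esub> i | i::nat. i \<in> UNIV}" using g(2) carr by blast
    then obtain i where i: "r = g ^ i mod Q" unfolding residue_field_pow by blast
    have "g ^ i = (g ^ card res) ^ (i div card res) * g ^ (i mod card res)"
      by (metis div_mult_mod_eq mult.commute power_add power_mult)
    then have "g ^ i mod Q = ((g ^ card res) ^ (i div card res) mod Q) * g ^ (i mod card res) mod Q"
      by (simp add: mod_mult_left_eq)
    also have "(g ^ card res) ^ (i div card res) mod Q = (g ^ card res mod Q) ^ (i div card res) mod Q"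
      by (simp add: power_mod)
    finally have "r = g ^ (i mod card res) mod Q" using i pow1 mod_eq_self[OF one_in] by simp
    then show "r \<in> (\<lambda>i. g ^ i mod Q) ` {..<card res}" using card_res_pos by auto
  qed
  moreover have gn: "\<not> Q dvd g" using g(1) carr res_not_dvd by auto
  have "\<not> Q dvd g ^ i" for i
    by (induction i) (use gn irr dvd_multD in \<open>auto simp: irreducible_def\<close>)
  then have "(\<lambda>i. g ^ i mod Q) ` {..<card res} \<subseteq> res" using mod_in_res by auto
  ultimately have img: "(\<lambda>i. g ^ i mod Q) ` {..<card res} = res" by blast
  then have "inj_on (\<lambda>i. g ^ i mod Q) {..<card res}" by (intro eq_card_imp_inj_on) auto
  then show ?thesis using that gn pow1 img by (auto simp: bij_betw_def)
qed

text \<open>Each invertible class contains exactly one element of \<open>res\<close>, the remainder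
  of any of its members modulo \<open>Q\<close>.\<close>

lemma poly_phi_eq_card_res: "poly_phi Q = card res"
proof -
  let ?E = "{(A, B). Q dvd A - B}"
  have E: "equiv UNIV ?E"
  proof (rule equivI)
    show "refl ?E" by (auto intro: refl_onI)
    show "sym ?E" by (auto intro!: symI simp: dvd_diff_commute)
    show "trans ?E"
    proof (rule transI, clarify)
      fix A B C assume "Q dvd A - B" "Q dvd B - C"
      then have "Q dvd (A - B) + (B - C)" by (rule dvd_add)
      then show "Q dvd A - C" by simp
    qed
  qed auto
  have "bij_betw (\<lambda>r. ?E `` {r}) res {X \<in> UNIV // ?E. \<exists>A\<in>X. \<exists>B. Q dvd A * B - 1}"
    unfolding bij_betw_def
  proof (intro conjI equalityI subsetI)
    show "inj_on (\<lambda>r. ?E `` {r}) res"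
    proof (rule inj_onI)
      fix r s assume rs: "r \<in> res" "s \<in> res" "?E `` {r} = ?E `` {s}"
      then have "Q dvd r - s" using eq_equiv_class[OF rs(3) E] by simp
      moreover have "r - s \<in> polys_below d" using rs by (simp add: res_def polys_below_diff)
      ultimately show "r = s" using dvd_polys_below by fastforce
    qed
  next
    fix X assume "X \<in> (\<lambda>r. ?E `` {r}) ` res"
    then obtain r where r: "r \<in> res" "X = ?E `` {r}" by blast
    obtain B where "Q dvd r * B - 1" using res_inverse res_not_dvd r(1) by metis
    moreover have "r \<in> X" using r by simp
    moreover have "X \<in> UNIV // ?E" unfolding r(2) by (rule quotientI) simp
    ultimately show "X \<in> {X \<in> UNIV // ?E. \<exists>A\<in>X. \<exists>B. Q dvd A * B - 1}" by blast
  next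
    fix X assume "X \<in> {X \<in> UNIV // ?E. \<exists>A\<in>X. \<exists>B. Q dvd A * B - 1}"
    then obtain A B where X: "X \<in> UNIV // ?E" "A \<in> X" "Q dvd A * B - 1" by blast
    have "\<not> Q dvd A"
    proof
      assume "Q dvd A"
      then have "Q dvd A * B - (A * B - 1)" using X(3) by (meson dvd_diff dvd_mult2)
      then show False using irr by (simp add: irreducible_def)
    qed
    then have r: "A mod Q \<in> res" by (rule mod_in_res)
    obtain C where C: "X = ?E `` {C}" using X(1) by (rule quotientE)
    then have "(C, A) \<in> ?E" using X(2) by simp
    then have "X = ?E `` {A}" unfolding C by (rule equiv_class_eq[OF E])
    also have "\<dots> = ?E `` {A mod Q}"
      by (rule equiv_class_eq[OF E]) (simp add: dvd_minus_mod)
    finally show "X \<in> (\<lambda>r. ?E `` {r}) ` res" using r by blast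
  qed
  then show ?thesis unfolding poly_phi_def by (rule bij_betw_same_card[symmetric])
qed

section \<open>Classification of the characters by their value at a generator\<close>

lemma character_one:
  assumes "dirichlet_character Q \<psi>"
  shows "\<psi> 1 = 1"
proof -
  have "\<psi> 1 \<noteq> 0" using assms by (simp add: dirichlet_character_def)
  moreover have "\<psi> (1 * 1) = \<psi> 1 * \<psi> 1" using assms unfolding dirichlet_character_def by blast
  ultimately show ?thesis by simp
qed

lemma character_power: "dirichlet_character Q \<psi> \<Longrightarrow> \<psi> (A ^ n) = \<psi> A ^ n"
  by (induction n) (simp_all add: character_one, simp add: dirichlet_character_def)

lemma character_mod: "dirichlet_character Q \<psi> \<Longrightarrow> \<psi> (A mod Q) = \<psi> A"
  by (erule dirichlet_character_cong) (metis dvd_diff_commute dvd_minus_mod)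

lemma character_zero_iff: "dirichlet_character Q \<psi> \<Longrightarrow> \<psi> A = 0 \<longleftrightarrow> Q dvd A"
  using coprime_Q_iff[of A] unfolding dirichlet_character_def by blast

text \<open>The discrete logarithm to base \<open>g\<close> is determined modulo
  \<open>card res\<close>, and so is the exponent of \<open>z\<close>. This makes the map from
  \<open>g ^ i\<close> to \<open>z ^ i\<close> well defined.\<close>

lemma primitive_root_power_eq:
  assumes g: "\<not> Q dvd g" "bij_betw (\<lambda>i. g ^ i mod Q) {..<card res} res" "g ^ card res mod Q = 1"
    and z: "z ^ card res = (1::complex)" and ij: "g ^ i mod Q = g ^ j mod Q"
  shows "z ^ i = z ^ j"
proof -
  define N where "N = card res"
  have N: "N > 0" using card_res_pos by (simp add: N_def)
  have red: "g ^ i mod Q = g ^ (i mod N) mod Q" for i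
  proof -
    have "g ^ i = (g ^ N) ^ (i div N) * g ^ (i mod N)"
      by (simp flip: power_mult power_add)
    then have "g ^ i mod Q = ((g ^ N) ^ (i div N) mod Q) * g ^ (i mod N) mod Q"
      by (simp add: mod_mult_left_eq)
    also have "(g ^ N) ^ (i div N) mod Q = (g ^ N mod Q) ^ (i div N) mod Q"
      by (simp add: power_mod)
    finally show ?thesis using g(3) mod_eq_self[OF one_in] by (simp add: N_def)
  qed
  have zred: "z ^ i = z ^ (i mod N)" for i
  proof -
    have "z ^ i = (z ^ N) ^ (i div N) * z ^ (i mod N)"
      by (simp flip: power_mult power_add)
    then show ?thesis using z by (simp add: N_def)
  qed
  have "g ^ (i mod N) mod Q = g ^ (j mod N) mod Q" using ij red by metis
  then have "i mod N = j mod N"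
    using bij_betw_imp_inj_on[OF g(2)] N unfolding N_def inj_on_def by auto
  then show ?thesis using zred by metis
qed

lemma primitive_root_surj:
  assumes "bij_betw (\<lambda>i. g ^ i mod Q) {..<card res} res" "\<not> Q dvd A"
  shows "\<exists>i. A mod Q = g ^ i mod Q"
proof -
  have "A mod Q \<in> (\<lambda>i. g ^ i mod Q) ` {..<card res}"
    using mod_in_res[OF assms(2)] bij_betw_imp_surj_on[OF assms(1)] by simp
  then show ?thesis by blast
qed

text \<open>Multiplicativity fixes a character by its value at \<open>g\<close>, which must be a
  root of unity; conversely every root of unity \<open>z\<close> extends to the character sending
  \<open>g ^ i\<close> to \<open>z ^ i\<close>.\<close>

lemma bij_betw_characters:
  assumes g: "\<not> Q dvd g" "bij_betw (\<lambda>i. g ^ i mod Q) {..<card res} res" "g ^ card res mod Q = 1"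
  shows "bij_betw (\<lambda>\<psi>. \<psi> g) {\<psi>. dirichlet_character Q \<psi>} {z. z ^ card res = 1}"
  unfolding bij_betw_def
proof (intro conjI equalityI subsetI)
  note surj = primitive_root_surj[OF g(2)]
  show "inj_on (\<lambda>\<psi>. \<psi> g) {\<psi>. dirichlet_character Q \<psi>}"
  proof (rule inj_onI, rule ext)
    fix \<psi> \<theta> A assume a: "\<psi> \<in> {\<psi>. dirichlet_character Q \<psi>}" "\<theta> \<in> {\<psi>. dirichlet_character Q \<psi>}" "\<psi> g = \<theta> g"
    show "\<psi> A = \<theta> A"
    proof (cases "Q dvd A")
      case True
      then have "\<psi> A = 0" "\<theta> A = 0" using a by (simp_all add: character_zero_iff)
      then show ?thesis by simp
    next
      case False
      then obtain i where i: "A mod Q = g ^ i mod Q" using surj by blast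
      have "\<omega> A = \<omega> g ^ i" if "dirichlet_character Q \<omega>" for \<omega>
        using character_mod[OF that, of A] character_mod[OF that, of "g ^ i"] i character_power[OF that]
        by simp
      from this[of \<psi>] this[of \<theta>] show ?thesis using a by simp
    qed
  qed
  fix z assume "z \<in> (\<lambda>\<psi>. \<psi> g) ` {\<psi>. dirichlet_character Q \<psi>}"
  then obtain \<psi> where \<psi>: "dirichlet_character Q \<psi>" "z = \<psi> g" by blast
  have "z ^ card res = \<psi> (g ^ card res mod Q)"
    using \<psi> by (simp add: character_mod character_power)
  then show "z \<in> {z. z ^ card res = 1}" using g(3) \<psi> character_one by simp
next
  note surj = primitive_root_surj[OF g(2)]
  have gpow: "\<not> Q dvd g ^ i" for i
    by (induction i) (use g irr dvd_multD in \<open>auto simp: irreducible_def\<close>)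
  fix z :: complex assume "z \<in> {z. z ^ card res = 1}"
  then have z: "z ^ card res = 1" by simp
  then have z0: "z \<noteq> 0" using card_res_pos by (metis power_0_left not_gr_zero zero_neq_one)
  \<comment> \<open>An arbitrary discrete logarithm of \<open>A\<close>. The choice looks only at
    \<open>A mod Q\<close>, so periodicity is automatic; \<open>zind\<close> shows that powers of
    \<open>z\<close> do not depend on it.\<close>
  define ind where "ind A = (SOME i. A mod Q = g ^ i mod Q)" for A
  have ind: "A mod Q = g ^ ind A mod Q" if "\<not> Q dvd A" for A
    unfolding ind_def using someI_ex[OF surj[OF that]] .
  have zind: "z ^ ind A = z ^ i" if "A mod Q = g ^ i mod Q" for A i
  proof -
    have "\<not> Q dvd A" using that gpow[of i] by (simp add: dvd_eq_mod_eq_0)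
    then have "g ^ ind A mod Q = g ^ i mod Q" using ind that by simp
    then show ?thesis by (rule primitive_root_power_eq[OF g z])
  qed
  define \<psi> where "\<psi> A = (if Q dvd A then 0 else z ^ ind A)" for A
  have "dirichlet_character Q \<psi>"
    unfolding dirichlet_character_def
  proof (intro conjI allI)
    fix A B
    show "\<psi> (A + B * Q) = \<psi> A" by (simp add: \<psi>_def ind_def)
    show "\<psi> A \<noteq> 0 \<longleftrightarrow> coprime A Q" using z0 by (simp add: \<psi>_def coprime_Q_iff)
    show "\<psi> (A * B) = \<psi> A * \<psi> B"
    proof (cases "Q dvd A \<or> Q dvd B")
      case True
      then show ?thesis by (auto simp: \<psi>_def)
    next
      case False
      then have AB: "\<not> Q dvd A * B" using dvd_multD by blast
      have "A * B mod Q = (A mod Q) * (B mod Q) mod Q" by (simp add: mod_mult_eq)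
      also have "\<dots> = g ^ (ind A + ind B) mod Q"
        using ind False by (simp add: mod_mult_eq power_add)
      finally have "z ^ ind (A * B) = z ^ (ind A + ind B)" by (rule zind)
      then show ?thesis using AB False by (simp add: \<psi>_def power_add)
    qed
  qed
  moreover have "\<psi> g = z" using zind[of g 1] g(1) by (simp add: \<psi>_def)
  ultimately show "z \<in> (\<lambda>\<psi>. \<psi> g) ` {\<psi>. dirichlet_character Q \<psi>}" by blast
qed

lemma finite_characters: "finite {\<psi>. dirichlet_character Q \<psi>}"
proof -
  obtain g where g: "\<not> Q dvd g" "bij_betw (\<lambda>i. g ^ i mod Q) {..<card res} res" "g ^ card res mod Q = 1"
    using primitive_root by blast
  have "finite {z::complex. z ^ card res = 1}"
    by (rule finite_roots_unity) (use card_res_pos in simp)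
  then show ?thesis using bij_betw_finite[OF bij_betw_characters[OF g]] by simp
qed

lemma sum_res_character_powers:
  assumes "bij_betw (\<lambda>i. g ^ i mod Q) {..<card res} res" "dirichlet_character Q \<psi>"
  shows "(\<Sum>r\<in>res. f r * \<psi> r) = (\<Sum>i<card res. f (g ^ i mod Q) * \<psi> g ^ i)"
  using sum.reindex_bij_betw[OF assms(1), of "\<lambda>r. f r * \<psi> r"] assms(2)
  by (simp add: character_mod character_power)

text \<open>Evaluation at a generator turns the sum over characters into a sum over roots of unity,
  and the sum over residues into a polynomial in the root.\<close>

lemma parseval_characters:
  "(\<Sum>\<psi> | dirichlet_character Q \<psi>. (cmod (\<Sum>r\<in>res. f r * \<psi> r))\<^sup>2) =
    real (card res) * (\<Sum>r\<in>res. (cmod (f r))\<^sup>2)"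
proof -
  obtain g where g: "\<not> Q dvd g" "bij_betw (\<lambda>i. g ^ i mod Q) {..<card res} res" "g ^ card res mod Q = 1"
    using primitive_root by blast
  have "(\<Sum>\<psi> | dirichlet_character Q \<psi>. (cmod (\<Sum>r\<in>res. f r * \<psi> r))\<^sup>2) =
      (\<Sum>\<psi> | dirichlet_character Q \<psi>. (cmod (\<Sum>i<card res. f (g ^ i mod Q) * \<psi> g ^ i))\<^sup>2)"
    using sum_res_character_powers[OF g(2)] by (intro sum.cong) auto
  also have "\<dots> = (\<Sum>z | z ^ card res = 1. (cmod (\<Sum>i<card res. f (g ^ i mod Q) * z ^ i))\<^sup>2)"
    by (rule sum.reindex_bij_betw[OF bij_betw_characters[OF g]])
  also have "\<dots> = real (card res) * (\<Sum>i<card res. (cmod (f (g ^ i mod Q)))\<^sup>2)"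
    by (rule parseval_roots_unity)
  also have "(\<Sum>i<card res. (cmod (f (g ^ i mod Q)))\<^sup>2) = (\<Sum>r\<in>res. (cmod (f r))\<^sup>2)"
    by (rule sum.reindex_bij_betw[OF g(2)])
  finally show ?thesis .
qed

lemma trivial_character_is_character: "dirichlet_character Q (trivial_character Q)"
  unfolding dirichlet_character_def trivial_character_def coprime_Q_iff
  using dvd_multD by (auto simp: dvd_add_left_iff)

text \<open>Over the powers of a generator this is a full geometric series with ratio
  \<open>\<psi> g\<close>, a root of unity other than 1 because \<open>g\<close> separates the
  characters.\<close>

lemma sum_character_eq_0:
  assumes "dirichlet_character Q \<psi>" "\<psi> \<noteq> trivial_character Q"
  shows "(\<Sum>r\<in>res. \<psi> r) = 0"
proof -
  obtain g where g: "\<not> Q dvd g" "bij_betw (\<lambda>i. g ^ i mod Q) {..<card res} res" "g ^ card res mod Q = 1"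
    using primitive_root by blast
  note bij = bij_betw_characters[OF g]
  have "trivial_character Q g = 1" using g(1) by (simp add: trivial_character_def coprime_Q_iff)
  then have z: "\<psi> g \<noteq> 1" "\<psi> g ^ card res = 1"
    using bij assms trivial_character_is_character unfolding bij_betw_def inj_on_def by auto
  have "(\<Sum>r\<in>res. \<psi> r) = (\<Sum>i<card res. \<psi> g ^ i)"
    using sum_res_character_powers[OF g(2) assms(1), of "\<lambda>_. 1"] by simp
  also have "\<dots> = 0" using z by (simp add: geometric_sum)
  finally show ?thesis .
qed

lemma norm_character:
  assumes "dirichlet_character Q \<psi>" "\<not> Q dvd A"
  shows "cmod (\<psi> A) = 1"
proof -
  obtain g where g: "\<not> Q dvd g" "bij_betw (\<lambda>i. g ^ i mod Q) {..<card res} res" "g ^ card res mod Q = 1"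
    using primitive_root by blast
  obtain i where i: "A mod Q = g ^ i mod Q"
    using primitive_root_surj[OF g(2) assms(2)] by blast
  have "\<psi> g ^ card res = 1"
    using bij_betw_characters[OF g] assms(1) unfolding bij_betw_def by blast
  then have "cmod (\<psi> g ^ card res) = 1" by simp
  then have "cmod (\<psi> g) ^ card res = 1" by (simp add: norm_power)
  then have "cmod (\<psi> g) = 1"
    using power_eq_imp_eq_base[of "cmod (\<psi> g)" "card res" 1] card_res_pos by simp
  moreover have "\<psi> A = \<psi> g ^ i" using assms(1) i character_mod character_power by metis
  ultimately show ?thesis by (simp add: norm_power)
qed

section \<open>The fourth moment as a sum over residues\<close>

lemma ex1_residue_ratio:
  assumes "\<not> Q dvd A" "\<not> Q dvd B"
  shows "\<exists>!r. r \<in> res \<and> Q dvd A - r * B"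
proof (rule ex_ex1I)
  obtain C where C: "C \<in> res" "Q dvd B * C - 1" using res_inverse[OF assms(2)] by blast
  have "\<not> Q dvd A * C" using assms(1) C(1) dvd_multD res_not_dvd by blast
  then have r: "A * C mod Q \<in> res" by (rule mod_in_res)
  have "A - (A * C mod Q) * B = (A * C - A * C mod Q) * B - A * (B * C - 1)"
    by (simp add: algebra_simps)
  moreover have "Q dvd (A * C - A * C mod Q) * B" by (intro dvd_mult2 dvd_minus_mod)
  moreover have "Q dvd A * (B * C - 1)" using C(2) by (rule dvd_mult)
  ultimately have "Q dvd A - (A * C mod Q) * B" by (metis dvd_diff)
  then show "\<exists>r. r \<in> res \<and> Q dvd A - r * B" using r by blast
next
  fix r s assume rs: "r \<in> res \<and> Q dvd A - r * B" "s \<in> res \<and> Q dvd A - s * B"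
  have "Q dvd (A - s * B) - (A - r * B)" using rs by (meson dvd_diff)
  then have "Q dvd (r - s) * B" by (simp add: algebra_simps)
  then have "Q dvd r - s" using dvd_multD assms(2) by blast
  moreover have "r - s \<in> polys_below d" using rs by (simp add: res_def polys_below_diff)
  ultimately show "r = s" using dvd_polys_below by fastforce
qed

lemma sum_residue_ratio:
  assumes "\<not> Q dvd A" "\<not> Q dvd B" "s \<in> res" "Q dvd A - s * B"
  shows "(\<Sum>r\<in>res. if Q dvd A - r * B then f r else 0) = f s"
proof -
  have "(\<Sum>r\<in>res. if Q dvd A - r * B then f r else 0) = (\<Sum>r\<in>res. if r = s then f r else 0)"
    using ex1_residue_ratio[OF assms(1,2)] assms(3,4) by (intro sum.cong refl) metis
  then show ?thesis using assms(3) by (simp add: sum.delta)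
qed

definition monic_pairs :: "'a poly \<Rightarrow> nat \<Rightarrow> nat \<Rightarrow> ('a poly \<times> 'a poly) set" where
  "monic_pairs r n m = {(A, B). A \<in> monic_polys n \<and> B \<in> monic_polys m \<and> Q dvd A - r * B}"

lemma monic_not_dvd: "A \<in> monic_polys n \<Longrightarrow> n < d \<Longrightarrow> \<not> Q dvd A"
  using dvd_polys_below[of A] monic_polys_nonzero by (auto simp: monic_polys_def polys_below_iff)

end

text \<open>\<open>q\<close> and \<open>u = q^(-1/2)\<close> are parameters, so that constants
  expressed through them can be fixed before \<open>Q\<close> is. The weight
  \<open>|N|^(-1/2)\<close> becomes \<open>u ^ degree N\<close>.\<close>

locale irreducible_modulus_weight = irreducible_modulus Q
  for Q :: "'a::{field,finite} poly" +
  fixes q u :: real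
  assumes q_eq: "q = real CARD('a)" and u_eq: "u = 1 / sqrt q"
begin

lemma q_ge_2: "q \<ge> 2"
  using card_field_ge_2[where 'a = 'a] by (simp add: q_eq)

lemma q_pos: "q > 0" using q_ge_2 by simp

lemma u_pos: "u > 0" using q_pos by (simp add: u_eq)

lemma u_lt_1: "u < 1" using q_ge_2 by (simp add: u_eq)

lemma u_square: "u * u = 1 / q"
  using q_pos by (simp add: u_eq)

lemma q_u_u: "q * (u * u) = 1"
  using q_pos by (simp add: u_square)

definition pair_weight :: "'a poly \<Rightarrow> real" where
  "pair_weight r = (\<Sum>n<d. \<Sum>m<d. u ^ (n + m) * real (card (monic_pairs r n m)))"

lemma dirichlet_L_half:
  assumes "dirichlet_character Q \<psi>" "\<psi> \<noteq> trivial_character Q"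
  shows "dirichlet_L \<psi> (1/2) = (\<Sum>n<d. of_real (u ^ n) * (\<Sum>N\<in>monic_polys n. \<psi> N))"
proof -
  have "complex_of_real q powr (- (1/2)) = complex_of_real q powr complex_of_real (- (1/2))"
    by simp
  also have "\<dots> = complex_of_real (q powr (- (1/2)))"
    by (rule powr_of_real) (use q_pos in simp)
  also have "q powr (- (1/2)) = u"
    unfolding u_eq powr_minus powr_half_sqrt[OF less_imp_le[OF q_pos]] by (simp add: field_simps)
  finally show ?thesis
    using dirichlet_L_nontrivial(2)[OF assms Q_nonzero, of "1/2"] by (simp add: q_eq)
qed

text \<open>Monic polynomials of degree below \<open>d\<close> are units modulo \<open>Q\<close>, so
  each pair \<open>A\<close>, \<open>B\<close> has one ratio \<open>r\<close> in \<open>res\<close>,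
  and \<open>\<psi> A * cnj (\<psi> B) = \<psi> r\<close> because \<open>\<psi> B\<close> has
  absolute value 1.\<close>

lemma norm_dirichlet_L_square:
  assumes \<psi>: "dirichlet_character Q \<psi>" "\<psi> \<noteq> trivial_character Q"
  shows "complex_of_real ((cmod (dirichlet_L \<psi> (1/2)))\<^sup>2) = (\<Sum>r\<in>res. of_real (pair_weight r) * \<psi> r)"
proof -
  define F where "F n m = (\<Sum>A\<in>monic_polys n. \<Sum>B\<in>monic_polys m. \<psi> A * cnj (\<psi> B))" for n m
  have F: "F n m = (\<Sum>r\<in>res. of_nat (card (monic_pairs r n m)) * \<psi> r)" if "n < d" "m < d" for n m
  proof -
    have "\<psi> A * cnj (\<psi> B) = (\<Sum>r\<in>res. if Q dvd A - r * B then \<psi> r else 0)"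
      if "A \<in> monic_polys n" "B \<in> monic_polys m" for A B
    proof -
      have AB: "\<not> Q dvd A" "\<not> Q dvd B" using that \<open>n < d\<close> \<open>m < d\<close> monic_not_dvd by blast+
      then obtain s where s: "s \<in> res" "Q dvd A - s * B" using ex1_residue_ratio by blast
      have "\<psi> A = \<psi> (s * B)" by (rule dirichlet_character_cong[OF \<psi>(1) s(2)])
      also have "\<dots> = \<psi> s * \<psi> B" using \<psi>(1) by (simp add: dirichlet_character_def)
      finally have "\<psi> A * cnj (\<psi> B) = \<psi> s * (\<psi> B * cnj (\<psi> B))" by simp
      also have "\<psi> B * cnj (\<psi> B) = 1"
        using norm_character[OF \<psi>(1) AB(2)] complex_norm_square[of "\<psi> B"] by simp
      finally show ?thesis unfolding sum_residue_ratio[OF AB s] by simp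
    qed
    then have "F n m = (\<Sum>A\<in>monic_polys n. \<Sum>B\<in>monic_polys m. \<Sum>r\<in>res. if Q dvd A - r * B then \<psi> r else 0)"
      unfolding F_def by (intro sum.cong refl) auto
    also have "\<dots> = (\<Sum>p\<in>monic_polys n \<times> monic_polys m. \<Sum>r\<in>res. if Q dvd fst p - r * snd p then \<psi> r else 0)"
      by (subst sum.cartesian_product) (simp add: case_prod_beta)
    also have "\<dots> = (\<Sum>r\<in>res. \<Sum>p\<in>monic_polys n \<times> monic_polys m. if Q dvd fst p - r * snd p then \<psi> r else 0)"
      by (rule sum.swap)
    also have "\<dots> = (\<Sum>r\<in>res. of_nat (card (monic_pairs r n m)) * \<psi> r)"
    proof (rule sum.cong[OF refl])
      fix r
      have "(\<Sum>p\<in>monic_polys n \<times> monic_polys m. if Q dvd fst p - r * snd p then \<psi> r else 0)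
        = (\<Sum>p | p \<in> monic_polys n \<times> monic_polys m \<and> Q dvd fst p - r * snd p. \<psi> r)"
        by (rule sum.inter_filter[symmetric]) simp
      also have "{p. p \<in> monic_polys n \<times> monic_polys m \<and> Q dvd fst p - r * snd p} = monic_pairs r n m"
        by (auto simp: monic_pairs_def)
      finally show "(\<Sum>p\<in>monic_polys n \<times> monic_polys m. if Q dvd fst p - r * snd p then \<psi> r else 0)
        = of_nat (card (monic_pairs r n m)) * \<psi> r" by simp
    qed
    finally show ?thesis .
  qed
  have F_prod: "F n m = (\<Sum>A\<in>monic_polys n. \<psi> A) * cnj (\<Sum>B\<in>monic_polys m. \<psi> B)" for n m
    unfolding F_def cnj_sum sum_product ..
  let ?L = "dirichlet_L \<psi> (1/2)"
  have "complex_of_real ((cmod ?L)\<^sup>2) = ?L * cnj ?L"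
    by (rule complex_norm_square)
  also have "\<dots> = (\<Sum>n<d. \<Sum>m<d. of_real (u ^ (n + m)) * F n m)"
    unfolding dirichlet_L_half[OF \<psi>] F_prod cnj_sum[of _ "{..<d}"] sum_product[of _ "{..<d}"]
    by (intro sum.cong refl) (simp add: power_add mult_ac)
  also have "\<dots> = (\<Sum>n<d. \<Sum>m<d. \<Sum>r\<in>res. of_real (u ^ (n + m) * real (card (monic_pairs r n m))) * \<psi> r)"
    by (intro sum.cong refl) (simp add: F sum_distrib_left mult.assoc)
  also have "\<dots> = (\<Sum>n<d. \<Sum>r\<in>res. \<Sum>m<d. of_real (u ^ (n + m) * real (card (monic_pairs r n m))) * \<psi> r)"
    by (intro sum.cong refl sum.swap)
  also have "\<dots> = (\<Sum>r\<in>res. \<Sum>n<d. \<Sum>m<d. of_real (u ^ (n + m) * real (card (monic_pairs r n m))) * \<psi> r)"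
    by (rule sum.swap)
  also have "\<dots> = (\<Sum>r\<in>res. of_real (pair_weight r) * \<psi> r)"
    unfolding pair_weight_def of_real_sum sum_distrib_right ..
  finally show ?thesis .
qed

text \<open>Nontrivial characters sum to zero over \<open>res\<close> and so annihilate
  \<open>K\<close>. Parseval's identity covers all characters; the subtracted square is the
  contribution of the trivial one.\<close>

theorem fourth_moment_eq:
  assumes v: "\<And>r. r \<in> res \<Longrightarrow> pair_weight r = K + v r"
  shows "(\<Sum>\<psi> | dirichlet_character Q \<psi> \<and> \<psi> \<noteq> trivial_character Q. cmod (dirichlet_L \<psi> (1/2)) ^ 4) =
    real (card res) * (\<Sum>r\<in>res. (v r)\<^sup>2) - (\<Sum>r\<in>res. v r)\<^sup>2"
proof -
  let ?X = "{\<psi>. dirichlet_character Q \<psi>}"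
  let ?t = "trivial_character Q"
  let ?S = "\<lambda>\<psi>. \<Sum>r\<in>res. of_real (v r) * \<psi> r"
  have "cmod (dirichlet_L \<psi> (1/2)) ^ 4 = (cmod (?S \<psi>))\<^sup>2" if "\<psi> \<in> ?X - {?t}" for \<psi>
  proof -
    have \<psi>: "dirichlet_character Q \<psi>" "\<psi> \<noteq> ?t" using that by auto
    have "(\<Sum>r\<in>res. of_real (pair_weight r) * \<psi> r) = (\<Sum>r\<in>res. of_real K * \<psi> r + of_real (v r) * \<psi> r)"
      by (intro sum.cong refl) (simp add: v algebra_simps)
    also have "\<dots> = of_real K * (\<Sum>r\<in>res. \<psi> r) + ?S \<psi>"
      by (simp add: sum.distrib sum_distrib_left)
    finally have "complex_of_real ((cmod (dirichlet_L \<psi> (1/2)))\<^sup>2) = ?S \<psi>"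
      using norm_dirichlet_L_square[OF \<psi>] sum_character_eq_0[OF \<psi>] by simp
    then have "cmod (?S \<psi>) = (cmod (dirichlet_L \<psi> (1/2)))\<^sup>2"
      by (metis norm_of_real abs_power2)
    then show ?thesis by (simp flip: power_mult)
  qed
  then have "(\<Sum>\<psi>\<in>?X - {?t}. cmod (dirichlet_L \<psi> (1/2)) ^ 4) = (\<Sum>\<psi>\<in>?X - {?t}. (cmod (?S \<psi>))\<^sup>2)"
    by (rule sum.cong[OF refl])
  also have "\<dots> = (\<Sum>\<psi>\<in>?X. (cmod (?S \<psi>))\<^sup>2) - (cmod (?S ?t))\<^sup>2"
    using finite_characters trivial_character_is_character by (simp add: sum_diff1)
  also have "(\<Sum>\<psi>\<in>?X. (cmod (?S \<psi>))\<^sup>2) = real (card res) * (\<Sum>r\<in>res. (v r)\<^sup>2)"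
    using parseval_characters[of "\<lambda>r. of_real (v r)"] by simp
  also have "?S ?t = of_real (\<Sum>r\<in>res. v r)"
    unfolding of_real_sum
    by (intro sum.cong refl) (simp add: trivial_character_def coprime_Q_iff res_not_dvd)
  also have "{\<psi>. dirichlet_character Q \<psi>} - {?t} = {\<psi>. dirichlet_character Q \<psi> \<and> \<psi> \<noteq> ?t}" by auto
  finally show ?thesis by (simp del: of_real_sum)
qed

end

section \<open>Duality for monic pairs\<close>

text \<open>A nonempty fibre is a translate of the kernel. Closure of \<open>S\<close> under
  differences is all that makes it a subgroup here.\<close>

lemma card_additive_fiber:
  fixes T :: "'v::ab_group_add \<Rightarrow> 'w::ab_group_add"
  assumes diff: "\<And>x y. x \<in> S \<Longrightarrow> y \<in> S \<Longrightarrow> x - y \<in> S"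
    and T: "\<And>x y. x \<in> S \<Longrightarrow> y \<in> S \<Longrightarrow> T (x - y) = T x - T y"
    and c: "c \<in> T ` S"
  shows "card {x \<in> S. T x = c} = card {x \<in> S. T x = 0}"
proof -
  obtain a where a: "a \<in> S" "T a = c" using c by blast
  have "a - a \<in> S" "T (a - a) = T a - T a" using a diff T by blast+
  then have z: "0 \<in> S" "T 0 = 0" by simp_all
  have add: "x + a \<in> S" "T (x + a) = T x + c" if "x \<in> S" for x
    using diff[OF that diff[OF z(1) a(1)]] T[OF that diff[OF z(1) a(1)]] T[OF z(1) a(1)] z a by simp_all
  have "bij_betw (\<lambda>x. x - a) {x \<in> S. T x = c} {x \<in> S. T x = 0}"
    by (rule bij_betwI[where g = "\<lambda>x. x + a"]) (use a diff T add in auto)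
  then show ?thesis by (rule bij_betw_same_card)
qed

lemma card_additive_image:
  fixes T :: "'v::ab_group_add \<Rightarrow> 'w::ab_group_add"
  assumes fin: "finite S"
    and diff: "\<And>x y. x \<in> S \<Longrightarrow> y \<in> S \<Longrightarrow> x - y \<in> S"
    and T: "\<And>x y. x \<in> S \<Longrightarrow> y \<in> S \<Longrightarrow> T (x - y) = T x - T y"
  shows "card S = card (T ` S) * card {x \<in> S. T x = 0}"
proof -
  have "card S = (\<Sum>c\<in>T ` S. card {x \<in> S. T x = c})"
    using sum.group[of S "T ` S" T "\<lambda>_. 1::nat"] fin by simp
  also have "\<dots> = (\<Sum>c\<in>T ` S. card {x \<in> S. T x = 0})"
    by (intro sum.cong refl card_additive_fiber diff T)
  finally show ?thesis by simp
qed

text \<open>A nonzero functional on a space closed under scalars is onto, so its \<open>q\<close>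
  level sets all have the size of its kernel.\<close>

lemma card_linear_functional:
  fixes \<phi> :: "'v::ab_group_add \<Rightarrow> 'a::{field,finite}"
  assumes fin: "finite S"
    and diff: "\<And>x y. x \<in> S \<Longrightarrow> y \<in> S \<Longrightarrow> x - y \<in> S"
    and T: "\<And>x y. x \<in> S \<Longrightarrow> y \<in> S \<Longrightarrow> \<phi> (x - y) = \<phi> x - \<phi> y"
    and sc: "\<And>c x. x \<in> S \<Longrightarrow> \<exists>y\<in>S. \<phi> y = c * \<phi> x"
    and x: "x \<in> S" "\<phi> x \<noteq> 0"
  shows "card S = CARD('a) * card {y \<in> S. \<phi> y = c}"
proof -
  have "\<phi> ` S = UNIV"
  proof (intro equalityI subsetI UNIV_I)
    fix b obtain y where "y \<in> S" "\<phi> y = (b / \<phi> x) * \<phi> x" using sc[OF x(1)] by blast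
    then show "b \<in> \<phi> ` S" using x(2) by (intro image_eqI[of _ _ y]) auto
  qed
  then show ?thesis
    using card_additive_image[OF fin diff T] card_additive_fiber[of S \<phi> c, OF diff T] by simp
qed

section \<open>A bilinear form on residues and its annihilators\<close>

context irreducible_modulus
begin

text \<open>Up to the leading coefficient of \<open>Q\<close>, this is the coefficient of
  \<open>1/x\<close> in the expansion of \<open>X Y / Q\<close> at infinity. Multiplication by a
  fixed polynomial is self-adjoint for it.\<close>

definition pairing :: "'a poly \<Rightarrow> 'a poly \<Rightarrow> 'a" where
  "pairing X Y = coeff (X * Y mod Q) (d - 1)"

lemma pairing_commute: "pairing X Y = pairing Y X"
  by (simp add: pairing_def mult.commute)

lemma pairing_diff: "pairing (X - Y) Z = pairing X Z - pairing Y Z"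
  by (simp add: pairing_def left_diff_distrib poly_mod_diff_left)

lemma pairing_smult: "pairing (smult c X) Z = c * pairing X Z"
  by (simp add: pairing_def mod_smult_left)

lemma pairing_mod: "pairing (X mod Q) Y = pairing X Y"
  by (simp add: pairing_def mod_mult_left_eq)

lemma pairing_mult: "pairing (r * X) Y = pairing X (r * Y mod Q)"
  by (simp add: pairing_def mod_mult_right_eq mult_ac)

lemma pairing_monom:
  assumes "Y \<in> polys_below (d - m)" "m < d"
  shows "pairing (monom 1 m) Y = coeff Y (d - 1 - m)"
proof -
  have "monom 1 m * Y \<in> polys_below d"
    using assms by (auto simp: polys_below_def coeff_monom_mult)
  then show ?thesis using assms(2) by (simp add: pairing_def mod_eq_self coeff_monom_mult)
qed

text \<open>If the degrees are below \<open>n\<close> and \<open>d - n\<close>, the product has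
  degree at most \<open>d - 2\<close>: nothing is reduced modulo \<open>Q\<close> and the
  coefficient read off is zero.\<close>

lemma pairing_annihilator_polys_below:
  assumes "Y \<in> polys_below d" "n \<le> d"
  shows "(\<forall>X\<in>polys_below n. pairing X Y = 0) \<longleftrightarrow> Y \<in> polys_below (d - n)"
proof
  assume Y: "Y \<in> polys_below (d - n)"
  show "\<forall>X\<in>polys_below n. pairing X Y = 0"
  proof
    fix X :: "'a poly" assume X: "X \<in> polys_below n"
    have "X * Y \<in> polys_below (d - 1)"
    proof (cases "X = 0 \<or> Y = 0")
      case False
      then show ?thesis using X Y by (auto simp: polys_below_iff degree_mult_eq)
    qed auto
    then have "X * Y \<in> polys_below d" "coeff (X * Y) (d - 1) = 0"
      using polys_below_mono[of "d - 1" d] by (auto simp: polys_below_def)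
    then show "pairing X Y = 0" by (simp add: pairing_def mod_eq_self)
  qed
next
  assume *: "\<forall>X\<in>polys_below n. pairing X Y = 0"
  show "Y \<in> polys_below (d - n)"
  proof (rule ccontr)
    assume "Y \<notin> polys_below (d - n)"
    then have Y: "Y \<noteq> 0" "degree Y \<ge> d - n" "degree Y < d" using assms(1) by (auto simp: polys_below_iff)
    \<comment> \<open>This shift moves the leading coefficient of \<open>Y\<close> exactly to
      position \<open>d - 1\<close>.\<close>
    define m where "m = d - 1 - degree Y"
    have m: "m < d" "d - 1 - m = degree Y" "degree Y < d - m" using Y(3) by (auto simp: m_def)
    have "m < n" using Y m by linarith
    then have "(monom 1 m :: 'a poly) \<in> polys_below n" by (auto simp: polys_below_def)
    then have "pairing (monom 1 m) Y = 0" using * by blast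
    moreover have "Y \<in> polys_below (d - m)" using m(3) by (simp add: polys_below_iff)
    ultimately show False using pairing_monom[of Y m] m Y(1) by simp
  qed
qed

definition annihilator :: "'a poly set \<Rightarrow> 'a poly set" where
  "annihilator U = {Y \<in> polys_below d. \<forall>X\<in>U. pairing X Y = 0}"

lemma annihilator_diff: "X \<in> annihilator U \<Longrightarrow> Y \<in> annihilator U \<Longrightarrow> X - Y \<in> annihilator U"
  by (simp add: annihilator_def polys_below_diff pairing_diff pairing_commute[of _ "X - Y"] pairing_commute[of X]
      pairing_commute[of Y])

lemma annihilator_smult: "X \<in> annihilator U \<Longrightarrow> smult c X \<in> annihilator U"
  by (simp add: annihilator_def polys_below_smult pairing_smult pairing_commute[of _ "smult c X"] pairing_commute[of X])

text \<open>Count the orthogonal pairs in \<open>U\<close> times the whole space in two ways. A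
  nonzero \<open>X\<close> is orthogonal to one \<open>q\<close>-th of the space, and a
  \<open>Y\<close> outside the annihilator is orthogonal to one \<open>q\<close>-th of
  \<open>U\<close>. The resulting equation is \<open>q - 1\<close> times the claim.\<close>

lemma card_annihilator:
  assumes U: "U \<subseteq> polys_below d" "0 \<in> U"
    and diff: "\<And>X Y. X \<in> U \<Longrightarrow> Y \<in> U \<Longrightarrow> X - Y \<in> U"
    and sm: "\<And>c X. X \<in> U \<Longrightarrow> smult c X \<in> U"
  shows "card U * card (annihilator U) = CARD('a) ^ d"
proof -
  let ?V = "polys_below d :: 'a poly set" and ?q = "CARD('a)"
  have finU: "finite U" by (rule finite_subset[OF U(1)]) simp
  have row: "?q * card {Y \<in> ?V. pairing X Y = 0} = (if X = 0 then ?q * ?q ^ d else ?q ^ d)" if "X \<in> U" for X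
  proof (cases "X = 0")
    case True
    then show ?thesis by (simp add: pairing_def card_polys_below)
  next
    case False
    have "X \<in> ?V" using that U by blast
    then have "\<not> (\<forall>Y\<in>?V. pairing Y X = 0)"
      using pairing_annihilator_polys_below[of X d] False by simp
    then obtain Y where Y: "Y \<in> ?V" "pairing X Y \<noteq> 0" by (auto simp: pairing_commute)
    have "card ?V = ?q * card {Y \<in> ?V. pairing X Y = 0}"
      by (rule card_linear_functional[where x = Y])
        (use Y polys_below_diff polys_below_smult in \<open>auto simp: pairing_commute[of X] pairing_diff intro!: bexI[of _ "smult _ _"] simp: pairing_smult\<close>)
    then show ?thesis using False by (simp add: card_polys_below)
  qed
  have col: "?q * card {X \<in> U. pairing X Y = 0} = (if Y \<in> annihilator U then ?q * card U else card U)"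
    if YV: "Y \<in> ?V" for Y
  proof (cases "Y \<in> annihilator U")
    case True
    then have "{X \<in> U. pairing X Y = 0} = U" by (auto simp: annihilator_def)
    then show ?thesis using True by simp
  next
    case False
    then obtain X where X: "X \<in> U" "pairing X Y \<noteq> 0" using YV by (auto simp: annihilator_def)
    have "card U = ?q * card {X \<in> U. pairing X Y = 0}"
      by (rule card_linear_functional[where x = X])
        (use X diff sm finU in \<open>auto simp: pairing_diff intro!: bexI[of _ "smult _ _"] simp: pairing_smult\<close>)
    then show ?thesis using False by simp
  qed
  have "(\<Sum>X\<in>U. card {Y \<in> ?V. pairing X Y = 0}) = (\<Sum>Y\<in>?V. card {X \<in> U. pairing X Y = 0})"
    using sum_multicount_gen[of U ?V "\<lambda>X Y. pairing X Y = 0" "\<lambda>Y. card {X \<in> U. pairing X Y = 0}"] finU by auto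
  then have "(\<Sum>X\<in>U. ?q * card {Y \<in> ?V. pairing X Y = 0}) = (\<Sum>Y\<in>?V. ?q * card {X \<in> U. pairing X Y = 0})"
    by (simp flip: sum_distrib_left)
  then have "(\<Sum>X\<in>U. if X = 0 then ?q * ?q ^ d else ?q ^ d) =
      (\<Sum>Y\<in>?V. if Y \<in> annihilator U then ?q * card U else card U)"
    by (simp only: row col cong: sum.cong)
  moreover have "(\<Sum>X\<in>U. if X = 0 then ?q * ?q ^ d else ?q ^ d) = ?q * ?q ^ d + (card U - 1) * ?q ^ d"
    using finU U(2) by (simp add: sum.remove[of U 0])
  moreover have "(\<Sum>Y\<in>?V. if Y \<in> annihilator U then ?q * card U else card U) =
      card (annihilator U) * (?q * card U) + (?q ^ d - card (annihilator U)) * card U"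
  proof -
    have sub: "annihilator U \<subseteq> ?V" by (auto simp: annihilator_def)
    then have "?V \<inter> {Y. Y \<in> annihilator U} = annihilator U" "?V \<inter> - {Y. Y \<in> annihilator U} = ?V - annihilator U"
      by auto
    then show ?thesis
      using sub by (simp add: sum.If_cases card_Diff_subset finite_subset[OF sub] card_polys_below)
  qed
  ultimately have eq: "?q * ?q ^ d + (card U - 1) * ?q ^ d =
      card (annihilator U) * (?q * card U) + (?q ^ d - card (annihilator U)) * card U" by simp
  have "card (annihilator U) \<le> card ?V" by (intro card_mono) (auto simp: annihilator_def)
  then have le: "card (annihilator U) \<le> ?q ^ d" by (simp add: card_polys_below)
  have "card U \<ge> 1" using finU U(2) by (simp add: Suc_le_eq card_gt_0_iff) auto
  then have "real ?q * real ?q ^ d + (real (card U) - 1) * real ?q ^ d =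
      real (card (annihilator U)) * (real ?q * real (card U)) + (real ?q ^ d - real (card (annihilator U))) * real (card U)"
    using arg_cong[OF eq, of real] le by (simp add: of_nat_diff)
  then have "(real ?q - 1) * (real (card U) * real (card (annihilator U))) = (real ?q - 1) * real ?q ^ d"
    by (simp add: algebra_simps)
  then have "real (card U) * real (card (annihilator U)) = real ?q ^ d"
    using card_field_ge_2[where 'a = 'a] by simp
  then show ?thesis by (metis of_nat_eq_iff of_nat_mult of_nat_power)
qed

text \<open>One inclusion is immediate from symmetry of the pairing, and the two cardinalities
  agree.\<close>

lemma double_annihilator:
  assumes U: "U \<subseteq> polys_below d" "0 \<in> U"
    and diff: "\<And>X Y. X \<in> U \<Longrightarrow> Y \<in> U \<Longrightarrow> X - Y \<in> U"
    and sm: "\<And>c X. X \<in> U \<Longrightarrow> smult c X \<in> U"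
  shows "annihilator (annihilator U) = U"
proof (rule sym, rule card_subset_eq)
  have "card (annihilator U) * card (annihilator (annihilator U)) = CARD('a) ^ d"
    by (rule card_annihilator)
      (auto simp: annihilator_diff annihilator_smult, auto simp: annihilator_def pairing_def)
  moreover have "card (annihilator U) * card U = CARD('a) ^ d"
    using card_annihilator[OF U diff sm] by (simp add: mult.commute)
  moreover have "CARD('a) ^ d \<noteq> 0" by simp
  ultimately show "card U = card (annihilator (annihilator U))"
    by (metis mult_cancel1 mult_0)
  show "U \<subseteq> annihilator (annihilator U)"
    using U(1) by (auto simp: annihilator_def pairing_commute)
  show "finite (annihilator (annihilator U))" by (simp add: annihilator_def)
qed

end

lemma coeff_mult_at_sum:
  fixes A B :: "'a::comm_semiring_0 poly"
  assumes "degree A \<le> n" "degree B \<le> m"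
  shows "coeff (A * B) (n + m) = coeff A n * coeff B m"
proof -
  have "coeff (A * B) (n + m) = (\<Sum>i\<le>n + m. if i = n then coeff A n * coeff B m else 0)"
    unfolding coeff_mult
  proof (rule sum.cong[OF refl])
    fix i
    show "coeff A i * coeff B (n + m - i) = (if i = n then coeff A n * coeff B m else 0)"
      using assms coeff_eq_0[of A i] coeff_eq_0[of B "n + m - i"]
      by (cases i n rule: linorder_cases) auto
  qed
  then show ?thesis by simp
qed

section \<open>Boxes in the lattice of a residue and their duals\<close>

context irreducible_modulus
begin

text \<open>The bounds are strict: pairs of degrees exactly \<open>n\<close> and \<open>m\<close>
  live in \<open>lattice r (Suc n) (Suc m)\<close>.\<close>

definition lattice :: "'a poly \<Rightarrow> nat \<Rightarrow> nat \<Rightarrow> ('a poly \<times> 'a poly) set" where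
  "lattice r n m = {(A, B). A \<in> polys_below n \<and> B \<in> polys_below m \<and> Q dvd A - r * B}"

lemma finite_lattice [simp]: "finite (lattice r n m)"
  by (rule finite_subset[of _ "polys_below n \<times> polys_below m"]) (auto simp: lattice_def)

lemma zero_in_lattice: "(0, 0) \<in> lattice r n m"
  by (simp add: lattice_def)

lemma lattice_diff: "x \<in> lattice r n m \<Longrightarrow> y \<in> lattice r n m \<Longrightarrow> x - y \<in> lattice r n m"
proof -
  have "Q dvd (A - C) - r * (B - D)" if "Q dvd A - r * B" "Q dvd C - r * D" for A B C D
    using dvd_diff[OF that] by (simp add: algebra_simps)
  then show "x \<in> lattice r n m \<Longrightarrow> y \<in> lattice r n m \<Longrightarrow> x - y \<in> lattice r n m"
    by (auto simp: lattice_def polys_below_diff)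
qed

lemma lattice_smult: "(A, B) \<in> lattice r n m \<Longrightarrow> (smult c A, smult c B) \<in> lattice r n m"
  by (auto simp: lattice_def polys_below_smult dvd_smult simp flip: smult_diff_right)

text \<open>The determinant of two lattice vectors is a multiple of \<open>Q\<close>. Whenever its
  degree is below \<open>d\<close> it must vanish, and the vectors are proportional; every later
  uniqueness statement rests on this.\<close>

lemma lattice_cross_dvd:
  assumes "Q dvd A - r * B" "Q dvd C - r * D"
  shows "Q dvd A * D - C * B"
proof -
  have "A * D - C * B = (A - r * B) * D - (C - r * D) * B" by (simp add: algebra_simps)
  then show ?thesis using assms by (metis dvd_diff dvd_mult2)
qed

text \<open>Up to a shift, monic pairs are a fibre of \<open>T (A, B) = (A - r B) mod Q\<close> on a
  box, hence either empty or as large as the kernel. The annihilator of the image of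
  \<open>T\<close> is the dual box \<open>L\<close>, which gives the size of the kernel; by double
  annihilation, the fibre is nonempty iff its target is orthogonal to \<open>L\<close>.\<close>

lemma card_monic_pairs_lattice:
  assumes n: "n < d" and m: "m < d" and nm: "d \<le> n + m"
  shows "card (monic_pairs r n m) =
    (if \<forall>(X, Y)\<in>lattice r (d - m) (d - n). coeff X (d - 1 - m) = coeff Y (d - 1 - n)
     then CARD('a) ^ (n + m - d) * card (lattice r (d - m) (d - n)) else 0)"
proof -
  let ?q = "CARD('a)"
  define S where "S = (polys_below n \<times> polys_below m :: ('a poly \<times> 'a poly) set)"
  define T where "T x = (fst x - r * snd x) mod Q" for x
  \<comment> \<open>Once the leading monomials are split off from a monic pair, the divisibility by
    \<open>Q\<close> says that \<open>T\<close> takes this value on the remaining lower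
    parts.\<close>
  define c where "c = (r * monom 1 m - monom 1 n) mod Q"
  define L where "L = lattice r (d - m) (d - n)"
  have finS: "finite S" and cardS: "card S = ?q ^ (n + m)"
    by (simp_all add: S_def card_cartesian_product card_polys_below power_add)
  have Sdiff: "x - y \<in> S" if "x \<in> S" "y \<in> S" for x y
    using that by (auto simp: S_def polys_below_diff)
  have Tdiff: "T (x - y) = T x - T y" for x y
    unfolding T_def poly_mod_diff_left[symmetric] by (simp add: algebra_simps)
  have zS: "0 \<in> S" and zT: "T 0 = 0" by (simp_all add: S_def T_def zero_prod_def)
  have im_sub: "T ` S \<subseteq> polys_below d" using mod_in_polys_below by (auto simp: T_def)
  have im_0: "0 \<in> T ` S" using zS zT by force
  have im_diff: "X - Y \<in> T ` S" if "X \<in> T ` S" "Y \<in> T ` S" for X Y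
  proof -
    obtain x y where "x \<in> S" "X = T x" "y \<in> S" "Y = T y" using \<open>X \<in> T ` S\<close> \<open>Y \<in> T ` S\<close> by blast
    then show ?thesis using Tdiff[of x y] Sdiff[of x y] by (intro image_eqI[of _ _ "x - y"]) auto
  qed
  have im_smult: "smult b X \<in> T ` S" if "X \<in> T ` S" for b X
  proof -
    obtain x where x: "x \<in> S" "X = T x" using \<open>X \<in> T ` S\<close> by blast
    then have "smult b X = T (smult b (fst x), smult b (snd x))"
      by (simp add: T_def smult_diff_right flip: mod_smult_left)
    moreover have "(smult b (fst x), smult b (snd x)) \<in> S" using x by (auto simp: S_def polys_below_smult)
    ultimately show ?thesis by blast
  qed
  \<comment> \<open>Test on the two coordinate axes of the box: the first bounds the degree of
    \<open>Y\<close>, the second, by self-adjointness, that of \<open>r * Y mod Q\<close>.\<close>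
  have ann: "annihilator (T ` S) = {Y \<in> polys_below (d - n). r * Y mod Q \<in> polys_below (d - m)}"
  proof -
    have "(\<forall>X\<in>T ` S. pairing X Y = 0) \<longleftrightarrow>
        (\<forall>A\<in>polys_below n. pairing A Y = 0) \<and> (\<forall>B\<in>polys_below m. pairing B (r * Y mod Q) = 0)" for Y
    proof
      assume *: "\<forall>X\<in>T ` S. pairing X Y = 0"
      show "(\<forall>A\<in>polys_below n. pairing A Y = 0) \<and> (\<forall>B\<in>polys_below m. pairing B (r * Y mod Q) = 0)"
      proof (intro conjI ballI)
        fix A :: "'a poly" assume "A \<in> polys_below n"
        then have "T (A, 0) \<in> T ` S" by (simp add: S_def)
        then have "pairing (T (A, 0)) Y = 0" using * by blast
        then show "pairing A Y = 0" by (simp add: T_def pairing_mod)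
      next
        fix B :: "'a poly" assume "B \<in> polys_below m"
        then have "T (0, B) \<in> T ` S" by (simp add: S_def)
        then have "pairing (T (0, B)) Y = 0" using * by blast
        then have "pairing (0 - r * B) Y = 0" by (simp add: T_def pairing_mod del: poly_mod_minus_left)
        then have "pairing (r * B) Y = 0" unfolding pairing_diff by (simp add: pairing_def)
        then show "pairing B (r * Y mod Q) = 0" by (simp add: pairing_mult)
      qed
    next
      assume *: "(\<forall>A\<in>polys_below n. pairing A Y = 0) \<and> (\<forall>B\<in>polys_below m. pairing B (r * Y mod Q) = 0)"
      show "\<forall>X\<in>T ` S. pairing X Y = 0"
        using * by (auto simp: S_def T_def pairing_mod pairing_diff pairing_mult)
    qed
    then have "annihilator (T ` S) = {Y \<in> polys_below d. (\<forall>A\<in>polys_below n. pairing A Y = 0) \<and>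
        (\<forall>B\<in>polys_below m. pairing B (r * Y mod Q) = 0)}"
      unfolding annihilator_def by simp
    also have "\<dots> = {Y \<in> polys_below d. Y \<in> polys_below (d - n) \<and> r * Y mod Q \<in> polys_below (d - m)}"
      using pairing_annihilator_polys_below[of _ n] n
        pairing_annihilator_polys_below[OF mod_in_polys_below, of m] m by auto
    also have "\<dots> = {Y \<in> polys_below (d - n). r * Y mod Q \<in> polys_below (d - m)}"
      using polys_below_mono[of "d - n" d] by auto
    finally show ?thesis .
  qed
  have bijL: "bij_betw (\<lambda>Y. (r * Y mod Q, Y)) (annihilator (T ` S)) L"
  proof (rule bij_betwI[where g = snd])
    show "(\<lambda>Y. (r * Y mod Q, Y)) \<in> annihilator (T ` S) \<rightarrow> L"
      unfolding ann L_def lattice_def by (auto simp: mod_eq_dvd_iff[symmetric])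
    have key: "r * Y mod Q = X" if "(X, Y) \<in> L" for X Y
    proof -
      have "X \<in> polys_below (d - m)" "Q dvd X - r * Y" using that by (auto simp: L_def lattice_def)
      then have "X mod Q = r * Y mod Q" "X \<in> polys_below d"
        using polys_below_mono[of "d - m" d] by (auto simp: mod_eq_dvd_iff)
      then show ?thesis by (simp add: mod_eq_self)
    qed
    then show "snd \<in> L \<rightarrow> annihilator (T ` S)"
      unfolding ann by (auto simp: L_def lattice_def)
    show "(r * snd y mod Q, snd y) = y" if "y \<in> L" for y
      using key[of "fst y" "snd y"] that by (cases y) simp
  qed simp
  have cardL: "card (T ` S) * card L = ?q ^ d"
    using card_annihilator[OF im_sub im_0 im_diff im_smult] bij_betw_same_card[OF bijL] by simp
  have "card {x \<in> S. T x = 0} * ?q ^ d = (card {x \<in> S. T x = 0} * card (T ` S)) * card L"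
    by (simp add: cardL mult.assoc)
  also have "card {x \<in> S. T x = 0} * card (T ` S) = ?q ^ (n + m)"
    using card_additive_image[OF finS, of T] Sdiff Tdiff cardS by (simp add: mult.commute)
  also have "?q ^ (n + m) * card L = (?q ^ (n + m - d) * card L) * ?q ^ d"
    using nm by (simp add: mult_ac flip: power_add)
  finally have ker: "card {x \<in> S. T x = 0} = ?q ^ (n + m - d) * card L"
    by simp
  \<comment> \<open>Pairing with the two monomials that make up \<open>c\<close> reads off one
    coefficient each, so orthogonality to \<open>L\<close> is equality of the two top
    coefficients.\<close>
  have mem: "c \<in> T ` S \<longleftrightarrow> (\<forall>(X, Y)\<in>L. coeff X (d - 1 - m) = coeff Y (d - 1 - n))"
  proof -
    have pc: "pairing c Y = coeff (r * Y mod Q) (d - 1 - m) - coeff Y (d - 1 - n)"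
      if "Y \<in> polys_below (d - n)" "r * Y mod Q \<in> polys_below (d - m)" for Y
      using pairing_monom[OF that(1) n] pairing_monom[OF that(2) m]
      by (simp add: c_def pairing_mod pairing_diff pairing_mult)
    have "c \<in> T ` S \<longleftrightarrow> c \<in> annihilator (annihilator (T ` S))"
      using double_annihilator[OF im_sub im_0 im_diff im_smult] by simp
    also have "\<dots> \<longleftrightarrow> (\<forall>Y\<in>annihilator (T ` S). pairing c Y = 0)"
      using mod_in_polys_below unfolding annihilator_def[of "annihilator (T ` S)"] c_def
      by (auto simp: pairing_commute)
    also have "\<dots> \<longleftrightarrow> (\<forall>Y\<in>annihilator (T ` S). coeff (r * Y mod Q) (d - 1 - m) = coeff Y (d - 1 - n))"
      by (intro ball_cong refl) (auto simp: ann pc)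
    also have "\<dots> \<longleftrightarrow> (\<forall>(X, Y)\<in>(\<lambda>Y. (r * Y mod Q, Y)) ` annihilator (T ` S). coeff X (d - 1 - m) = coeff Y (d - 1 - n))"
      by simp
    finally show ?thesis using bij_betw_imp_surj_on[OF bijL] by simp
  qed
  have "bij_betw (\<lambda>x. (monom 1 n + fst x, monom 1 m + snd x)) {x \<in> S. T x = c} (monic_pairs r n m)"
  proof (rule bij_betwI[where g = "\<lambda>x. (fst x - monom 1 n, snd x - monom 1 m)"])
    have eq: "T x = c \<longleftrightarrow> Q dvd (monom 1 n + fst x) - r * (monom 1 m + snd x)" for x
      unfolding T_def c_def mod_eq_dvd_iff by (simp add: algebra_simps)
    have m1: "monom 1 n + A \<in> monic_polys n" if "A \<in> polys_below n" for A :: "'a poly" and n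
      using that by (simp add: monic_polys_eq)
    have m2: "A - monom 1 n \<in> polys_below n" if "A \<in> monic_polys n" for A :: "'a poly" and n
      using that by (auto simp: monic_polys_eq)
    show "(\<lambda>x. (monom 1 n + fst x, monom 1 m + snd x)) \<in> {x \<in> S. T x = c} \<rightarrow> monic_pairs r n m"
      unfolding eq by (auto simp: monic_pairs_def S_def m1)
    show "(\<lambda>x. (fst x - monom 1 n, snd x - monom 1 m)) \<in> monic_pairs r n m \<rightarrow> {x \<in> S. T x = c}"
      unfolding eq by (auto simp: monic_pairs_def S_def m2)
  qed auto
  then have "card (monic_pairs r n m) = card {x \<in> S. T x = c}"
    by (rule bij_betw_same_card[symmetric])
  also have "\<dots> = (if c \<in> T ` S then ?q ^ (n + m - d) * card L else 0)"
  proof (cases "c \<in> T ` S")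
    case True
    then show ?thesis using card_additive_fiber[of S T c] Sdiff Tdiff ker by simp
  next
    case False
    then have "{x \<in> S. T x = c} = {}" by blast
    then show ?thesis using False by (simp only: card.empty if_False)
  qed
  finally show ?thesis by (simp only: mem L_def)
qed

lemma lattice_nonzero_components:
  assumes "(X, Y) \<in> lattice r n m" "(X, Y) \<noteq> (0, 0)" "r \<in> res" "n \<le> d" "m \<le> d"
  shows "X \<noteq> 0" "Y \<noteq> 0"
proof -
  have *: "X \<in> polys_below d" "Y \<in> polys_below d" "Q dvd X - r * Y"
    using assms(1,4,5) polys_below_mono by (auto simp: lattice_def)
  show "X \<noteq> 0"
  proof
    assume "X = 0"
    then have "Q dvd r * Y" using * by simp
    then have "Q dvd Y" using dvd_multD res_not_dvd assms(3) by blast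
    then show False using dvd_polys_below * \<open>X = 0\<close> assms(2) by blast
  qed
  show "Y \<noteq> 0"
  proof
    assume "Y = 0"
    then have "Q dvd X" using * by simp
    then show False using dvd_polys_below * \<open>Y = 0\<close> assms(2) by blast
  qed
qed

text \<open>If the dual box has a nonzero vector, its top coefficients decide. Either they agree on
  all vectors, and then the monic ones make up one \<open>q\<close>-th of the box, or they disagree
  somewhere, and then neither side has monic pairs.\<close>

theorem monic_pairs_duality:
  assumes n: "n < d" and m: "m < d" and nm: "d \<le> n + m" and r: "r \<in> res"
  shows "card (monic_pairs r n m) = CARD('a) ^ (n + m - d) *
    (if lattice r (d - m) (d - n) = {(0, 0)} then 1 else CARD('a) * card (monic_pairs r (d - 1 - m) (d - 1 - n)))"
proof -
  define n' m' where "n' = d - 1 - m" and "m' = d - 1 - n"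
  define L where "L = lattice r (d - m) (d - n)"
  have S: "d - m = Suc n'" "d - n = Suc m'" using n m by (auto simp: n'_def m'_def)
  have nm': "n' + m' < d" using nm n m by (auto simp: n'_def m'_def)
  let ?top = "\<forall>(X, Y)\<in>L. coeff X n' = coeff Y m'"
  note formula = card_monic_pairs_lattice[OF n m nm, of r, folded L_def n'_def m'_def]
  have mp: "monic_pairs r n' m' = {(X, Y) \<in> L. coeff X n' = 1 \<and> coeff Y m' = 1}"
    by (auto simp: monic_pairs_def L_def S lattice_def monic_polys_iff)
  consider "L = {(0, 0)}" | "L \<noteq> {(0, 0)}" ?top | "L \<noteq> {(0, 0)}" "\<not> ?top" by blast
  then show ?thesis
  proof cases
    case 1
    then show ?thesis using formula by (simp add: L_def)
  next
    case 2
    \<comment> \<open>Otherwise all top coefficients vanish, so multiplication by \<open>x\<close>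
      maps the box to itself, and a nonzero vector would acquire arbitrarily large degree.\<close>
    have "\<exists>X Y. (X, Y) \<in> L \<and> coeff X n' \<noteq> 0"
    proof (rule ccontr)
      assume none: "\<not> (\<exists>X Y. (X, Y) \<in> L \<and> coeff X n' \<noteq> 0)"
      have step: "(pCons 0 X, pCons 0 Y) \<in> L" if "(X, Y) \<in> L" for X Y
      proof -
        have XY: "X \<in> polys_below (Suc n')" "Y \<in> polys_below (Suc m')" "Q dvd X - r * Y"
          using that by (auto simp: L_def S lattice_def)
        have "coeff X n' = 0" "coeff Y m' = 0" using none 2(2) that by fastforce+
        then have "pCons 0 X \<in> polys_below (Suc n')" "pCons 0 Y \<in> polys_below (Suc m')"
          using XY by (auto simp: polys_below_def coeff_pCons split: nat.splits dest!: Suc_le_D)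
            (metis le_antisym not_less_eq_eq)+
        moreover have "Q dvd [:0, 1:] * (X - r * Y)" using XY(3) by (rule dvd_mult)
        then have "Q dvd pCons 0 X - r * pCons 0 Y" by (simp add: algebra_simps)
        ultimately show ?thesis by (simp add: L_def S lattice_def)
      qed
      obtain X Y where XY: "(X, Y) \<in> L" "(X, Y) \<noteq> (0, 0)"
        using 2(1) zero_in_lattice[of r "d - m" "d - n"] unfolding L_def by force
      have X0: "X \<noteq> 0"
        using lattice_nonzero_components(1)[OF XY[unfolded L_def] r] by simp
      have "\<exists>X' Y'. (X', Y') \<in> L \<and> X' \<noteq> 0 \<and> degree X' \<ge> k" for k
      proof (induction k)
        case 0
        then show ?case using XY X0 by blast
      next
        case (Suc k)
        then obtain X' Y' where "(X', Y') \<in> L" "X' \<noteq> 0" "degree X' \<ge> k" by blast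
        then show ?case using step by (intro exI[of _ "pCons 0 X'"] exI[of _ "pCons 0 Y'"]) auto
      qed
      then obtain X' Y' where "(X', Y') \<in> L" "X' \<noteq> 0" "degree X' \<ge> Suc n'" by blast
      then show False by (auto simp: L_def S lattice_def polys_below_iff)
    qed
    then obtain X Y where XY: "(X, Y) \<in> L" "coeff X n' \<noteq> 0" by blast
    have "card L = CARD('a) * card {x \<in> L. coeff (fst x) n' = 1}"
    proof (rule card_linear_functional[where \<phi> = "\<lambda>x. coeff (fst x) n'"])
      show "finite L" by (simp add: L_def)
      show "x - y \<in> L" if "x \<in> L" "y \<in> L" for x y using that by (simp add: L_def lattice_diff)
      show "\<exists>y\<in>L. coeff (fst y) n' = c * coeff (fst x) n'" if "x \<in> L" for c x
        using that lattice_smult[of "fst x" "snd x"] unfolding L_def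
        by (intro bexI[of _ "(smult c (fst x), smult c (snd x))"]) auto
      show "(X, Y) \<in> L" "coeff (fst (X, Y)) n' \<noteq> 0" using XY by auto
    qed simp
    also have "{x \<in> L. coeff (fst x) n' = 1} = monic_pairs r n' m'"
      unfolding mp using 2(2) by force
    finally show ?thesis using formula 2 by (simp add: L_def n'_def m'_def)
  next
    case 3
    then obtain X Y where XY: "(X, Y) \<in> L" "coeff X n' \<noteq> coeff Y m'" by blast
    have "monic_pairs r n' m' = {}"
    proof (rule equals0I)
      fix p assume "p \<in> monic_pairs r n' m'"
      then obtain A B where AB: "(A, B) \<in> L" "A \<in> monic_polys n'" "B \<in> monic_polys m'"
        by (auto simp: monic_pairs_def L_def lattice_def S monic_polys_iff)
      \<comment> \<open>The determinant against a monic pair has degree at most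
        \<open>n' + m' < d\<close>, so it is zero; but its coefficient at \<open>n' + m'\<close> is
        the difference of the two top coefficients of \<open>(X, Y)\<close>.\<close>
      define D where "D = X * B - A * Y"
      have "Q dvd D" unfolding D_def
        by (rule lattice_cross_dvd[where r = r]) (use XY AB in \<open>auto simp: L_def lattice_def\<close>)
      moreover have deg: "degree X \<le> n'" "degree Y \<le> m'" "degree A = n'" "degree B = m'"
        "coeff A n' = 1" "coeff B m' = 1"
        using XY AB by (auto simp: L_def lattice_def S polys_below_iff monic_polys_def)
      then have "degree (X * B) \<le> n' + m'" "degree (A * Y) \<le> n' + m'"
        using degree_mult_le[of X B] degree_mult_le[of A Y] by auto
      then have "degree D \<le> n' + m'" unfolding D_def by (rule degree_diff_le)
      then have "D \<in> polys_below d" using nm' by (auto simp: polys_below_iff)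
      ultimately have "D = 0" using dvd_polys_below by blast
      moreover have "coeff D (n' + m') = coeff X n' - coeff Y m'"
        using deg unfolding D_def by (simp add: coeff_mult_at_sum)
      ultimately show False using XY(2) by simp
    qed
    then show ?thesis using formula 3 by (auto simp: L_def n'_def m'_def)
  qed
qed

end

section \<open>Primitive pairs\<close>

text \<open>A fraction has only one reduced form with monic denominator.\<close>

lemma coprime_proportional_eq:
  fixes A B C D :: "'a::field poly"
  assumes "coprime A B" "coprime C D" "lead_coeff B = 1" "lead_coeff D = 1" "A * D = C * B"
  shows "A = C" "B = D"
proof -
  have "B dvd A * D" "D dvd C * B" using assms(5) by (simp, metis dvd_triv_right)
  then have "B dvd D" "D dvd B" using assms(1,2) coprime_dvd_multD by (metis coprime_commute)+
  then obtain E F where E: "D = B * E" "B = D * F" by (meson dvdE)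
  have "B \<noteq> 0" "D \<noteq> 0" using assms(3,4) by auto
  moreover have "E \<noteq> 0" "F \<noteq> 0" using E calculation by auto
  ultimately have "degree D = degree B + degree E" "degree B = degree D + degree F"
    using E by (metis degree_mult_eq)+
  then have "degree E = 0" by simp
  moreover have "lead_coeff E = 1" using E(1) assms(3,4) by (simp add: lead_coeff_mult)
  ultimately have "E = 1" by (auto elim!: degree_eq_zeroE simp: one_pCons)
  then show BD: "B = D" using E by simp
  have "D \<noteq> 0" using assms(4) by auto
  then show "A = C" using assms(5) BD by simp
qed

context irreducible_modulus
begin

text \<open>Requiring \<open>B\<close> to be monic selects one pair from each class of scalar
  multiples; the leading coefficient of \<open>A\<close> stays free.\<close>

definition primitive_pairs :: "('a poly \<times> 'a poly) set" where
  "primitive_pairs = {(A, B). A \<noteq> 0 \<and> lead_coeff B = 1 \<and> coprime A B \<and> degree A + degree B < d}"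

definition primitive_over :: "'a poly \<Rightarrow> ('a poly \<times> 'a poly) set" where
  "primitive_over r = {p \<in> primitive_pairs. Q dvd fst p - r * snd p}"

lemma finite_primitive_pairs [simp]: "finite primitive_pairs"
  by (rule finite_subset[of _ "polys_below d \<times> polys_below d"])
    (auto simp: primitive_pairs_def polys_below_iff)

lemma finite_primitive_over [simp]: "finite (primitive_over r)"
  by (simp add: primitive_over_def)

lemma cross_product_zero:
  assumes "Q dvd A - r * B" "Q dvd C - r * D" "degree A + degree D < d" "degree C + degree B < d"
  shows "A * D = C * B"
proof -
  have "degree (A * D) < d" "degree (C * B) < d"
    using assms(3,4) degree_mult_le[of A D] degree_mult_le[of C B] by linarith+
  then have "degree (A * D - C * B) < d" by (rule degree_diff_less)
  then have "A * D - C * B \<in> polys_below d" by (simp add: polys_below_iff)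
  then have "A * D - C * B = 0" using dvd_polys_below lattice_cross_dvd[OF assms(1,2)] by blast
  then show ?thesis by simp
qed

lemma primitive_over_eq:
  assumes "p \<in> primitive_over r" "p' \<in> primitive_over r"
    "degree (fst p) + degree (snd p') < d" "degree (fst p') + degree (snd p) < d"
  shows "p = p'"
proof -
  have "fst p * snd p' = fst p' * snd p"
    by (rule cross_product_zero[where r = r]) (use assms in \<open>auto simp: primitive_over_def\<close>)
  then have "fst p = fst p'" "snd p = snd p'"
    using assms(1,2) coprime_proportional_eq[of "fst p" "snd p" "fst p'" "snd p'"]
    by (auto simp: primitive_over_def primitive_pairs_def)
  then show ?thesis by (simp add: prod_eq_iff)
qed

text \<open>Divide by the common factor. \<open>F\<close> also takes over the leading coefficient of
  \<open>B\<close>, to leave a monic second entry; since \<open>degree F < d\<close>, it cancels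
  from the divisibility by \<open>Q\<close>.\<close>

lemma lattice_primitive_factor:
  assumes "Q dvd A - r * B" "A \<in> polys_below d" "B \<in> polys_below d" "A \<noteq> 0" "B \<noteq> 0"
    and "degree A + degree B < d"
  obtains F p where "p \<in> primitive_over r" "F \<noteq> 0" "A = F * fst p" "B = F * snd p"
    "lead_coeff F = lead_coeff B"
proof -
  obtain G A' B' where G: "lead_coeff G = 1" "A = G * A'" "B = G * B'" "coprime A' B'"
    using ex_coprime_decomposition[OF assms(5)] by metis
  define c where "c = lead_coeff B"
  have c: "c \<noteq> 0" using assms(5) by (simp add: c_def)
  define F where "F = smult c G"
  define p where "p = (smult (inverse c) A', smult (inverse c) B')"
  have AB: "A = F * fst p" "B = F * snd p" using c G by (simp_all add: F_def p_def)
  have lF: "lead_coeff F = c" using G(1) by (simp add: F_def lead_coeff_smult)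
  have "lead_coeff B = lead_coeff F * lead_coeff (snd p)" using AB(2) by (simp add: lead_coeff_mult)
  then have lB: "lead_coeff (snd p) = 1" using lF c by (simp add: c_def)
  have F0: "F \<noteq> 0" "fst p \<noteq> 0" "snd p \<noteq> 0" using AB assms(4,5) by auto
  have cop: "coprime (fst p) (snd p)"
  proof (rule coprimeI)
    fix D assume "D dvd fst p" "D dvd snd p"
    then have "D dvd A'" "D dvd B'" using c by (auto simp: p_def dvd_smult_iff)
    then show "is_unit D" using G(4) by (meson coprime_common_divisor)
  qed
  have deg: "degree A = degree F + degree (fst p)" "degree B = degree F + degree (snd p)"
    using F0 unfolding AB by (simp_all add: degree_mult_eq)
  have "degree F < d" using deg assms(6) by linarith
  then have "F \<in> polys_below d" by (simp add: polys_below_iff)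
  then have "\<not> Q dvd F" using dvd_polys_below F0 by blast
  moreover have "Q dvd F * (fst p - r * snd p)" using assms(1) AB by (simp add: algebra_simps)
  ultimately have "Q dvd fst p - r * snd p" using dvd_multD by blast
  then have "p \<in> primitive_over r"
    using F0 lB cop deg assms(6) by (auto simp: primitive_over_def primitive_pairs_def)
  then show ?thesis using that F0(1) AB lF unfolding c_def by blast
qed

text \<open>Each monic pair is \<open>F\<close> times a primitive pair in exactly one way, with
  \<open>F\<close> monic. Both entries must leave the same degree for \<open>F\<close>, and then
  every monic \<open>F\<close> of that degree occurs.\<close>

lemma card_monic_pairs_primitive:
  assumes nm: "n + m < d"
  shows "card (monic_pairs r n m) = (\<Sum>p\<in>primitive_over r.
    if lead_coeff (fst p) = 1 \<and> degree (fst p) \<le> n \<and> degree (snd p) \<le> m \<and>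
      n - degree (fst p) = m - degree (snd p)
    then CARD('a) ^ (n - degree (fst p)) else 0)"
proof -
  let ?c = "\<lambda>p. lead_coeff (fst p) = 1 \<and> degree (fst p) \<le> n \<and> degree (snd p) \<le> m \<and>
      n - degree (fst p) = m - degree (snd p)"
  let ?P = "{p \<in> primitive_over r. ?c p}"
  let ?S = "SIGMA p:?P. (monic_polys (n - degree (fst p)) :: 'a poly set)"
  let ?f = "\<lambda>(p, F). (F * fst p, F * snd p)"
  have inj: "inj_on ?f ?S"
  proof (rule inj_onI, clarify)
    fix A B F A' B' F'
    assume a: "(A, B) \<in> primitive_over r" "(A', B') \<in> primitive_over r"
      and F: "F \<in> monic_polys (n - degree (fst (A, B)))" "F' \<in> monic_polys (n - degree (fst (A', B')))"
      and e: "F * fst (A, B) = F' * fst (A', B')" "F * snd (A, B) = F' * snd (A', B')"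
    have F0: "F \<noteq> 0" "F' \<noteq> 0" using F monic_polys_nonzero by auto
    have "(F * A) * (F' * B') = (F' * A') * (F * B)" using e by (simp add: mult_ac)
    then have "(F * F') * (A * B') = (F * F') * (A' * B)" by (simp add: mult_ac)
    then have "A * B' = A' * B" using F0 by simp
    then have "A = A'" "B = B'"
      using a coprime_proportional_eq[of A B A' B'] by (auto simp: primitive_over_def primitive_pairs_def)
    moreover have "B \<noteq> 0" using a by (auto simp: primitive_over_def primitive_pairs_def)
    ultimately show "((A, B) = (A', B')) \<and> F = F'" using e by simp
  qed
  have "?f ` ?S = monic_pairs r n m"
  proof (intro equalityI subsetI)
    fix x assume "x \<in> ?f ` ?S"
    then obtain A B F where x: "x = (F * A, F * B)" "(A, B) \<in> primitive_over r" "?c (A, B)"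
      "F \<in> monic_polys (n - degree A)" by auto
    have nz: "A \<noteq> 0" "B \<noteq> 0" "F \<noteq> 0" "lead_coeff A = 1" "lead_coeff B = 1" "lead_coeff F = 1"
      "degree F = n - degree A"
      using x by (auto simp: primitive_over_def primitive_pairs_def monic_polys_def)
    have "lead_coeff (F * A) = 1" "lead_coeff (F * B) = 1" using nz by (simp_all only: lead_coeff_mult mult_1)
    moreover have "degree (F * A) = n" "degree (F * B) = m" using x(3) nz by (auto simp: degree_mult_eq)
    ultimately have "F * A \<in> monic_polys n" "F * B \<in> monic_polys m"
      unfolding monic_polys_def by blast+
    moreover have "Q dvd F * (A - r * B)" using x(2) by (intro dvd_mult) (simp add: primitive_over_def)
    ultimately show "x \<in> monic_pairs r n m"
      unfolding x(1) by (simp add: monic_pairs_def algebra_simps)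
  next
    fix x assume "x \<in> monic_pairs r n m"
    then obtain A B where x: "x = (A, B)" "A \<in> monic_polys n" "B \<in> monic_polys m" "Q dvd A - r * B"
      by (auto simp: monic_pairs_def)
    have AB: "A \<noteq> 0" "B \<noteq> 0" "degree A = n" "degree B = m" "lead_coeff A = 1" "lead_coeff B = 1"
      using x by (auto simp: monic_polys_def)
    obtain F p where p: "p \<in> primitive_over r" "F \<noteq> 0" "A = F * fst p" "B = F * snd p"
      "lead_coeff F = lead_coeff B"
      by (rule lattice_primitive_factor[OF x(4)]) (use AB nm in \<open>auto simp: polys_below_iff\<close>)
    have p0: "fst p \<noteq> 0" "snd p \<noteq> 0" using p AB by auto
    have "n = degree F + degree (fst p)" "m = degree F + degree (snd p)"
      using AB p p0 by (auto simp: degree_mult_eq)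
    moreover have "lead_coeff (fst p) = 1"
      using AB(5,6) p(3,5) by (simp add: lead_coeff_mult)
    ultimately have "(p, F) \<in> ?S" using p AB by (auto simp: monic_polys_def)
    moreover have "x = ?f (p, F)" using x(1) p by simp
    ultimately show "x \<in> ?f ` ?S" by blast
  qed
  then have "card (monic_pairs r n m) = card ?S" using card_image[OF inj] by simp
  also have "\<dots> = (\<Sum>p\<in>?P. CARD('a) ^ (n - degree (fst p)))"
    by (simp add: card_monic_polys)
  also have "\<dots> = (\<Sum>p\<in>primitive_over r. if ?c p then CARD('a) ^ (n - degree (fst p)) else 0)"
    by (rule sum.inter_filter) simp
  finally show ?thesis .
qed

text \<open>Two primitive pairs in a box with \<open>n + m < d\<close> have determinant zero and
  coincide. The sum is therefore 0 or 1, and it is 1 as soon as the box has a nonzero vector, since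
  such a vector is a multiple of a primitive pair.\<close>

lemma lattice_nonzero_primitive:
  assumes r: "r \<in> res" and nm: "n + m < d"
  shows "(if lattice r (Suc n) (Suc m) = {(0, 0)} then 0 else 1 :: nat) =
    (\<Sum>p\<in>primitive_over r. if degree (fst p) \<le> n \<and> degree (snd p) \<le> m then 1 else 0)"
proof -
  let ?P = "{p \<in> primitive_over r. degree (fst p) \<le> n \<and> degree (snd p) \<le> m}"
  have sum: "(\<Sum>p\<in>primitive_over r. if degree (fst p) \<le> n \<and> degree (snd p) \<le> m then 1 else 0) = card ?P"
    by (simp add: sum.If_cases) (rule arg_cong[of _ _ card], auto)
  have sub: "?P \<subseteq> lattice r (Suc n) (Suc m)"
    by (auto simp: lattice_def primitive_over_def polys_below_iff)
  show ?thesis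
  proof (cases "lattice r (Suc n) (Suc m) = {(0, 0)}")
    case True
    then have "?P = {}" using sub by (auto simp: primitive_over_def primitive_pairs_def)
    then have "card ?P = 0" by (simp only: card.empty)
    then show ?thesis unfolding sum using True by simp
  next
    case False
    then obtain A B where AB: "(A, B) \<in> lattice r (Suc n) (Suc m)" "(A, B) \<noteq> (0, 0)"
      using zero_in_lattice[of r "Suc n" "Suc m"] by force
    have nz: "A \<noteq> 0" "B \<noteq> 0" using lattice_nonzero_components[OF AB r] nm by auto
    have AB': "degree A \<le> n" "degree B \<le> m" "Q dvd A - r * B"
      using AB nz by (auto simp: lattice_def polys_below_iff)
    obtain F p where p: "p \<in> primitive_over r" "F \<noteq> 0" "A = F * fst p" "B = F * snd p"
      by (rule lattice_primitive_factor[OF AB'(3)]) (use AB' nz nm in \<open>auto simp: polys_below_iff\<close>)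
    have "fst p \<noteq> 0" "snd p \<noteq> 0" using p nz by auto
    then have pP: "p \<in> ?P" using p AB' by (auto simp: degree_mult_eq)
    have "?P = {p}"
    proof (intro equalityI subsetI)
      fix p' assume "p' \<in> ?P"
      then show "p' \<in> {p}" using primitive_over_eq[of p' r p] pP nm by auto
    qed (use pP in simp)
    then have "card ?P = 1" by (simp only: card.insert card.empty finite.emptyI) simp
    then show ?thesis using False sum by simp
  qed
qed

end

section \<open>The weight of a residue as a sum over primitive pairs\<close>

lemma card_double_less: "card {t::nat. h + 2 * t < D} = (D - h + 1) div 2"
proof -
  have "{t. h + 2 * t < D} = {..<(D - h + 1) div 2}" by auto
  then show ?thesis by simp
qed

context irreducible_modulus_weight
begin

definition height :: "'a poly \<times> 'a poly \<Rightarrow> nat" where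
  "height p = degree (fst p) + degree (snd p)"

definition gap :: "'a poly \<times> 'a poly \<Rightarrow> nat" where
  "gap p = d - height p"

text \<open>The contribution of the boxes whose lattice points are multiples of \<open>p\<close>: there the number of monic pairs
  in the dual box deviates from its expected value.\<close>

definition box_correction :: "'a poly \<times> 'a poly \<Rightarrow> real" where
  "box_correction p = (\<Sum>(n, m) | degree (fst p) \<le> n \<and> degree (snd p) \<le> m \<and> n + m + 2 \<le> d.
     u ^ (n + m + 2 - height p))"

definition coefficient :: "'a poly \<times> 'a poly \<Rightarrow> real" where
  "coefficient p = (if lead_coeff (fst p) = 1 then real (gap p) else 0) - box_correction p"

definition short_sum :: "'a poly \<Rightarrow> real" where
  "short_sum r = (\<Sum>p\<in>primitive_over r. coefficient p * u ^ height p)"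

lemma u_q_power: "u ^ (2 * k) * q ^ k = 1"
  using q_u_u by (simp add: power_mult power2_eq_square mult.commute flip: power_mult_distrib)

lemma finite_sum_le: "finite {(n::nat, m::nat). n + m + c \<le> D}"
  by (rule finite_subset[of _ "{..D} \<times> {..D}"]) auto

lemma finite_sum_less: "finite {(n::nat, m::nat). n + m < D}"
  by (rule finite_subset[of _ "{..D} \<times> {..D}"]) auto

text \<open>The multiples of \<open>p\<close> by monic polynomials of degree \<open>t\<close> number
  \<open>q ^ t\<close> and weigh \<open>u ^ (height p + 2 * t)\<close>. The powers cancel, so each
  \<open>t\<close> with \<open>height p + 2 * t < D\<close> contributes
  \<open>u ^ height p\<close>.\<close>

lemma sum_monic_pairs_primitive:
  assumes D: "D \<le> d"
  shows "(\<Sum>(n, m) | n + m < D. u ^ (n + m) * real (card (monic_pairs r n m))) =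
    (\<Sum>p\<in>primitive_over r. if lead_coeff (fst p) = 1 then real ((D - height p + 1) div 2) * u ^ height p else 0)"
proof -
  let ?I = "{(n::nat, m::nat). n + m < D}"
  define cond where "cond p n m \<longleftrightarrow> degree (fst p) \<le> n \<and> degree (snd p) \<le> m \<and> n - degree (fst p) = m - degree (snd p)"
    for p :: "'a poly \<times> 'a poly" and n m
  have "(\<Sum>(n, m)\<in>?I. u ^ (n + m) * real (card (monic_pairs r n m))) =
     (\<Sum>x\<in>?I. \<Sum>p\<in>primitive_over r. if lead_coeff (fst p) = 1 \<and> cond p (fst x) (snd x)
        then u ^ (fst x + snd x) * q ^ (fst x - degree (fst p)) else 0)"
    by (rule sum.cong[OF refl])
      (use D in \<open>auto simp: card_monic_pairs_primitive cond_def sum_distrib_left q_eq intro!: sum.cong\<close>)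
  also have "\<dots> = (\<Sum>p\<in>primitive_over r. \<Sum>x\<in>?I. if lead_coeff (fst p) = 1 \<and> cond p (fst x) (snd x)
        then u ^ (fst x + snd x) * q ^ (fst x - degree (fst p)) else 0)"
    by (rule sum.swap)
  also have "\<dots> = (\<Sum>p\<in>primitive_over r. if lead_coeff (fst p) = 1 then real ((D - height p + 1) div 2) * u ^ height p else 0)"
  proof (rule sum.cong[OF refl])
    fix p assume "p \<in> primitive_over r"
    let ?T = "{t. height p + 2 * t < D}"
    let ?X = "{x \<in> ?I. cond p (fst x) (snd x)}"
    have "(\<Sum>x\<in>?X. u ^ (fst x + snd x) * q ^ (fst x - degree (fst p))) = real ((D - height p + 1) div 2) * u ^ height p"
    proof -
      have bij: "bij_betw (\<lambda>t. (degree (fst p) + t, degree (snd p) + t)) ?T ?X"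
        by (rule bij_betwI[where g = "\<lambda>x. fst x - degree (fst p)"]) (auto simp: cond_def height_def)
      have "(\<Sum>x\<in>?X. u ^ (fst x + snd x) * q ^ (fst x - degree (fst p))) =
          (\<Sum>t\<in>?T. u ^ (height p + 2 * t) * q ^ t)"
        using sum.reindex_bij_betw[OF bij, of "\<lambda>x. u ^ (fst x + snd x) * q ^ (fst x - degree (fst p))", symmetric]
        by (simp add: height_def add_ac mult_2)
      also have "\<dots> = (\<Sum>t\<in>?T. u ^ height p)"
        by (intro sum.cong refl) (simp add: power_add mult.assoc u_q_power)
      finally show ?thesis by (simp add: card_double_less)
    qed
    moreover have "(\<Sum>x\<in>?I. if cond p (fst x) (snd x) then u ^ (fst x + snd x) * q ^ (fst x - degree (fst p)) else 0)
        = (\<Sum>x\<in>?X. u ^ (fst x + snd x) * q ^ (fst x - degree (fst p)))"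
      by (rule sum.inter_filter[symmetric]) (rule finite_sum_less)
    ultimately show "(\<Sum>x\<in>?I. if lead_coeff (fst p) = 1 \<and> cond p (fst x) (snd x)
        then u ^ (fst x + snd x) * q ^ (fst x - degree (fst p)) else 0) =
      (if lead_coeff (fst p) = 1 then real ((D - height p + 1) div 2) * u ^ height p else 0)"
      by simp
  qed
  finally show ?thesis .
qed

text \<open>Duality after normalization: the dual box has the same weight, plus an expected term
  \<open>u ^ (n + m + 2)\<close> that is present exactly when the small lattice box is trivial. In
  that case there are no monic pairs in the small box.\<close>

lemma weighted_monic_pairs_dual:
  assumes r: "r \<in> res" and nm: "n + m + 2 \<le> d"
  shows "u ^ ((d - 1 - m) + (d - 1 - n)) * real (card (monic_pairs r (d - 1 - m) (d - 1 - n))) =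
    u ^ (n + m + 2) - u ^ (n + m + 2) * (if lattice r (Suc n) (Suc m) = {(0, 0)} then 0 else 1)
      + u ^ (n + m) * real (card (monic_pairs r n m))"
proof -
  \<comment> \<open>The excess over \<open>d\<close> of the degrees in the large box; its factor
    \<open>q ^ k\<close> cancels against \<open>u ^ (2 * k)\<close>.\<close>
  define k where "k = d - 2 - (n + m)"
  have k: "(d - 1 - m) + (d - 1 - n) = 2 * k + (n + m + 2)" "(d - 1 - m) + (d - 1 - n) - d = k"
    using nm by (auto simp: k_def)
  have c: "d - 1 - m < d" "d - 1 - n < d" "d \<le> (d - 1 - m) + (d - 1 - n)"
    using nm by auto
  have s: "d - (d - 1 - n) = Suc n" "d - (d - 1 - m) = Suc m" "d - 1 - (d - 1 - n) = n" "d - 1 - (d - 1 - m) = m"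
    using nm by auto
  have "real (card (monic_pairs r (d - 1 - m) (d - 1 - n))) = q ^ k *
    (if lattice r (Suc n) (Suc m) = {(0, 0)} then 1 else q * real (card (monic_pairs r n m)))"
    unfolding monic_pairs_duality[OF c r, unfolded s k(2)] by (simp add: q_eq)
  then have "u ^ ((d - 1 - m) + (d - 1 - n)) * real (card (monic_pairs r (d - 1 - m) (d - 1 - n))) =
    (u ^ (2 * k) * q ^ k) * (u ^ (n + m + 2) *
    (if lattice r (Suc n) (Suc m) = {(0, 0)} then 1 else q * real (card (monic_pairs r n m))))"
    unfolding k by (simp add: power_add)
  also have "\<dots> = u ^ (n + m + 2) *
    (if lattice r (Suc n) (Suc m) = {(0, 0)} then 1 else q * real (card (monic_pairs r n m)))"
    by (simp add: u_q_power)
  also have "\<dots> = u ^ (n + m + 2) - u ^ (n + m + 2) * (if lattice r (Suc n) (Suc m) = {(0, 0)} then 0 else 1)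
      + u ^ (n + m) * real (card (monic_pairs r n m))"
  proof (cases "lattice r (Suc n) (Suc m) = {(0, 0)}")
    case True
    have "monic_pairs r n m \<subseteq> lattice r (Suc n) (Suc m)"
      by (auto simp: monic_pairs_def lattice_def monic_polys_iff)
    then have "monic_pairs r n m = {}" using True by (auto simp: monic_pairs_def monic_polys_def)
    then show ?thesis using True by simp
  next
    case False
    have "u ^ (n + m + 2) * q = u ^ (n + m)" using q_u_u by (simp add: power_add power2_eq_square mult_ac)
    then show ?thesis using False by (simp add: mult.assoc[symmetric])
  qed
  finally show ?thesis .
qed

lemma sum_lattice_nonzero_primitive:
  assumes r: "r \<in> res"
  shows "(\<Sum>(n, m) | n + m + 2 \<le> d. u ^ (n + m + 2) * (if lattice r (Suc n) (Suc m) = {(0, 0)} then 0 else 1)) =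
    (\<Sum>p\<in>primitive_over r. box_correction p * u ^ height p)"
proof -
  let ?I = "{(n::nat, m::nat). n + m + 2 \<le> d}"
  have "(\<Sum>(n, m)\<in>?I. u ^ (n + m + 2) * (if lattice r (Suc n) (Suc m) = {(0, 0)} then 0 else 1)) =
    (\<Sum>x\<in>?I. \<Sum>p\<in>primitive_over r. if degree (fst p) \<le> fst x \<and> degree (snd p) \<le> snd x then u ^ (fst x + snd x + 2) else 0)"
  proof (rule sum.cong[OF refl])
    fix x assume "x \<in> ?I"
    then obtain n m where x: "x = (n, m)" "n + m < d" by auto
    have "(if lattice r (Suc n) (Suc m) = {(0, 0)} then 0 else 1 :: real) =
        real (if lattice r (Suc n) (Suc m) = {(0, 0)} then 0 else 1)" by simp
    also have "\<dots> = (\<Sum>p\<in>primitive_over r. if degree (fst p) \<le> n \<and> degree (snd p) \<le> m then 1 else 0)"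
      unfolding lattice_nonzero_primitive[OF r x(2)] by (simp only: of_nat_sum) (intro sum.cong refl, simp)
    finally show "(case x of (n, m) \<Rightarrow> u ^ (n + m + 2) * (if lattice r (Suc n) (Suc m) = {(0, 0)} then 0 else 1)) =
      (\<Sum>p\<in>primitive_over r. if degree (fst p) \<le> fst x \<and> degree (snd p) \<le> snd x then u ^ (fst x + snd x + 2) else 0)"
      unfolding x(1) prod.case by (simp only: sum_distrib_left) (intro sum.cong refl, simp)
  qed
  also have "\<dots> = (\<Sum>p\<in>primitive_over r. \<Sum>x\<in>?I. if degree (fst p) \<le> fst x \<and> degree (snd p) \<le> snd x then u ^ (fst x + snd x + 2) else 0)"
    by (rule sum.swap)
  also have "\<dots> = (\<Sum>p\<in>primitive_over r. box_correction p * u ^ height p)"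
  proof (rule sum.cong[OF refl])
    fix p :: "'a poly \<times> 'a poly"
    let ?J = "{(n, m). degree (fst p) \<le> n \<and> degree (snd p) \<le> m \<and> n + m + 2 \<le> d}"
    have "(\<Sum>x\<in>?I. if degree (fst p) \<le> fst x \<and> degree (snd p) \<le> snd x then u ^ (fst x + snd x + 2) else 0)
       = (\<Sum>x | x \<in> ?I \<and> degree (fst p) \<le> fst x \<and> degree (snd p) \<le> snd x. u ^ (fst x + snd x + 2))"
      by (rule sum.inter_filter[symmetric]) (use finite_sum_le[of 2 d] in simp)
    also have "{x. x \<in> ?I \<and> degree (fst p) \<le> fst x \<and> degree (snd p) \<le> snd x} = ?J" by auto
    also have "(\<Sum>x\<in>?J. u ^ (fst x + snd x + 2)) = (\<Sum>(n, m)\<in>?J. u ^ (n + m + 2 - height p) * u ^ height p)"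
      by (rule sum.cong[OF refl]) (auto simp: height_def simp flip: power_add)
    also have "\<dots> = box_correction p * u ^ height p"
      unfolding box_correction_def sum_distrib_right by (intro sum.cong refl) auto
    finally show "(\<Sum>x\<in>?I. if degree (fst p) \<le> fst x \<and> degree (snd p) \<le> snd x then u ^ (fst x + snd x + 2) else 0)
      = box_correction p * u ^ height p" .
  qed
  finally show ?thesis .
qed

text \<open>The square of degrees splits into the triangle \<open>n + m < d\<close> and its
  complement, which duality carries to \<open>n + m + 2 \<le> d\<close>. The expected terms do not
  involve \<open>r\<close>; the rest regroups over primitive pairs.\<close>

theorem pair_weight_eq:
  assumes r: "r \<in> res"
  shows "pair_weight r = (\<Sum>(n, m) | n + m + 2 \<le> d. u ^ (n + m + 2)) + short_sum r"
proof -
  let ?f = "\<lambda>n m. u ^ (n + m) * real (card (monic_pairs r n m))"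
  let ?I = "{(n::nat, m::nat). n + m < d}" and ?I2 = "{(n::nat, m::nat). n + m + 2 \<le> d}"
  let ?J = "{(n, m). n < d \<and> m < d \<and> d \<le> n + m}"
  have finJ: "finite ?J" by (rule finite_subset[of _ "{..d} \<times> {..d}"]) auto
  have "pair_weight r = (\<Sum>(n, m)\<in>{..<d} \<times> {..<d}. ?f n m)"
    unfolding pair_weight_def by (rule sum.cartesian_product)
  also have "{..<d} \<times> {..<d} = ?I \<union> ?J" by auto
  also have "(\<Sum>(n, m)\<in>?I \<union> ?J. ?f n m) = (\<Sum>(n, m)\<in>?I. ?f n m) + (\<Sum>(n, m)\<in>?J. ?f n m)"
    by (rule sum.union_disjoint) (use finJ finite_sum_less[of d] in auto)
  also have "(\<Sum>(n, m)\<in>?J. ?f n m) = (\<Sum>(n, m)\<in>?I2. ?f (d - 1 - m) (d - 1 - n))"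
    by (rule sum.reindex_bij_witness[of _ "\<lambda>(n, m). (d - 1 - m, d - 1 - n)" "\<lambda>(n, m). (d - 1 - m, d - 1 - n)"]) auto
  also have "\<dots> = (\<Sum>(n, m)\<in>?I2. u ^ (n + m + 2) - u ^ (n + m + 2) * (if lattice r (Suc n) (Suc m) = {(0, 0)} then 0 else 1)
      + ?f n m)"
    by (rule sum.cong[OF refl]) (use weighted_monic_pairs_dual[OF r] in auto)
  also have "\<dots> = (\<Sum>(n, m)\<in>?I2. u ^ (n + m + 2)) -
      (\<Sum>(n, m)\<in>?I2. u ^ (n + m + 2) * (if lattice r (Suc n) (Suc m) = {(0, 0)} then 0 else 1)) + (\<Sum>(n, m)\<in>?I2. ?f n m)"
    by (simp add: case_prod_beta sum.distrib sum_subtractf)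
  finally have 1: "pair_weight r = (\<Sum>(n, m)\<in>?I. ?f n m) + ((\<Sum>(n, m)\<in>?I2. u ^ (n + m + 2)) -
      (\<Sum>(n, m)\<in>?I2. u ^ (n + m + 2) * (if lattice r (Suc n) (Suc m) = {(0, 0)} then 0 else 1)) + (\<Sum>(n, m)\<in>?I2. ?f n m))" .
  have 2: "?I2 = {(n, m). n + m < d - 1}" by auto
  have "(\<Sum>(n, m)\<in>?I. ?f n m) + (\<Sum>(n, m) | n + m < d - 1. ?f n m) -
      (\<Sum>p\<in>primitive_over r. box_correction p * u ^ height p) = short_sum r"
    unfolding sum_monic_pairs_primitive[OF order_refl] sum_monic_pairs_primitive[OF diff_le_self]
      short_sum_def sum.distrib[symmetric] sum_subtractf[symmetric]
  proof (rule sum.cong[OF refl])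
    fix p assume "p \<in> primitive_over r"
    then have "height p < d" by (auto simp: primitive_over_def primitive_pairs_def height_def)
    \<comment> \<open>The two triangles have sides \<open>d\<close> and \<open>d - 1\<close>. Their
      counts are the gap halved, rounded up and rounded down, so whatever the parity the total is
      the gap.\<close>
    then have "(d - height p + 1) div 2 + (d - 1 - height p + 1) div 2 = gap p"
      unfolding gap_def by linarith
    then have "real ((d - height p + 1) div 2) + real ((d - 1 - height p + 1) div 2) = real (gap p)"
      by (simp only: of_nat_add[symmetric])
    then show "(if lead_coeff (fst p) = 1 then real ((d - height p + 1) div 2) * u ^ height p else 0) +
        (if lead_coeff (fst p) = 1 then real ((d - 1 - height p + 1) div 2) * u ^ height p else 0) -
        box_correction p * u ^ height p = coefficient p * u ^ height p"
      unfolding coefficient_def by (auto simp: algebra_simps simp flip: distrib_left)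
  qed
  then show ?thesis unfolding 1 sum_lattice_nonzero_primitive[OF r] 2[symmetric] by linarith
qed

end

section \<open>Divisors of polynomials\<close>

definition monic_divisors :: "'a::field poly \<Rightarrow> 'a poly set" where
  "monic_divisors N = {D. lead_coeff D = 1 \<and> D dvd N}"

definition tau :: "'a::field poly \<Rightarrow> nat" where
  "tau N = card (monic_divisors N)"

lemma finite_monic_divisors:
  fixes N :: "'a::{field,finite} poly"
  assumes "N \<noteq> 0"
  shows "finite (monic_divisors N)"
proof (rule finite_subset[OF _ finite_degree_le[of "degree N"]])
  show "monic_divisors N \<subseteq> {R. degree R \<le> degree N}"
    using assms dvd_imp_degree_le by (auto simp: monic_divisors_def)
qed

lemma tau_pos:
  fixes N :: "'a::{field,finite} poly"
  assumes "N \<noteq> 0"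
  shows "tau N > 0"
proof -
  have "1 \<in> monic_divisors N" by (simp add: monic_divisors_def)
  then show ?thesis using finite_monic_divisors[OF assms] by (auto simp: tau_def card_gt_0_iff)
qed

lemma tau_smult: "c \<noteq> 0 \<Longrightarrow> tau (smult c N) = tau N"
  by (simp add: tau_def monic_divisors_def dvd_smult_iff)

text \<open>A monic divisor \<open>D\<close> of \<open>G H\<close> is \<open>C D1\<close> with
  \<open>C\<close> the gcd of \<open>D\<close> and \<open>G\<close>; then \<open>D1\<close> is
  coprime to \<open>G / C\<close> and divides \<open>H\<close>.\<close>

lemma tau_mult_le:
  fixes G H :: "'a::{field,finite} poly"
  assumes "G \<noteq> 0" "H \<noteq> 0"
  shows "tau (G * H) \<le> tau G * tau H"
proof -
  have "monic_divisors (G * H) \<subseteq> (\<lambda>(D, E). D * E) ` (monic_divisors G \<times> monic_divisors H)"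
  proof
    fix D assume "D \<in> monic_divisors (G * H)"
    then have D: "lead_coeff D = 1" "D dvd G * H" by (auto simp: monic_divisors_def)
    then have "D \<noteq> 0" by auto
    then obtain C G1 D1 where C: "lead_coeff C = 1" "G = C * G1" "D = C * D1" "coprime G1 D1"
      using ex_coprime_decomposition by metis
    have "C \<noteq> 0" using C(1) by auto
    then have "D1 dvd G1 * H" using D(2) unfolding C(2,3) by (simp add: mult.assoc)
    then have "D1 dvd H" using C(4) coprime_dvd_multD by (metis coprime_commute)
    moreover have "lead_coeff D1 = 1" using D(1) C(1,3) by (simp add: lead_coeff_mult)
    ultimately have "(C, D1) \<in> monic_divisors G \<times> monic_divisors H"
      using C by (auto simp: monic_divisors_def)
    then show "D \<in> (\<lambda>(D, E). D * E) ` (monic_divisors G \<times> monic_divisors H)"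
      using C(3) by force
  qed
  then have "tau (G * H) \<le> card ((\<lambda>(D, E). D * E) ` (monic_divisors G \<times> monic_divisors H))"
    unfolding tau_def using assms by (intro card_mono) (auto simp: finite_monic_divisors)
  also have "\<dots> \<le> card (monic_divisors G \<times> monic_divisors H)"
    by (rule card_image_le) (simp add: finite_monic_divisors assms)
  finally show ?thesis by (simp add: tau_def card_cartesian_product)
qed

lemma monic_unit_eq_1:
  fixes D :: "'a::field poly"
  assumes "is_unit D" "lead_coeff D = 1"
  shows "D = 1"
proof -
  have "D \<noteq> 0" using assms(2) by auto
  then have "degree D = 0" using assms(1) by (simp add: is_unit_iff_degree)
  then show ?thesis using assms(2) by (auto elim!: degree_eq_zeroE simp: one_pCons)
qed

lemma tau_unit: "is_unit N \<Longrightarrow> tau N = 1"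
  for N :: "'a::field poly"
proof -
  assume "is_unit N"
  then have "monic_divisors N = {1}"
    using monic_unit_eq_1 dvd_unit_imp_unit by (auto simp: monic_divisors_def)
  then show ?thesis by (simp add: tau_def)
qed

lemma tau_irreducible:
  fixes P :: "'a::{field,finite} poly"
  assumes "irreducible P"
  shows "tau P \<le> 2"
proof -
  have "monic_divisors P \<subseteq> {1, smult (inverse (lead_coeff P)) P}"
  proof
    fix D assume "D \<in> monic_divisors P"
    then obtain E where E: "lead_coeff D = 1" "P = D * E" by (auto simp: monic_divisors_def)
    have "is_unit D \<or> is_unit E" using assms E(2) by (auto simp: irreducible_def)
    then show "D \<in> {1, smult (inverse (lead_coeff P)) P}"
    proof
      assume "is_unit E"
      then have "E \<noteq> 0" by auto
      then have "degree E = 0" using \<open>is_unit E\<close> by (simp add: is_unit_iff_degree)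
      then obtain c where c: "E = [:c:]" "c \<noteq> 0" using \<open>E \<noteq> 0\<close> by (auto elim!: degree_eq_zeroE)
      then have "P = smult c D" using E by simp
      then have "smult (inverse (lead_coeff P)) P = D" using c E(1) by simp
      then show ?thesis by simp
    qed (use E monic_unit_eq_1 in auto)
  qed
  then have "tau P \<le> card {1, smult (inverse (lead_coeff P)) P}"
    unfolding tau_def by (intro card_mono) auto
  also have "\<dots> \<le> 2" by (simp add: card_insert_if)
  finally show ?thesis .
qed

text \<open>Landreau's inequality. Splitting off a divisor of least degree exceeding \<open>Y / 2\<close> removes
  at least \<open>Y / 2\<close> from the degree, and such a divisor either has degree at most \<open>Y\<close> or is
  irreducible, hence has only two monic divisors.\<close>

lemma tau_le_small_divisor:
  fixes N :: "'a::{field,finite} poly"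
  assumes "N \<noteq> 0" "2 * degree N \<le> Y * j"
  shows "\<exists>F. F dvd N \<and> lead_coeff F = 1 \<and> degree F \<le> Y \<and> tau N \<le> (2 * tau F) ^ j"
proof -
  have "\<exists>F. F dvd N \<and> degree F \<le> Y \<and> tau N \<le> (2 * tau F) ^ j"
    using assms
  proof (induction j arbitrary: N)
    case 0
    then have "is_unit N" by (simp add: is_unit_iff_degree)
    then show ?case by (intro exI[of _ 1]) (simp add: tau_unit)
  next
    case (Suc j)
    have pow_ge: "x \<le> (2 * x) ^ Suc j" if "x > 0" for x :: nat
    proof -
      have "1 \<le> (2 * x) ^ j" using that by simp
      then have "x * 1 \<le> (2 * x) * (2 * x) ^ j" by (intro mult_le_mono) auto
      then show ?thesis by simp
    qed
    show ?case
    proof (cases "degree N \<le> Y")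
      case True
      then show ?thesis using pow_ge[OF tau_pos[OF Suc.prems(1)]] by (intro exI[of _ N]) auto
    next
      case False
      define P where "P D \<longleftrightarrow> D dvd N \<and> Y < 2 * degree D" for D
      have "P N" using False by (simp add: P_def)
      then obtain G where G: "P G" and min: "\<And>D. P D \<Longrightarrow> degree G \<le> degree D"
        using ex_has_least_nat[of P N degree] by blast
      obtain N2 where N2: "N = G * N2" using G by (auto simp: P_def)
      have nz: "G \<noteq> 0" "N2 \<noteq> 0" using N2 Suc.prems(1) by auto
      have "degree N = degree G + degree N2" using N2 nz by (simp add: degree_mult_eq)
      then have "2 * degree N2 \<le> Y * j" using Suc.prems(2) G by (simp add: P_def)
      then obtain F where F: "F dvd N2" "degree F \<le> Y" "tau N2 \<le> (2 * tau F) ^ j"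
        using Suc.IH nz(2) by blast
      have F0: "F \<noteq> 0" using F(1) nz(2) by auto
      have FN: "F dvd N" using F(1) N2 by simp
      have tau: "tau N \<le> tau G * (2 * tau F) ^ j"
        using tau_mult_le[OF nz] F(3) N2 by (meson le_trans mult_le_mono2)
      show ?thesis
      proof (cases "degree G \<le> Y")
        case True
        \<comment> \<open>Keep whichever of \<open>F\<close> and \<open>G\<close> has more divisors;
          its additional power pays for the factor \<open>tau G\<close>.\<close>
        show ?thesis
        proof (cases "tau G \<le> tau F")
          case True
          then have "tau G * (2 * tau F) ^ j \<le> (2 * tau F) * (2 * tau F) ^ j"
            by (intro mult_le_mono1) simp
          then have "tau N \<le> (2 * tau F) ^ Suc j" using tau unfolding power_Suc by (rule order_trans[rotated])
          then show ?thesis using FN F(2) by blast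
        next
          case False
          then have "tau G * (2 * tau F) ^ j \<le> (2 * tau G) * (2 * tau G) ^ j"
            by (intro mult_le_mono power_mono) auto
          then have "tau N \<le> (2 * tau G) ^ Suc j" using tau unfolding power_Suc by (rule order_trans[rotated])
          then show ?thesis using True N2 by (meson dvd_triv_left)
        qed
      next
        case big: False
        \<comment> \<open>In a proper factorization both factors have smaller degree than
          \<open>G\<close>, so by minimality each has degree at most \<open>Y / 2\<close>, and
          \<open>degree G\<close> would not exceed \<open>Y\<close>.\<close>
        have "irreducible G"
        proof (rule irreducibleI)
          show "G \<noteq> 0" "\<not> is_unit G" using nz big by (auto simp: is_unit_iff_degree)
          fix A B assume AB: "G = A * B"
          have AB0: "A \<noteq> 0" "B \<noteq> 0" using AB nz by auto
          have deg: "degree G = degree A + degree B" using AB AB0 by (simp add: degree_mult_eq)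
          show "is_unit A \<or> is_unit B"
          proof (rule ccontr)
            assume "\<not> (is_unit A \<or> is_unit B)"
            then have "degree A > 0" "degree B > 0" using AB0 by (auto simp: is_unit_iff_degree)
            then have "\<not> P A" "\<not> P B" using min[of A] min[of B] deg by auto
            moreover have "A dvd N" "B dvd N" using AB N2 by auto
            ultimately show False using deg big by (auto simp: P_def)
          qed
        qed
        then have "tau G \<le> 2 * tau F" using tau_irreducible[of G] tau_pos[OF F0] by linarith
        then have "tau G * (2 * tau F) ^ j \<le> (2 * tau F) * (2 * tau F) ^ j" by (rule mult_le_mono1)
        then have "tau N \<le> (2 * tau F) ^ Suc j" using tau unfolding power_Suc by (rule order_trans[rotated])
          then show ?thesis using FN F(2) by blast
      qed
    qed
  qed
  then obtain F where F: "F dvd N" "degree F \<le> Y" "tau N \<le> (2 * tau F) ^ j" by blast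
  have "F \<noteq> 0" using F(1) assms(1) by auto
  then show ?thesis using F
    by (intro exI[of _ "smult (inverse (lead_coeff F)) F"]) (auto simp: tau_smult smult_dvd_iff)
qed

text \<open>Expand one factor \<open>tau N\<close> as a sum over divisors, \<open>N = D E\<close>,
  and use submultiplicativity on the remaining power: the sum becomes a convolution of two moments
  of order \<open>J\<close>. So \<open>K\<close> passes to \<open>2 * K + 1\<close>.\<close>

lemma sum_tau_power_bound:
  "\<exists>K. \<forall>n. (\<Sum>N\<in>(monic_polys n :: 'a::{field,finite} poly set). tau N ^ J) \<le> CARD('a) ^ n * (n + 1) ^ K"
proof (induction J)
  case 0
  show ?case by (intro exI[of _ 0]) (simp add: card_monic_polys)
next
  case (Suc J)
  then obtain K where K: "\<And>n. (\<Sum>N\<in>(monic_polys n :: 'a poly set). tau N ^ J) \<le> CARD('a) ^ n * (n + 1) ^ K"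
    by blast
  let ?m = "monic_polys :: nat \<Rightarrow> 'a poly set"
  have "(\<Sum>N\<in>?m n. tau N ^ Suc J) \<le> CARD('a) ^ n * (n + 1) ^ (2 * K + 1)" for n
  proof -
    have "(\<Sum>N\<in>?m n. tau N ^ Suc J) = (\<Sum>N\<in>?m n. \<Sum>D\<in>monic_divisors N. tau N ^ J)"
      by (simp add: tau_def)
    also have "\<dots> = (\<Sum>(N, D)\<in>Sigma (?m n) monic_divisors. tau N ^ J)"
      by (rule sum.Sigma) (simp, use finite_monic_divisors monic_polys_nonzero in blast)
    also have "\<dots> = (\<Sum>(i, D, E)\<in>(SIGMA i:{..n}. ?m i \<times> ?m (n - i)). tau (D * E) ^ J)"
    proof (rule sum.reindex_bij_witness[of _ "\<lambda>(i, D, E). (D * E, D)" "\<lambda>(N, D). (degree D, D, N div D)"])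
      fix a assume "a \<in> Sigma (?m n) monic_divisors"
      then obtain N D where ND: "a = (N, D)" "lead_coeff D = 1" "N \<in> ?m n" "D dvd N"
        by (auto simp: monic_divisors_def)
      from ND(4) obtain E where "N = D * E" by (elim dvdE)
      with ND have a: "a = (D * E, D)" "lead_coeff D = 1" "D * E \<in> ?m n" by auto
      have "D * E \<noteq> 0" using a(3) by (rule monic_polys_nonzero)
      then have nz: "D \<noteq> 0" "E \<noteq> 0" by auto
      have "lead_coeff E = 1" using a by (auto simp: monic_polys_def lead_coeff_mult)
      moreover have "degree D + degree E = n" using a(3) nz by (auto simp: monic_polys_def degree_mult_eq)
      ultimately show "(case a of (N, D) \<Rightarrow> (degree D, D, N div D)) \<in> (SIGMA i:{..n}. ?m i \<times> ?m (n - i))"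
        using a nz by (auto simp: monic_polys_def)
      show "(case case a of (N, D) \<Rightarrow> (degree D, D, N div D) of (i, D, E) \<Rightarrow> (D * E, D)) = a"
        using a nz by simp
      show "(case case a of (N, D) \<Rightarrow> (degree D, D, N div D) of (i, D, E) \<Rightarrow> tau (D * E) ^ J) = (case a of (N, D) \<Rightarrow> tau N ^ J)"
        using a nz by simp
    next
      fix b assume "b \<in> (SIGMA i:{..n}. ?m i \<times> ?m (n - i))"
      then obtain i D E where b: "b = (i, D, E)" "i \<le> n" "D \<in> ?m i" "E \<in> ?m (n - i)" by auto
      have nz: "D \<noteq> 0" "E \<noteq> 0" using monic_polys_nonzero[OF b(3)] monic_polys_nonzero[OF b(4)] by auto
      have l: "lead_coeff D = 1" "lead_coeff E = 1" "degree D = i" "degree E = n - i"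
        using b by (auto simp: monic_polys_def)
      have "lead_coeff (D * E) = 1" unfolding lead_coeff_mult l(1,2) by simp
      moreover have "degree (D * E) = n" using l nz b(2) by (simp add: degree_mult_eq)
      ultimately have "D * E \<in> ?m n" by (simp only: monic_polys_def mem_Collect_eq)
      then show "(case b of (i, D, E) \<Rightarrow> (D * E, D)) \<in> Sigma (?m n) monic_divisors"
        using b(1) l by (simp add: monic_divisors_def)
      show "(case case b of (i, D, E) \<Rightarrow> (D * E, D) of (N, D) \<Rightarrow> (degree D, D, N div D)) = b"
        using b(1) l nz by simp
    qed
    also have "\<dots> \<le> (\<Sum>(i, D, E)\<in>(SIGMA i:{..n}. ?m i \<times> ?m (n - i)). tau D ^ J * tau E ^ J)"
      by (rule sum_mono)
        (auto intro!: power_mono tau_mult_le monic_polys_nonzero simp flip: power_mult_distrib)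
    also have "\<dots> = (\<Sum>i\<le>n. \<Sum>(D, E)\<in>?m i \<times> ?m (n - i). tau D ^ J * tau E ^ J)"
      by (rule sum.Sigma[symmetric]) auto
    also have "\<dots> = (\<Sum>i\<le>n. (\<Sum>D\<in>?m i. tau D ^ J) * (\<Sum>E\<in>?m (n - i). tau E ^ J))"
      by (simp add: sum_product sum.cartesian_product)
    also have "\<dots> \<le> (\<Sum>i\<le>n. CARD('a) ^ n * (n + 1) ^ (2 * K))"
    proof (rule sum_mono)
      fix i assume "i \<in> {..n}"
      then have i: "i \<le> n" by simp
      have "(\<Sum>D\<in>?m i. tau D ^ J) * (\<Sum>E\<in>?m (n - i). tau E ^ J) \<le>
          (CARD('a) ^ i * (n + 1) ^ K) * (CARD('a) ^ (n - i) * (n + 1) ^ K)"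
        using i by (intro mult_le_mono order_trans[OF K] power_mono) auto
      also have "\<dots> = (CARD('a) ^ i * CARD('a) ^ (n - i)) * (n + 1) ^ (2 * K)"
        unfolding mult_2 power_add by (simp only: mult_ac)
      also have "CARD('a) ^ i * CARD('a) ^ (n - i) = CARD('a) ^ n"
        using i by (simp flip: power_add)
      finally show "(\<Sum>D\<in>?m i. tau D ^ J) * (\<Sum>E\<in>?m (n - i). tau E ^ J) \<le> CARD('a) ^ n * (n + 1) ^ (2 * K)" .
    qed
    also have "\<dots> = CARD('a) ^ n * (n + 1) ^ (2 * K + 1)" by (simp add: algebra_simps)
    finally show ?thesis .
  qed
  then show ?case by blast
qed

section \<open>Counting solutions of linear and bilinear congruences\<close>

text \<open>After cancelling \<open>G\<close>, the coefficient \<open>B1\<close> is invertible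
  modulo \<open>F1\<close>, so two solutions differ by a multiple of \<open>F1\<close>. If
  \<open>degree F1 \<ge> l\<close>, the truncated exponent correctly allows one solution.\<close>

lemma card_linear_congruence:
  fixes F :: "'a::{field,finite} poly"
  assumes F: "F = G * F1" "B = G * B1" "coprime F1 B1" "F \<noteq> 0"
  shows "card {X \<in> polys_below l. F dvd X * B + D} \<le> CARD('a) ^ (l - degree F1)"
proof (cases "{X \<in> polys_below l. F dvd X * B + D} = {}")
  case False
  then obtain X0 where X0: "X0 \<in> polys_below l" "F dvd X0 * B + D" by blast
  have nz: "G \<noteq> 0" "F1 \<noteq> 0" using F by auto
  have "{X \<in> polys_below l. F dvd X * B + D} \<subseteq> (\<lambda>Z. X0 + F1 * Z) ` polys_below (l - degree F1)"
  proof
    fix X assume "X \<in> {X \<in> polys_below l. F dvd X * B + D}"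
    then have X: "X \<in> polys_below l" "F dvd X * B + D" by auto
    have "F dvd (X * B + D) - (X0 * B + D)" using X X0 by (intro dvd_diff)
    also have "(X * B + D) - (X0 * B + D) = G * ((X - X0) * B1)" using F(2) by (simp add: algebra_simps)
    finally have "F1 dvd B1 * (X - X0)" using F(1) nz by (simp add: mult.commute)
    then have "F1 dvd X - X0" using F(3) coprime_dvd_multD by blast
    then obtain Z where Z: "X - X0 = F1 * Z" by (elim dvdE)
    have "X - X0 \<in> polys_below l" using X X0 by (simp add: polys_below_diff)
    then have "Z \<in> polys_below (l - degree F1)"
      using Z nz by (cases "Z = 0") (auto simp: polys_below_iff degree_mult_eq)
    moreover have "X = X0 + F1 * Z" using Z by (simp add: algebra_simps)
    ultimately show "X \<in> (\<lambda>Z. X0 + F1 * Z) ` polys_below (l - degree F1)" by blast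
  qed
  then have "card {X \<in> polys_below l. F dvd X * B + D} \<le> card ((\<lambda>Z. X0 + F1 * Z) ` polys_below (l - degree F1))"
    by (intro card_mono) auto
  also have "\<dots> \<le> card (polys_below (l - degree F1) :: 'a poly set)" by (rule card_image_le) simp
  finally show ?thesis by (simp add: card_polys_below)
next
  case True
  then show ?thesis by (simp only: card.empty le0)
qed

lemma card_multiples:
  fixes G :: "'a::{field,finite} poly"
  assumes "G \<noteq> 0"
  shows "card {B \<in> polys_below m - {0}. G dvd B} \<le> (if degree G < m then CARD('a) ^ (m - degree G) else 0)"
proof -
  have "{B \<in> polys_below m - {0}. G dvd B} \<subseteq> (\<lambda>Z. G * Z) ` (polys_below (m - degree G))"
    using assms by (auto simp: polys_below_iff degree_mult_eq elim!: dvdE)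
  then have "card {B \<in> polys_below m - {0}. G dvd B} \<le> card ((\<lambda>Z. G * Z) ` (polys_below (m - degree G)))"
    by (intro card_mono) auto
  also have "\<dots> \<le> card (polys_below (m - degree G) :: 'a poly set)" by (rule card_image_le) simp
  finally have le: "card {B \<in> polys_below m - {0}. G dvd B} \<le> CARD('a) ^ (m - degree G)"
    by (simp add: card_polys_below)
  show ?thesis
  proof (cases "degree G < m")
    case False
    then have "{B \<in> polys_below m - {0}. G dvd B} = {}"
      using dvd_imp_degree_le[of G] by (auto simp: polys_below_iff) (meson le_less_trans)
    then show ?thesis by (simp only: card.empty le0)
  qed (use le in simp)
qed

text \<open>Sort by \<open>G\<close>, the gcd of \<open>F\<close> and \<open>B\<close>: the choices
  of \<open>B\<close> lose a factor \<open>|G|\<close>, those of \<open>X\<close> a factor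
  \<open>|F / G|\<close>, and together \<open>|F|\<close>. The value \<open>B = 0\<close> is
  excluded because \<open>X\<close> would then be unrestricted whenever \<open>F\<close> divides
  \<open>D\<close>.\<close>

lemma card_bilinear_congruence:
  fixes F :: "'a::{field,finite} poly"
  assumes F: "F \<noteq> 0" "degree F \<le> l"
  shows "card {(X, B). X \<in> polys_below l \<and> B \<in> polys_below m - {0} \<and> F dvd X * B + D} \<le>
    tau F * CARD('a) ^ (l + m - degree F)"
proof -
  let ?q = "CARD('a)"
  let ?B = "\<lambda>G. {B \<in> polys_below m - {0}. G dvd B}"
  let ?X = "\<lambda>G. {(X, B). X \<in> polys_below l \<and> B \<in> ?B G \<and>
      (\<exists>F1 B1. F = G * F1 \<and> B = G * B1 \<and> coprime F1 B1) \<and> F dvd X * B + D}"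
  have finX: "finite (?X G)" for G
    by (rule finite_subset[of _ "polys_below l \<times> polys_below m"]) auto
  have "{(X, B). X \<in> polys_below l \<and> B \<in> polys_below m - {0} \<and> F dvd X * B + D} \<subseteq> (\<Union>G\<in>monic_divisors F. ?X G)"
  proof (rule subsetI)
    fix x assume "x \<in> {(X, B). X \<in> polys_below l \<and> B \<in> polys_below m - {0} \<and> F dvd X * B + D}"
    then obtain X B where x: "x = (X, B)"
      and a: "X \<in> polys_below l" "B \<in> polys_below m" "B \<noteq> 0" "F dvd X * B + D" by blast
    obtain G F1 B1 where G: "lead_coeff G = 1" "F = G * F1" "B = G * B1" "coprime F1 B1"
      using ex_coprime_decomposition[OF a(3)] by metis
    have "G \<in> monic_divisors F" using G(1,2) by (simp add: monic_divisors_def)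
    moreover have "\<exists>F1 B1. F = G * F1 \<and> B = G * B1 \<and> coprime F1 B1" using G by blast
    then have "(X, B) \<in> ?X G" using a G(3) by simp
    ultimately show "x \<in> (\<Union>G\<in>monic_divisors F. ?X G)" unfolding x by blast
  qed
  then have "card {(X, B). X \<in> polys_below l \<and> B \<in> polys_below m - {0} \<and> F dvd X * B + D} \<le>
      card (\<Union>G\<in>monic_divisors F. ?X G)"
    by (intro card_mono finite_UN_I finite_monic_divisors F finX) auto
  also have "\<dots> \<le> (\<Sum>G\<in>monic_divisors F. card (?X G))"
    by (rule card_UN_le) (rule finite_monic_divisors[OF F(1)])
  also have "\<dots> \<le> (\<Sum>G\<in>monic_divisors F. ?q ^ (l + m - degree F))"
  proof (rule sum_mono)
    fix G assume "G \<in> monic_divisors F"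
    then obtain F1 where G: "F = G * F1" by (auto simp: monic_divisors_def)
    have nz: "G \<noteq> 0" "F1 \<noteq> 0" using F G by auto
    have deg: "degree F = degree G + degree F1" using G nz by (simp add: degree_mult_eq)
    have "?X G \<subseteq> (\<Union>B\<in>{B \<in> ?B G. \<exists>B1. B = G * B1 \<and> coprime F1 B1}. {X \<in> polys_below l. F dvd X * B + D} \<times> {B})"
      using nz(1) G by auto
    then have "card (?X G) \<le>
      card (\<Union>B\<in>{B \<in> ?B G. \<exists>B1. B = G * B1 \<and> coprime F1 B1}. {X \<in> polys_below l. F dvd X * B + D} \<times> {B})"
      by (intro card_mono) auto
    also have "\<dots> \<le> (\<Sum>B\<in>{B \<in> ?B G. \<exists>B1. B = G * B1 \<and> coprime F1 B1}.
        card ({X \<in> polys_below l. F dvd X * B + D} \<times> {B}))"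
      by (rule card_UN_le) simp
    also have "\<dots> \<le> (\<Sum>B\<in>{B \<in> ?B G. \<exists>B1. B = G * B1 \<and> coprime F1 B1}. ?q ^ (l - degree F1))"
    proof (rule sum_mono)
      fix B assume "B \<in> {B \<in> ?B G. \<exists>B1. B = G * B1 \<and> coprime F1 B1}"
      then obtain B1 where "B = G * B1" "coprime F1 B1" by blast
      then show "card ({X \<in> polys_below l. F dvd X * B + D} \<times> {B}) \<le> ?q ^ (l - degree F1)"
        using card_linear_congruence[OF G _ _ F(1)] by (simp add: card_cartesian_product)
    qed
    also have "\<dots> \<le> card (?B G) * ?q ^ (l - degree F1)"
      by (simp, intro card_mono) auto
    also have "\<dots> \<le> (if degree G < m then ?q ^ (m - degree G) else 0) * ?q ^ (l - degree F1)"
      by (intro mult_le_mono1 card_multiples nz)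
    \<comment> \<open>\<open>degree F \<le> l\<close> keeps the subtraction
      \<open>l - degree F1\<close> from truncating, so the exponents add up exactly.\<close>
    also have "\<dots> \<le> ?q ^ (l + m - degree F)"
      using deg F(2) by (auto simp flip: power_add intro!: power_increasing)
    finally show "card (?X G) \<le> ?q ^ (l + m - degree F)" .
  qed
  finally show ?thesis by (simp add: tau_def)
qed

section \<open>Off-diagonal terms\<close>

lemma card_divisors_le:
  fixes N :: "'a::{field,finite} poly"
  assumes "N \<noteq> 0"
  shows "card {A. A dvd N} \<le> CARD('a) * tau N"
proof -
  have "{A. A dvd N} \<subseteq> (\<lambda>(c, D). smult c D) ` (UNIV \<times> monic_divisors N)"
  proof (rule subsetI)
    fix A assume "A \<in> {A. A dvd N}"
    then have A: "A dvd N" "A \<noteq> 0" using assms by auto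
    have "smult (inverse (lead_coeff A)) A \<in> monic_divisors N"
      using A by (auto simp: monic_divisors_def smult_dvd_iff)
    moreover have "A = (\<lambda>(c, D). smult c D) (lead_coeff A, smult (inverse (lead_coeff A)) A)" using A(2) by simp
    ultimately show "A \<in> (\<lambda>(c, D). smult c D) ` (UNIV \<times> monic_divisors N)" by blast
  qed
  then have "card {A. A dvd N} \<le> card ((\<lambda>(c, D). smult c D) ` ((UNIV :: 'a set) \<times> monic_divisors N))"
    by (intro card_mono) (auto simp: finite_monic_divisors assms)
  also have "\<dots> \<le> card ((UNIV :: 'a set) \<times> monic_divisors N)"
    by (rule card_image_le) (simp add: finite_monic_divisors assms)
  finally show ?thesis by (simp add: tau_def card_cartesian_product)
qed

text \<open>The divisor supplied by Landreau's inequality depends on \<open>N\<close>. Summing over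
  all candidates \<open>F\<close> removes this dependence and allows \<open>N\<close> to be summed
  first.\<close>

lemma tau_le_sum_small_divisors:
  fixes N :: "'a::{field,finite} poly"
  assumes "N \<noteq> 0" "2 * degree N \<le> Y * J"
  shows "tau N \<le> (\<Sum>j\<le>Y. \<Sum>F\<in>monic_polys j. if F dvd N then (2 * tau F) ^ J else 0)"
proof -
  obtain F where F: "F dvd N" "lead_coeff F = 1" "degree F \<le> Y" "tau N \<le> (2 * tau F) ^ J"
    using tau_le_small_divisor[OF assms] by blast
  note F(4)
  also have "(2 * tau F) ^ J = (if F dvd N then (2 * tau F) ^ J else 0)" using F(1) by simp
  also have "\<dots> \<le> (\<Sum>F\<in>monic_polys (degree F). if F dvd N then (2 * tau F) ^ J else 0)"
    by (rule member_le_sum) (use F in \<open>auto simp: monic_polys_def[of "degree F"] intro: finite_monic_polys[unfolded monic_polys_def]\<close>)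
  also have "\<dots> \<le> (\<Sum>j\<le>Y. \<Sum>F\<in>monic_polys j. if F dvd N then (2 * tau F) ^ J else 0)"
    by (rule member_le_sum[of "degree F" "{..Y}" "\<lambda>j. \<Sum>F\<in>monic_polys j. if F dvd N then (2 * tau F) ^ J else 0"])
      (use F in auto)
  finally show ?thesis .
qed

section \<open>Pairs of distinct primitive pairs over the same residue\<close>

context irreducible_modulus
begin

definition crossing :: "nat \<Rightarrow> nat \<Rightarrow> nat \<Rightarrow> nat \<Rightarrow> (('a poly \<times> 'a poly) \<times> ('a poly \<times> 'a poly)) set" where
  "crossing a b a' b' = {(p, p'). p \<in> primitive_pairs \<and> p' \<in> primitive_pairs \<and> p \<noteq> p' \<and>
     degree (fst p) = a \<and> degree (snd p) = b \<and> degree (fst p') = a' \<and> degree (snd p') = b' \<and>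
     Q dvd fst p * snd p' - fst p' * snd p}"

lemma finite_crossing [simp]: "finite (crossing a b a' b')"
  by (rule finite_subset[of _ "primitive_pairs \<times> primitive_pairs"]) (auto simp: crossing_def)

lemma primitive_pairs_not_dvd:
  assumes "p \<in> primitive_pairs"
  shows "\<not> Q dvd fst p" "\<not> Q dvd snd p"
proof -
  have "fst p \<noteq> 0" "snd p \<noteq> 0" "fst p \<in> polys_below d" "snd p \<in> polys_below d"
    using assms by (auto simp: primitive_pairs_def polys_below_iff)
  then show "\<not> Q dvd fst p" "\<not> Q dvd snd p" using dvd_polys_below by blast+
qed

lemma primitive_over_ex1:
  assumes "p \<in> primitive_pairs"
  shows "\<exists>!r. r \<in> res \<and> p \<in> primitive_over r"
  using ex1_residue_ratio[OF primitive_pairs_not_dvd[OF assms]] assms by (simp add: primitive_over_def)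

lemma primitive_over_iff_cross:
  assumes "p \<in> primitive_over r" "p' \<in> primitive_pairs"
  shows "p' \<in> primitive_over r \<longleftrightarrow> Q dvd fst p * snd p' - fst p' * snd p"
proof
  assume "p' \<in> primitive_over r"
  then show "Q dvd fst p * snd p' - fst p' * snd p"
    using lattice_cross_dvd[of "fst p" r "snd p" "fst p'" "snd p'"] assms(1) by (simp add: primitive_over_def)
next
  assume *: "Q dvd fst p * snd p' - fst p' * snd p"
  have "Q dvd (fst p - r * snd p) * snd p'" using assms(1) by (simp add: primitive_over_def)
  then have "Q dvd (fst p - r * snd p) * snd p' - (fst p * snd p' - fst p' * snd p)" using * by (rule dvd_diff)
  also have "(fst p - r * snd p) * snd p' - (fst p * snd p' - fst p' * snd p) = (fst p' - r * snd p') * snd p"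
    by (simp add: algebra_simps)
  finally have "Q dvd fst p' - r * snd p'"
    using dvd_multD primitive_pairs_not_dvd(2)[of p] assms(1) by (auto simp: primitive_over_def)
  then show "p' \<in> primitive_over r" using assms(2) by (simp add: primitive_over_def)
qed

lemma card_primitive_degrees_le:
  "card {p \<in> primitive_pairs. degree (fst p) = a \<and> degree (snd p) = b} \<le> CARD('a) ^ (a + b + 1)"
proof -
  have "{p \<in> primitive_pairs. degree (fst p) = a \<and> degree (snd p) = b} \<subseteq> polys_below (a + 1) \<times> monic_polys b"
    by (auto simp: primitive_pairs_def polys_below_iff monic_polys_def)
  then have "card {p \<in> primitive_pairs. degree (fst p) = a \<and> degree (snd p) = b} \<le>
      card (polys_below (a + 1) \<times> monic_polys b :: ('a poly \<times> 'a poly) set)"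
    by (intro card_mono) auto
  also have "\<dots> = CARD('a) ^ (a + b + 1)"
    by (simp add: card_cartesian_product card_polys_below card_monic_polys power_add)
  finally show ?thesis .
qed

text \<open>The first pair determines the residue, and two primitive pairs of the same degrees over
  one residue have a determinant of degree below \<open>d\<close>, so they coincide.\<close>

lemma card_crossing_trivial: "card (crossing a b a' b') \<le> CARD('a) ^ (a + b + 1)"
proof -
  have "inj_on fst (crossing a b a' b')"
  proof (rule inj_onI)
    fix x y assume a: "x \<in> crossing a b a' b'" "y \<in> crossing a b a' b'" "fst x = fst y"
    define p where "p = fst x"
    have p: "p \<in> primitive_pairs" using a by (auto simp: p_def crossing_def)
    then obtain r where r: "p \<in> primitive_over r" using primitive_over_ex1 by blast
    have "snd x \<in> primitive_over r" "snd y \<in> primitive_over r"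
      using primitive_over_iff_cross[OF r] a by (auto simp: crossing_def p_def)
    moreover have "degree (fst (snd x)) = a'" "degree (snd (snd x)) = b'" "degree (fst (snd y)) = a'"
      "degree (snd (snd y)) = b'" using a by (auto simp: crossing_def)
    moreover have "a' + b' < d" using a(1) by (auto simp: crossing_def primitive_pairs_def)
    ultimately have "snd x = snd y" using primitive_over_eq[of "snd x" r "snd y"] by simp
    then show "x = y" using a(3) by (simp add: prod_eq_iff)
  qed
  then have "card (crossing a b a' b') = card (fst ` crossing a b a' b')" by (simp add: card_image)
  also have "\<dots> \<le> card {p \<in> primitive_pairs. degree (fst p) = a \<and> degree (snd p) = b}"
    by (intro card_mono) (auto simp: crossing_def)
  also have "\<dots> \<le> CARD('a) ^ (a + b + 1)" by (rule card_primitive_degrees_le)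
  finally show ?thesis .
qed

text \<open>Otherwise the determinant has degree below \<open>d\<close>, hence is zero, and the two
  reduced fractions agree.\<close>

lemma crossing_degree_cases:
  assumes "crossing a b a' b' \<noteq> {}"
  shows "d \<le> a + b' \<or> d \<le> a' + b"
proof (rule ccontr)
  assume *: "\<not> (d \<le> a + b' \<or> d \<le> a' + b)"
  obtain p p' where p: "(p, p') \<in> crossing a b a' b'" using assms by auto
  then have "p \<in> primitive_pairs" by (simp add: crossing_def)
  then obtain r where r: "p \<in> primitive_over r" using primitive_over_ex1 by blast
  then have "p' \<in> primitive_over r" using p primitive_over_iff_cross[OF r] by (auto simp: crossing_def)
  then have "p = p'" using r * p by (intro primitive_over_eq) (auto simp: crossing_def)
  then show False using p by (auto simp: crossing_def)
qed

text \<open>A pair in \<open>crossing a b a' b'\<close> satisfies \<open>A B' = A' B + Q E\<close> with \<open>degree E \<le> a + b' - d\<close>,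
  and is determined by \<open>A'\<close>, \<open>B\<close>, \<open>E\<close> and the divisor \<open>A\<close> of \<open>A' B + Q E\<close>.\<close>

definition cofactors :: "nat \<Rightarrow> nat \<Rightarrow> nat \<Rightarrow> ('a poly \<times> 'a poly \<times> 'a poly) set" where
  "cofactors x y z = (polys_below x - {0}) \<times> (polys_below y - {0}) \<times> polys_below z"

lemma finite_cofactors [simp]: "finite (cofactors x y z)"
  by (simp add: cofactors_def)

lemma card_crossing_le_divisors:
  assumes "a + b < d" "a' + b' < d" "d \<le> a + b'"
  shows "card (crossing a b a' b') \<le> (\<Sum>(X, B, E)\<in>cofactors (a' + 1) (b + 1) (a + b' - d + 1).
    if X * B + Q * E \<noteq> 0 \<and> degree (X * B + Q * E) \<le> 2 * d then card {A. A dvd X * B + Q * E} else 0)"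
proof -
  let ?T = "cofactors (a' + 1) (b + 1) (a + b' - d + 1)"
  let ?N = "\<lambda>t. fst t * fst (snd t) + Q * snd (snd t)"
  let ?S = "SIGMA t:{t \<in> ?T. ?N t \<noteq> 0 \<and> degree (?N t) \<le> 2 * d}. {A. A dvd ?N t}"
  let ?E = "\<lambda>p p'. (fst p * snd p' - fst p' * snd p) div Q"
  let ?f = "\<lambda>(p, p'). ((fst p', snd p, ?E p p'), fst p)"
  have cr: "fst p \<noteq> 0 \<and> snd p \<noteq> 0 \<and> fst p' \<noteq> 0 \<and> snd p' \<noteq> 0 \<and> Q * ?E p p' = fst p * snd p' - fst p' * snd p"
    if "(p, p') \<in> crossing a b a' b'" for p p'
    using that by (auto simp: crossing_def primitive_pairs_def)
  have fin: "finite {A. A dvd ?N t}" if "?N t \<noteq> 0" for t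
    by (rule finite_subset[OF _ finite_degree_le[of "degree (?N t)"]]) (use that dvd_imp_degree_le in blast)
  have inj: "inj_on ?f (crossing a b a' b')"
  proof (rule inj_onI)
    fix x y assume a: "x \<in> crossing a b a' b'" "y \<in> crossing a b a' b'" "?f x = ?f y"
    obtain p p' s s' where xy: "x = (p, p')" "y = (s, s')" by (metis surj_pair)
    have e: "fst p' = fst s'" "snd p = snd s" "fst p = fst s" "?E p p' = ?E s s'"
      using a(3) unfolding xy by auto
    have "fst p * snd p' - fst p' * snd p = fst s * snd s' - fst s' * snd s"
      using cr[of p p'] cr[of s s'] a(1,2) e(4) xy by metis
    then have "fst p * snd p' = fst p * snd s'" using e by simp
    then have "snd p' = snd s'" using cr[of p p'] a(1) xy by simp
    then show "x = y" using e xy by (simp add: prod_eq_iff)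
  qed
  have sub: "?f ` crossing a b a' b' \<subseteq> ?S"
  proof (rule subsetI)
    fix x assume "x \<in> ?f ` crossing a b a' b'"
    then obtain p p' where p: "(p, p') \<in> crossing a b a' b'" "x = ((fst p', snd p, ?E p p'), fst p)" by auto
    note nz = cr[OF p(1)]
    have deg: "degree (fst p) = a" "degree (snd p) = b" "degree (fst p') = a'" "degree (snd p') = b'"
      using p(1) by (auto simp: crossing_def)
    have N: "fst p' * snd p + Q * ?E p p' = fst p * snd p'" using nz by simp
    have dN: "degree (fst p * snd p') = a + b'" using nz deg by (simp add: degree_mult_eq)
    \<comment> \<open>Since \<open>a + b\<close> and \<open>a' + b'\<close> are both below
      \<open>d\<close>, the assumption \<open>d \<le> a + b'\<close> forces
      \<open>a' + b < d\<close>; so \<open>A B'\<close> dominates the determinant.\<close>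
    have "degree (fst p' * snd p) \<le> a + b'" using nz deg assms by (simp add: degree_mult_eq)
    then have "degree (Q * ?E p p') \<le> a + b'" using nz dN by (metis degree_diff_le order_refl)
    then have "?E p p' \<in> polys_below (a + b' - d + 1)"
      using Q_nonzero by (cases "?E p p' = 0") (auto simp: polys_below_iff degree_mult_eq)
    then have "(fst p', snd p, ?E p p') \<in> ?T"
      using nz deg by (auto simp: cofactors_def polys_below_iff)
    moreover have "a + b' \<le> 2 * d" using assms by simp
    ultimately show "x \<in> ?S" using p(2) N nz dN by simp
  qed
  have finS: "finite ?S" by (rule finite_SigmaI) (use fin in auto)
  have "card (crossing a b a' b') = card (?f ` crossing a b a' b')" by (simp add: card_image[OF inj])
  also have "\<dots> \<le> card ?S" by (rule card_mono[OF finS sub])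
  also have "\<dots> = (\<Sum>t\<in>{t \<in> ?T. ?N t \<noteq> 0 \<and> degree (?N t) \<le> 2 * d}. card {A. A dvd ?N t})"
    by (rule card_SigmaI) (use fin in auto)
  also have "\<dots> = (\<Sum>t\<in>?T. if ?N t \<noteq> 0 \<and> degree (?N t) \<le> 2 * d then card {A. A dvd ?N t} else 0)"
    by (rule sum.inter_filter) simp
  finally show ?thesis by (simp add: case_prod_beta)
qed

lemma card_cofactors_le: "card (cofactors x y z) \<le> CARD('a) ^ (x + y + z)"
proof -
  have "card (cofactors x y z) \<le> card (polys_below x \<times> polys_below y \<times> polys_below z :: ('a poly \<times> 'a poly \<times> 'a poly) set)"
    by (intro card_mono) (auto simp: cofactors_def)
  then show ?thesis by (simp add: card_cartesian_product card_polys_below power_add mult.assoc)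
qed

text \<open>Solve the congruence for a variable whose range is at least as long as
  \<open>degree F\<close>. For \<open>X\<close> or \<open>B\<close> it is bilinear; for
  \<open>E\<close> the coefficient is \<open>Q\<close>, which is coprime to \<open>F\<close> because
  \<open>degree F \<le> z < d\<close>.\<close>

lemma card_cofactors_dvd_le:
  assumes F: "F \<noteq> 0" and deg: "degree F \<le> max (max x y) z" and z: "z < d"
  shows "card {t \<in> cofactors x y z. F dvd fst t * fst (snd t) + Q * snd (snd t)} \<le>
    tau F * CARD('a) ^ (x + y + z - degree F)"
proof -
  let ?q = "CARD('a)"
  let ?S = "{t \<in> cofactors x y z. F dvd fst t * fst (snd t) + Q * snd (snd t)}"
  let ?U = "\<lambda>E. {(X, B). X \<in> polys_below x \<and> B \<in> polys_below y - {0} \<and> F dvd X * B + Q * E}"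
  let ?V = "\<lambda>E. {(B, X). B \<in> polys_below y \<and> X \<in> polys_below x - {0} \<and> F dvd B * X + Q * E}"
  have finU: "finite (?U E)" "finite (?V E)" for E
    by (rule finite_subset[of _ "polys_below x \<times> polys_below y"], auto)
      (rule finite_subset[of _ "polys_below y \<times> polys_below x"], auto)
  consider "degree F \<le> x" | "degree F \<le> y" | "degree F \<le> z" using deg by linarith
  then show ?thesis
  proof cases
    case 1
    have "?S \<subseteq> (\<Union>E\<in>polys_below z. (\<lambda>(X, B). (X, B, E)) ` ?U E)"
      by (auto simp: cofactors_def image_iff)
    then have "card ?S \<le> card (\<Union>E\<in>polys_below z. (\<lambda>(X, B). (X, B, E)) ` ?U E)"
      by (intro card_mono finite_UN_I finite_imageI finU) auto
    also have "\<dots> \<le> (\<Sum>E\<in>polys_below z. card ((\<lambda>(X, B). (X, B, E)) ` ?U E))"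
      by (rule card_UN_le) simp
    also have "\<dots> \<le> (\<Sum>E\<in>(polys_below z :: 'a poly set). tau F * ?q ^ (x + y - degree F))"
      by (intro sum_mono order_trans[OF card_image_le card_bilinear_congruence] finU F 1)
    also have "\<dots> = tau F * ?q ^ (x + y + z - degree F)"
      using 1 by (simp add: card_polys_below mult_ac add_ac flip: power_add)
    finally show ?thesis .
  next
    case 2
    have "?S \<subseteq> (\<Union>E\<in>polys_below z. (\<lambda>(B, X). (X, B, E)) ` ?V E)"
      by (auto simp: cofactors_def image_iff mult.commute)
    then have "card ?S \<le> card (\<Union>E\<in>polys_below z. (\<lambda>(B, X). (X, B, E)) ` ?V E)"
      by (intro card_mono finite_UN_I finite_imageI finU) auto
    also have "\<dots> \<le> (\<Sum>E\<in>polys_below z. card ((\<lambda>(B, X). (X, B, E)) ` ?V E))"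
      by (rule card_UN_le) simp
    also have "\<dots> \<le> (\<Sum>E\<in>(polys_below z :: 'a poly set). tau F * ?q ^ (y + x - degree F))"
      by (intro sum_mono order_trans[OF card_image_le card_bilinear_congruence] finU F 2)
    also have "\<dots> = tau F * ?q ^ (x + y + z - degree F)"
      using 2 by (simp add: card_polys_below mult_ac add_ac flip: power_add)
    finally show ?thesis .
  next
    case 3
    have "\<not> Q dvd F" using 3 z F dvd_imp_degree_le[of Q F] by auto
    then have cop: "coprime F Q" by (simp add: coprime_Q_iff)
    let ?W = "\<lambda>D. {E \<in> polys_below z. F dvd E * Q + D}"
    have "?S \<subseteq> (\<Union>(X, B)\<in>polys_below x \<times> polys_below y. (\<lambda>E. (X, B, E)) ` ?W (X * B))"
      by (auto simp: cofactors_def image_iff mult.commute add.commute)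
    then have "card ?S \<le> card (\<Union>(X, B)\<in>polys_below x \<times> polys_below y. (\<lambda>E. (X, B, E)) ` ?W (X * B))"
      by (intro card_mono finite_UN_I) auto
    also have "\<dots> \<le> (\<Sum>p\<in>polys_below x \<times> polys_below y. card (case p of (X, B) \<Rightarrow> (\<lambda>E. (X, B, E)) ` ?W (X * B)))"
      by (rule card_UN_le) simp
    also have "\<dots> \<le> (\<Sum>p\<in>(polys_below x \<times> polys_below y :: ('a poly \<times> 'a poly) set). ?q ^ (z - degree F))"
    proof (rule sum_mono)
      fix p :: "'a poly \<times> 'a poly"
      have "card (?W D) \<le> ?q ^ (z - degree F)" for D
        using card_linear_congruence[of F 1 F Q Q z D] cop F by simp
      moreover have "card ((\<lambda>E. (fst p, snd p, E)) ` ?W (fst p * snd p)) \<le> card (?W (fst p * snd p))"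
        by (rule card_image_le) simp
      ultimately show "card (case p of (X, B) \<Rightarrow> (\<lambda>E. (X, B, E)) ` ?W (X * B)) \<le> ?q ^ (z - degree F)"
        by (auto simp: case_prod_beta intro: order_trans)
    qed
    also have "\<dots> = ?q ^ (x + y + z - degree F)"
      using 3 by (simp add: card_cartesian_product card_polys_below flip: power_add)
    also have "\<dots> \<le> tau F * ?q ^ (x + y + z - degree F)" using tau_pos[OF F] by simp
    finally show ?thesis .
  qed
qed

text \<open>\<open>4 * d \<le> Y * J\<close> makes Landreau's inequality available for degrees up to
  \<open>2 * d\<close>. The count of multiples of \<open>F\<close> brings one more factor
  \<open>tau F\<close>, hence the moment of order \<open>Suc J\<close>. In the exponent, 4 stands
  for the three ranges, each one longer than its degree bound, and for the leading coefficient of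
  the divisor \<open>A\<close>.\<close>

theorem card_crossing_le:
  assumes K: "\<And>n. (\<Sum>N\<in>(monic_polys n :: 'a poly set). tau N ^ Suc J) \<le> CARD('a) ^ n * (n + 1) ^ K"
    and Y: "4 * d \<le> Y * J" and deg: "a + b < d" "a' + b' < d" "d \<le> a + b'"
  shows "card (crossing a b a' b') \<le> 2 ^ J * (Y + 1) ^ (K + 1) * CARD('a) ^ (a' + b + (a + b' - d) + 4) *
    (if Y \<le> max (max a' b) (a + b' - d) + 1 then 1 else CARD('a) ^ Y)"
proof -
  let ?q = "CARD('a)"
  define z where "z = a + b' - d + 1"
  define M where "M = (a' + 1) + (b + 1) + z"
  let ?T = "cofactors (a' + 1) (b + 1) z"
  let ?N = "\<lambda>t. fst t * fst (snd t) + Q * snd (snd t)"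
  \<comment> \<open>All three ranges are shorter than \<open>Y\<close>, so multiples of
    \<open>F\<close> need not be evenly distributed among the triples; they are then bounded by all
    triples, at the cost of \<open>q ^ Y\<close>.\<close>
  define big where "big \<longleftrightarrow> \<not> Y \<le> max (max a' b) (a + b' - d) + 1"
  define G where "G = (if big then ?q ^ Y else 1)"
  have z: "z < d" using deg by (simp add: z_def)
  have "card (crossing a b a' b') \<le> (\<Sum>t\<in>?T. if ?N t \<noteq> 0 \<and> degree (?N t) \<le> 2 * d then card {A. A dvd ?N t} else 0)"
    using card_crossing_le_divisors[OF deg] by (simp add: case_prod_beta z_def)
  also have "\<dots> \<le> (\<Sum>t\<in>?T. \<Sum>j\<le>Y. \<Sum>F\<in>monic_polys j. if F dvd ?N t then ?q * (2 * tau F) ^ J else 0)"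
  proof (rule sum_mono)
    fix t
    show "(if ?N t \<noteq> 0 \<and> degree (?N t) \<le> 2 * d then card {A. A dvd ?N t} else 0) \<le>
      (\<Sum>j\<le>Y. \<Sum>F\<in>monic_polys j. if F dvd ?N t then ?q * (2 * tau F) ^ J else 0)"
    proof (cases "?N t \<noteq> 0 \<and> degree (?N t) \<le> 2 * d")
      case True
      then have "card {A. A dvd ?N t} \<le> ?q * tau (?N t)" using card_divisors_le by blast
      also have "tau (?N t) \<le> (\<Sum>j\<le>Y. \<Sum>F\<in>monic_polys j. if F dvd ?N t then (2 * tau F) ^ J else 0)"
        by (rule tau_le_sum_small_divisors) (use True Y in auto)
      finally have "card {A. A dvd ?N t} \<le> ?q * (\<Sum>j\<le>Y. \<Sum>F\<in>monic_polys j. if F dvd ?N t then (2 * tau F) ^ J else 0)"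
        by simp
      also have "\<dots> = (\<Sum>j\<le>Y. \<Sum>F\<in>monic_polys j. if F dvd ?N t then ?q * (2 * tau F) ^ J else 0)"
        unfolding sum_distrib_left by (intro sum.cong refl) auto
      finally show ?thesis unfolding if_P[OF True] .
    next
      case False
      show ?thesis unfolding if_not_P[OF False] by (rule le0)
    qed
  qed
  also have "\<dots> = (\<Sum>j\<le>Y. \<Sum>t\<in>?T. \<Sum>F\<in>monic_polys j. if F dvd ?N t then ?q * (2 * tau F) ^ J else 0)"
    by (rule sum.swap)
  also have "\<dots> = (\<Sum>j\<le>Y. \<Sum>F\<in>monic_polys j. \<Sum>t\<in>?T. if F dvd ?N t then ?q * (2 * tau F) ^ J else 0)"
    by (intro sum.cong refl sum.swap)
  also have "\<dots> = (\<Sum>j\<le>Y. \<Sum>F\<in>monic_polys j. card {t \<in> ?T. F dvd ?N t} * (?q * (2 * tau F) ^ J))"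
  proof (intro sum.cong refl)
    fix F :: "'a poly"
    have "(\<Sum>t\<in>?T. if F dvd ?N t then ?q * (2 * tau F) ^ J else 0) = (\<Sum>t\<in>{t \<in> ?T. F dvd ?N t}. ?q * (2 * tau F) ^ J)"
      by (rule sum.inter_filter[symmetric]) simp
    then show "(\<Sum>t\<in>?T. if F dvd ?N t then ?q * (2 * tau F) ^ J else 0) = card {t \<in> ?T. F dvd ?N t} * (?q * (2 * tau F) ^ J)"
      by simp
  qed
  also have "\<dots> \<le> (\<Sum>j\<le>Y. 2 ^ J * (Y + 1) ^ K * ?q ^ (M + 1) * G)"
  proof (rule sum_mono)
    fix j assume "j \<in> {..Y}"
    then have j: "j \<le> Y" by simp
    \<comment> \<open>Multiplication by \<open>q ^ j\<close> expresses the density of multiples of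
      \<open>F\<close> without fractions. The factor is cancelled below by the \<open>q ^ j\<close>
      in the moment bound.\<close>
    have each: "?q ^ j * (card {t \<in> ?T. F dvd ?N t} * (?q * (2 * tau F) ^ J)) \<le> 2 ^ J * ?q ^ (M + 1) * G * tau F ^ Suc J"
      if "F \<in> monic_polys j" for F
    proof -
      have F: "F \<noteq> 0" "degree F = j" using that monic_polys_nonzero by (auto simp: monic_polys_def)
      have "?q ^ j * card {t \<in> ?T. F dvd ?N t} \<le> tau F * ?q ^ M * G"
      proof (cases big)
        case False
        then have "degree F \<le> max (max (a' + 1) (b + 1)) z" using F(2) j by (auto simp: big_def z_def)
        then have "card {t \<in> ?T. F dvd ?N t} \<le> tau F * ?q ^ (M - j)" and "j \<le> M"
          using card_cofactors_dvd_le[OF F(1) _ z, of "a' + 1" "b + 1"] F(2) by (auto simp: M_def)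
        then have "?q ^ j * card {t \<in> ?T. F dvd ?N t} \<le> ?q ^ j * (tau F * ?q ^ (M - j))" by simp
        also have "\<dots> = tau F * ?q ^ M" using \<open>j \<le> M\<close> by (simp add: mult_ac flip: power_add)
        finally show ?thesis using False by (simp add: G_def)
      next
        case True
        have "card {t \<in> ?T. F dvd ?N t} \<le> card ?T" by (intro card_mono) auto
        also have "\<dots> \<le> ?q ^ M" unfolding M_def by (rule card_cofactors_le)
        finally have "?q ^ j * card {t \<in> ?T. F dvd ?N t} \<le> ?q ^ Y * ?q ^ M"
          using j by (intro mult_le_mono power_increasing) auto
        also have "\<dots> \<le> tau F * (?q ^ Y * ?q ^ M)" using tau_pos[OF F(1)] by simp
        finally show ?thesis using True by (simp add: G_def mult_ac)
      qed
      then have "(?q ^ j * card {t \<in> ?T. F dvd ?N t}) * (?q * (2 * tau F) ^ J) \<le> (tau F * ?q ^ M * G) * (?q * (2 * tau F) ^ J)"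
        by (rule mult_le_mono1)
      then show ?thesis by (simp add: power_mult_distrib mult_ac)
    qed
    have "?q ^ j * (\<Sum>F\<in>monic_polys j. card {t \<in> ?T. F dvd ?N t} * (?q * (2 * tau F) ^ J)) \<le>
        (\<Sum>F\<in>(monic_polys j :: 'a poly set). 2 ^ J * ?q ^ (M + 1) * G * tau F ^ Suc J)"
      unfolding sum_distrib_left by (rule sum_mono) (rule each)
    also have "\<dots> = 2 ^ J * ?q ^ (M + 1) * G * (\<Sum>F\<in>(monic_polys j :: 'a poly set). tau F ^ Suc J)"
      by (rule sum_distrib_left[symmetric])
    also have "\<dots> \<le> 2 ^ J * ?q ^ (M + 1) * G * (?q ^ j * (Y + 1) ^ K)"
      by (intro mult_le_mono order_refl order_trans[OF K] power_mono) (use j in auto)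
    also have "\<dots> = ?q ^ j * (2 ^ J * (Y + 1) ^ K * ?q ^ (M + 1) * G)" by (simp only: mult_ac)
    finally show "(\<Sum>F\<in>monic_polys j. card {t \<in> ?T. F dvd ?N t} * (?q * (2 * tau F) ^ J)) \<le>
        2 ^ J * (Y + 1) ^ K * ?q ^ (M + 1) * G" by simp
  qed
  also have "\<dots> = 2 ^ J * (Y + 1) ^ (K + 1) * ?q ^ (M + 1) * G" by (simp add: algebra_simps)
  finally have "card (crossing a b a' b') \<le> 2 ^ J * (Y + 1) ^ (K + 1) * ?q ^ (M + 1) * G" .
  moreover have "M + 1 = a' + b + (a + b' - d) + 4" by (simp add: M_def z_def)
  moreover have "G = (if Y \<le> max (max a' b) (a + b' - d) + 1 then 1 else ?q ^ Y)"
    by (simp only: G_def big_def) simp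
  ultimately show ?thesis by (simp only:)
qed

end

section \<open>Coprime pairs of monic polynomials\<close>

definition coprime_monic :: "nat \<Rightarrow> nat \<Rightarrow> ('a::{field,finite} poly \<times> 'a poly) set" where
  "coprime_monic a b = {(A, B). A \<in> monic_polys a \<and> B \<in> monic_polys b \<and> coprime A B}"

lemma finite_coprime_monic [simp]: "finite (coprime_monic a b)"
  by (rule finite_subset[of _ "monic_polys a \<times> monic_polys b"]) (auto simp: coprime_monic_def)

text \<open>Sort all monic pairs by the degree \<open>i\<close> of their monic gcd, for which there
  are \<open>q ^ i\<close> choices.\<close>

lemma sum_card_coprime_monic:
  "(\<Sum>i\<le>min a b. CARD('a) ^ i * card (coprime_monic (a - i) (b - i) :: ('a::{field,finite} poly \<times> 'a poly) set)) = CARD('a) ^ (a + b)"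
proof -
  let ?C = "\<lambda>i. coprime_monic (a - i) (b - i) :: ('a poly \<times> 'a poly) set"
  let ?S = "SIGMA i:{..min a b}. (monic_polys i :: 'a poly set) \<times> ?C i"
  let ?f = "\<lambda>(i::nat, G, p). (G * fst p, G * snd p)"
  have inj: "inj_on ?f ?S"
  proof (rule inj_onI)
    fix x y assume a: "x \<in> ?S" "y \<in> ?S" "?f x = ?f y"
    obtain i G A B where x: "x = (i, G, (A, B))" "G \<in> monic_polys i" "A \<in> monic_polys (a - i)"
      "B \<in> monic_polys (b - i)" "coprime A B" using a(1) by (auto simp: coprime_monic_def)
    obtain j H C D where y: "y = (j, H, (C, D))" "H \<in> monic_polys j" "C \<in> monic_polys (a - j)"
      "D \<in> monic_polys (b - j)" "coprime C D" using a(2) by (auto simp: coprime_monic_def)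
    have e: "G * A = H * C" "G * B = H * D" using a(3) x(1) y(1) by auto
    have nz: "G \<noteq> 0" "H \<noteq> 0" "B \<noteq> 0" using x y monic_polys_nonzero by blast+
    have "(G * A) * (H * D) = (H * C) * (G * B)" using e by simp
    then have "(G * H) * (A * D) = (G * H) * (C * B)" by (simp add: mult_ac)
    then have "A * D = C * B" using nz by simp
    then have AC: "A = C" "B = D"
      using coprime_proportional_eq[of A B C D] x y by (auto simp: monic_polys_def)
    then have "G = H" using e(2) nz by simp
    moreover have "i = j" using \<open>G = H\<close> x(2) y(2) by (simp add: monic_polys_def)
    ultimately show "x = y" using x(1) y(1) AC by simp
  qed
  have "?f ` ?S = monic_polys a \<times> monic_polys b"
  proof (intro equalityI subsetI)
    fix x assume "x \<in> ?f ` ?S"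
    then obtain i G A B where x: "x = (G * A, G * B)" "i \<le> min a b" "G \<in> monic_polys i" "A \<in> monic_polys (a - i)"
      "B \<in> monic_polys (b - i)" by (auto simp: coprime_monic_def)
    have mm: "F * H \<in> monic_polys (n + m)" if "F \<in> monic_polys n" "H \<in> monic_polys m" for F H :: "'a poly" and n m
    proof -
      have l: "lead_coeff F = 1" "lead_coeff H = 1" "degree F = n" "degree H = m" "F \<noteq> 0" "H \<noteq> 0"
        using that by (auto simp: monic_polys_def)
      have "lead_coeff (F * H) = 1" unfolding lead_coeff_mult l(1,2) by simp
      moreover have "degree (F * H) = n + m" using l by (simp add: degree_mult_eq)
      ultimately show ?thesis by (simp only: monic_polys_def mem_Collect_eq)
    qed
    show "x \<in> monic_polys a \<times> monic_polys b"
      using mm[OF x(3,4)] mm[OF x(3,5)] x(1,2) by simp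
  next
    fix x :: "'a poly \<times> 'a poly" assume "x \<in> monic_polys a \<times> monic_polys b"
    then obtain A B where x: "x = (A, B)" "A \<in> monic_polys a" "B \<in> monic_polys b" by blast
    have AB: "A \<noteq> 0" "B \<noteq> 0" "lead_coeff A = 1" "lead_coeff B = 1" "degree A = a" "degree B = b"
      using x by (auto simp: monic_polys_def)
    obtain G A' B' where G: "lead_coeff G = 1" "A = G * A'" "B = G * B'" "coprime A' B'"
      using ex_coprime_decomposition[OF AB(2)] by metis
    have nz: "G \<noteq> 0" "A' \<noteq> 0" "B' \<noteq> 0" using G AB by auto
    have "lead_coeff A' = 1" "lead_coeff B' = 1" using AB(3,4) G(1) unfolding G(2,3) lead_coeff_mult by auto
    moreover have "a = degree G + degree A'" "b = degree G + degree B'"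
      using AB(5,6) nz unfolding G(2,3) by (simp_all add: degree_mult_eq)
    ultimately have "(degree G, G, (A', B')) \<in> ?S"
      using G(1,4) by (auto simp: coprime_monic_def monic_polys_def)
    moreover have "x = ?f (degree G, G, (A', B'))" using x(1) G by simp
    ultimately show "x \<in> ?f ` ?S" by blast
  qed
  then have "card ?S = card (monic_polys a \<times> monic_polys b :: ('a poly \<times> 'a poly) set)"
    using card_image[OF inj] by simp
  then show ?thesis
    by (simp add: card_cartesian_product card_monic_polys power_add)
qed

text \<open>In the sorting by gcd for \<open>(Suc a, Suc b)\<close>, the terms with nonconstant gcd
  are \<open>q\<close> times the whole sum for \<open>(a, b)\<close>. Hence coprime pairs have
  density exactly \<open>1 - 1/q\<close> when both degrees are positive.\<close>

lemma card_coprime_monic_Suc: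
  "card (coprime_monic (Suc a) (Suc b) :: ('a::{field,finite} poly \<times> 'a poly) set) + CARD('a) ^ (a + b + 1) = CARD('a) ^ (a + b + 2)"
proof -
  let ?c = "\<lambda>a b. card (coprime_monic a b :: ('a poly \<times> 'a poly) set)"
  have "CARD('a) ^ (a + b + 2) = (\<Sum>i\<le>Suc (min a b). CARD('a) ^ i * ?c (Suc a - i) (Suc b - i))"
    using sum_card_coprime_monic[where 'a = 'a, of "Suc a" "Suc b"] by simp
  also have "\<dots> = ?c (Suc a) (Suc b) + (\<Sum>i\<le>min a b. CARD('a) * (CARD('a) ^ i * ?c (a - i) (b - i)))"
    by (subst sum.atMost_Suc_shift) (simp add: mult.assoc)
  also have "(\<Sum>i\<le>min a b. CARD('a) * (CARD('a) ^ i * ?c (a - i) (b - i))) = CARD('a) ^ (a + b + 1)"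
    unfolding sum_distrib_left[symmetric] sum_card_coprime_monic by simp
  finally show ?thesis by simp
qed

lemma card_coprime_monic_le:
  "card (coprime_monic a b :: ('a::{field,finite} poly \<times> 'a poly) set) \<le> CARD('a) ^ (a + b)"
proof -
  have "card (coprime_monic a b :: ('a poly \<times> 'a poly) set) \<le> card (monic_polys a \<times> monic_polys b :: ('a poly \<times> 'a poly) set)"
    by (intro card_mono) (auto simp: coprime_monic_def)
  then show ?thesis by (simp add: card_cartesian_product card_monic_polys power_add)
qed

section \<open>Elementary sums and bounds\<close>

lemma geometric_partial_sum_le:
  fixes u :: real
  assumes "0 \<le> u" "u < 1"
  shows "(\<Sum>j<n. u ^ j) \<le> 1 / (1 - u)"
proof -
  have "(\<Sum>j<n. u ^ j) = (1 - u ^ n) / (1 - u)" using assms by (simp add: sum_gp_strict)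
  also have "\<dots> \<le> 1 / (1 - u)" using assms by (intro divide_right_mono) auto
  finally show ?thesis .
qed

text \<open>\<open>(j + 1) u ^ j\<close> is a coefficient of the Cauchy square of the geometric
  series.\<close>

lemma arith_geometric_partial_sum_le:
  fixes u :: real
  assumes "0 \<le> u" "u < 1"
  shows "(\<Sum>j<n. real (Suc j) * u ^ j) \<le> (1 / (1 - u))\<^sup>2"
proof -
  have "(\<Sum>j<n. real (Suc j) * u ^ j) = (\<Sum>j<n. \<Sum>i\<le>j. u ^ i * u ^ (j - i))"
    by (intro sum.cong refl) (simp flip: power_add)
  also have "\<dots> \<le> (\<Sum>i<n. u ^ i) * (\<Sum>i<n. u ^ i)"
  proof -
    have "(\<Sum>j<n. \<Sum>i\<le>j. u ^ i * u ^ (j - i)) = (\<Sum>(j, i)\<in>(SIGMA j:{..<n}. {..j}). u ^ i * u ^ (j - i))"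
      by (rule sum.Sigma) auto
    also have "\<dots> = (\<Sum>(i, k) | i + k < n. u ^ i * u ^ k)"
      by (rule sum.reindex_bij_witness[of _ "\<lambda>(i, k). (i + k, i)" "\<lambda>(j, i). (i, j - i)"]) auto
    also have "\<dots> \<le> (\<Sum>(i, k)\<in>{..<n} \<times> {..<n}. u ^ i * u ^ k)"
      by (rule sum_mono2) (use assms in auto)
    also have "\<dots> = (\<Sum>i<n. u ^ i) * (\<Sum>i<n. u ^ i)"
      by (simp add: sum_product sum.cartesian_product)
    finally show ?thesis .
  qed
  also have "\<dots> \<le> (1 / (1 - u)) * (1 / (1 - u))"
    using geometric_partial_sum_le[OF assms] assms by (intro mult_mono) (auto intro: sum_nonneg)
  finally show ?thesis by (simp add: power2_eq_square)
qed

lemma sum_arith_geometric_shift_le: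
  fixes u :: real
  assumes "0 \<le> u" "u < 1"
  shows "(\<Sum>e\<in>{e'..n}. real e * u ^ (e - e')) \<le> real (Suc e') * (1 / (1 - u))\<^sup>2"
proof (cases "e' \<le> n")
  case True
  have "(\<Sum>e\<in>{e'..n}. real e * u ^ (e - e')) = (\<Sum>j<Suc (n - e'). real (e' + j) * u ^ j)"
    by (rule sum.reindex_bij_witness[of _ "\<lambda>j. e' + j" "\<lambda>e. e - e'"]) (use True in auto)
  also have "\<dots> \<le> (\<Sum>j<Suc (n - e'). real (Suc e') * (real (Suc j) * u ^ j))"
  proof (rule sum_mono)
    fix j
    have "e' + j \<le> Suc e' * Suc j" by simp
    then have "real (e' + j) \<le> real (Suc e') * real (Suc j)" by (metis of_nat_le_iff of_nat_mult)
    then have "real (e' + j) * u ^ j \<le> real (Suc e') * real (Suc j) * u ^ j"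
      using assms by (intro mult_right_mono) auto
    then show "real (e' + j) * u ^ j \<le> real (Suc e') * (real (Suc j) * u ^ j)" by (simp only: mult.assoc)
  qed
  also have "\<dots> = real (Suc e') * (\<Sum>j<Suc (n - e'). real (Suc j) * u ^ j)"
    by (rule sum_distrib_left[symmetric])
  also have "\<dots> \<le> real (Suc e') * (1 / (1 - u))\<^sup>2"
    by (rule mult_left_mono[OF arith_geometric_partial_sum_le[OF assms]]) simp
  finally show ?thesis .
qed simp

text \<open>Induction with \<open>u\<close> varying: one factor \<open>n\<close> is absorbed by half
  of the decay, and \<open>sqrt u\<close> is left for the remaining power.\<close>

lemma power_times_geometric_bounded:
  fixes u :: real
  assumes "0 \<le> u" "u < 1"
  shows "\<exists>C. \<forall>n::nat. real n ^ k * u ^ n \<le> C"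
  using assms
proof (induction k arbitrary: u)
  case 0
  then show ?case by (intro exI[of _ 1]) (simp add: power_le_one)
next
  case (Suc k)
  define v where "v = sqrt u"
  have v: "0 \<le> v" "v < 1" "u = v * v" using Suc.prems by (auto simp: v_def)
  obtain C where C: "\<And>n. real n ^ k * v ^ n \<le> C" using Suc.IH[OF v(1,2)] by blast
  have "real n ^ Suc k * u ^ n \<le> C * (1 / (1 - v))\<^sup>2" for n
  proof -
    have "real (Suc n) * v ^ n \<le> (\<Sum>j<Suc n. real (Suc j) * v ^ j)"
      by (rule member_le_sum[of n "{..<Suc n}" "\<lambda>j. real (Suc j) * v ^ j"]) (use v in auto)
    also have "\<dots> \<le> (1 / (1 - v))\<^sup>2" by (rule arith_geometric_partial_sum_le[OF v(1,2)])
    finally have "real n * v ^ n \<le> (1 / (1 - v))\<^sup>2"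
      using v by (simp add: algebra_simps)  (smt (verit) zero_le_power)
    then have "(real n ^ k * v ^ n) * (real n * v ^ n) \<le> C * (1 / (1 - v))\<^sup>2"
      using C[of n] C[of 0] v by (intro mult_mono) (auto intro: order_trans[OF _ C[of n]])
    then show ?thesis by (simp add: v(3) power_mult_distrib mult_ac)
  qed
  then show ?case by blast
qed

text \<open>There are at most \<open>m\<close> summands, each at most \<open>m^2\<close>, and the
  largest \<open>m\<close> has \<open>m^3 \<le> n\<close>.\<close>

lemma sum_squares_cube_le: "(\<Sum>e | 1 \<le> e \<and> e ^ 3 \<le> n. e\<^sup>2) \<le> (n::nat)"
proof -
  let ?S = "{e::nat. 1 \<le> e \<and> e ^ 3 \<le> n}"
  have le: "e \<le> e ^ 3" for e :: nat by (cases e) (simp_all add: power3_eq_cube)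
  have fin: "finite ?S" by (rule finite_subset[of _ "{..n}"]) (use le order_trans in blast, simp)
  show ?thesis
  proof (cases "?S = {}")
    case False
    define m where "m = Max ?S"
    have m: "m \<in> ?S" unfolding m_def using fin False by (rule Max_in)
    have "?S \<subseteq> {1..m}" using fin by (auto simp: m_def)
    then have "card ?S \<le> m" using card_mono[of "{1..m}" ?S] by simp
    have "(\<Sum>e\<in>?S. e\<^sup>2) \<le> card ?S * m\<^sup>2"
      using sum_bounded_above[of ?S "\<lambda>e. e\<^sup>2" "m\<^sup>2"] fin by (auto simp: m_def)
    also have "\<dots> \<le> m * m\<^sup>2" using \<open>card ?S \<le> m\<close> by simp
    also have "\<dots> \<le> n" using m by (simp add: power3_eq_cube power2_eq_square)
    finally show ?thesis .
  next
    case True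
    then show ?thesis by (simp only: sum.empty)
  qed
qed

text \<open>For fixed \<open>b\<close>, distinct \<open>a\<close> have distinct gaps as long as
  these are positive; \<open>\<phi> 0 = 0\<close> discards the truncated ones.\<close>

lemma sum_degree_gap_le:
  fixes \<phi> :: "nat \<Rightarrow> real"
  assumes "\<And>e. \<phi> e \<ge> 0" "\<phi> 0 = 0"
  shows "(\<Sum>a<d. \<phi> (d - (a + b))) \<le> (\<Sum>e\<in>{1..d}. \<phi> e)"
proof -
  have "(\<Sum>a<d. \<phi> (d - (a + b))) = (\<Sum>a | a + b < d. \<phi> (d - (a + b)))"
    by (rule sum.mono_neutral_right) (use assms(2) in \<open>auto simp: not_less\<close>)
  also have "\<dots> = (\<Sum>e\<in>(\<lambda>a. d - (a + b)) ` {a. a + b < d}. \<phi> e)"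
    by (rule sum.reindex[symmetric, unfolded o_def]) (auto simp: inj_on_def)
  also have "\<dots> \<le> (\<Sum>e\<in>{1..d}. \<phi> e)"
    by (rule sum_mono2) (use assms(1) in auto)
  finally show ?thesis .
qed

section \<open>The weighted sum over off-diagonal pairs\<close>

context irreducible_modulus_weight
begin

lemma crossing_empty: "\<not> (a + b < d \<and> a' + b' < d) \<Longrightarrow> crossing a b a' b' = {}"
  by (auto simp: crossing_def primitive_pairs_def)

lemma card_crossing_swap: "card (crossing a b a' b') = card (crossing a' b' a b)"
proof (rule bij_betw_same_card[of prod.swap])
  show "bij_betw prod.swap (crossing a b a' b') (crossing a' b' a b)"
    by (rule bij_betwI[where g = prod.swap]) (auto simp: crossing_def dvd_diff_commute)
qed

lemma q_u_power: "q ^ k * u ^ (2 * k) = 1"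
  using u_q_power[of k] by (simp add: mult.commute)

lemma u_power_antimono: "m \<le> n \<Longrightarrow> u ^ n \<le> u ^ m"
  using u_pos u_lt_1 by (intro power_decreasing) auto

text \<open>The weight is \<open>u ^ (2 * M + e)\<close>, where \<open>e\<close> is the sum of both
  gaps: the count, about \<open>q ^ M\<close>, is absorbed exactly and \<open>u ^ e\<close> remains.
  The moment 41 is one more than the power 40 in Landreau's inequality.\<close>

lemma card_crossing_weight_le_aux:
  assumes K: "\<And>n. (\<Sum>N\<in>(monic_polys n :: 'a poly set). tau N ^ 41) \<le> CARD('a) ^ n * (n + 1) ^ K"
    and deg: "a + b < d" "a' + b' < d" "d \<le> a + b'"
  shows "real (card (crossing a b a' b')) * u ^ (a + b + (a' + b')) \<le>
    2 ^ 40 * (3 * real d) ^ (K + 1) * q ^ 4 * u ^ min (d - (a + b)) (d - (a' + b'))"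
proof -
  define Y where "Y = d div 10 + 1"
    \<comment> \<open>large enough for \<open>4 d \<le> 40 Y\<close>, and small enough for the factor \<open>q ^ Y\<close> to be absorbed: if \<open>a'\<close>, \<open>b\<close>
      and \<open>a + b' - d\<close> are all less than \<open>Y - 1\<close>, then \<open>e \<ge> d - 3 Y + 6 \<ge> 2 Y + d div 2\<close>\<close>
  define M where "M = a' + b + (a + b' - d)"
  define e where "e = (d - (a + b)) + (d - (a' + b'))"
  define P where "P = 2 ^ 40 * (3 * real d) ^ (K + 1)"
  let ?small = "Y \<le> max (max a' b) (a + b' - d) + 1"
  have P: "P \<ge> 0" by (simp add: P_def)
  have exps: "a + b + (a' + b') = 2 * M + e" "e + M = d" using deg by (auto simp: M_def e_def)
  have min: "min (d - (a + b)) (d - (a' + b')) \<le> e" "2 * min (d - (a + b)) (d - (a' + b')) \<le> e"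
    by (auto simp: e_def)
  have "card (crossing a b a' b') \<le> 2 ^ 40 * (Y + 1) ^ (K + 1) * CARD('a) ^ (M + 4) * (if ?small then 1 else CARD('a) ^ Y)"
    unfolding M_def by (rule card_crossing_le) (use K deg in \<open>auto simp: Y_def\<close>)
  then have "real (card (crossing a b a' b')) \<le>
      real (2 ^ 40 * (Y + 1) ^ (K + 1) * CARD('a) ^ (M + 4) * (if ?small then 1 else CARD('a) ^ Y))"
    by (simp only: of_nat_le_iff)
  also have "\<dots> = 2 ^ 40 * real (Y + 1) ^ (K + 1) * q ^ (M + 4) * (if ?small then 1 else q ^ Y)"
    unfolding q_eq by (simp only: of_nat_mult of_nat_power of_nat_numeral if_distrib[of real] of_nat_1)
  also have "\<dots> \<le> P * q ^ (M + 4) * (if ?small then 1 else q ^ Y)"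
  proof -
    have "Y + 1 \<le> 3 * d" using d_pos by (simp add: Y_def)
    then have "real (Y + 1) \<le> 3 * real d" by linarith
    then have "real (Y + 1) ^ (K + 1) \<le> (3 * real d) ^ (K + 1)" by (intro power_mono) auto
    then show ?thesis unfolding P_def using q_pos by (intro mult_right_mono mult_left_mono) auto
  qed
  finally have "real (card (crossing a b a' b')) * u ^ (a + b + (a' + b')) \<le>
      P * q ^ (M + 4) * (if ?small then 1 else q ^ Y) * u ^ (2 * M + e)"
    unfolding exps(1) using u_pos by (intro mult_right_mono) auto
  also have "\<dots> = P * q ^ 4 * (q ^ M * u ^ (2 * M)) * (u ^ e * (if ?small then 1 else q ^ Y))"
    by (simp only: power_add mult_ac)
  also have "\<dots> = P * q ^ 4 * (u ^ e * (if ?small then 1 else q ^ Y))"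
    by (simp add: q_u_power)
  also have "\<dots> \<le> P * q ^ 4 * u ^ min (d - (a + b)) (d - (a' + b'))"
  proof (rule mult_left_mono)
    show "u ^ e * (if ?small then 1 else q ^ Y) \<le> u ^ min (d - (a + b)) (d - (a' + b'))"
    proof (cases ?small)
      case True
      then show ?thesis using min(1) by (simp add: u_power_antimono)
    next
      case False
      then have "M + 3 * 2 \<le> 3 * Y" unfolding M_def by linarith
      then have "M + 6 \<le> 3 * (d div 10) + 3" by (simp add: Y_def)
      moreover have "5 * (d div 10) + d div 2 \<le> d" by linarith
      ultimately have "2 * (d div 10) + 2 + d div 2 \<le> e" using exps(2) by linarith
      then have ge: "2 * Y + d div 2 \<le> e" by (simp add: Y_def)
      define m where "m = e - 2 * Y"
      have "u ^ e * q ^ Y = (q ^ Y * u ^ (2 * Y)) * u ^ m"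
        using ge by (simp add: m_def mult_ac flip: power_add)
      also have "\<dots> = u ^ m" by (simp add: q_u_power)
      also have "\<dots> \<le> u ^ min (d - (a + b)) (d - (a' + b'))"
      proof (rule u_power_antimono)
        \<comment> \<open>The smaller gap is at most half the sum \<open>e\<close>, and
          \<open>e \<le> d\<close>; so the remaining \<open>d div 2\<close> in the exponent is
          enough.\<close>
        have "2 * min (d - (a + b)) (d - (a' + b')) \<le> d" using min(2) exps(2) by linarith
        then show "min (d - (a + b)) (d - (a' + b')) \<le> m" using ge unfolding m_def by linarith
      qed
      finally show ?thesis using False by simp
    qed
    show "0 \<le> P * q ^ 4" using P q_pos by simp
  qed
  finally show ?thesis by (simp only: P_def)
qed

lemma card_crossing_weight_le:
  assumes K: "\<And>n. (\<Sum>N\<in>(monic_polys n :: 'a poly set). tau N ^ 41) \<le> CARD('a) ^ n * (n + 1) ^ K"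
  shows "real (card (crossing a b a' b')) * u ^ (a + b + (a' + b')) \<le>
    2 ^ 40 * (3 * real d) ^ (K + 1) * q ^ 4 * u ^ min (d - (a + b)) (d - (a' + b'))"
proof (cases "crossing a b a' b' = {}")
  case True
  then have "card (crossing a b a' b') = 0" by (simp only: card.empty)
  then show ?thesis using q_pos u_pos by simp
next
  case False
  then have deg: "a + b < d" "a' + b' < d" using crossing_empty by blast+
  show ?thesis
  proof (cases "d \<le> a + b'")
    case True
    then show ?thesis by (rule card_crossing_weight_le_aux[OF K deg])
  next
    case False
    then have "d \<le> a' + b" using crossing_degree_cases \<open>crossing a b a' b' \<noteq> {}\<close> by blast
    then show ?thesis
      using card_crossing_weight_le_aux[OF K deg(2,1)]
      by (simp add: card_crossing_swap[of a' b' a b] min.commute add.commute add.left_commute)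
  qed
qed

definition cross_term :: "nat \<times> nat \<Rightarrow> nat \<times> nat \<Rightarrow> real" where
  "cross_term x y = real (card (crossing (fst x) (snd x) (fst y) (snd y))) *
     real (d - (fst x + snd x)) * real (d - (fst y + snd y)) * u ^ (fst x + snd x + (fst y + snd y))"

lemma cross_term_nonneg: "cross_term x y \<ge> 0"
  using u_pos by (simp add: cross_term_def)

lemma cross_term_swap: "cross_term x y = cross_term y x"
  unfolding cross_term_def using card_crossing_swap[of "fst x" "snd x" "fst y" "snd y"]
  by (simp add: mult_ac add_ac)

text \<open>A count of \<open>q ^ (s + 1)\<close> meets the weight \<open>u ^ (2 * s + j)\<close>:
  only the difference \<open>j\<close> of the gaps is left as decay.\<close>

lemma cross_term_trivial:
  assumes "fst x + snd x \<le> fst y + snd y"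
  shows "cross_term x y \<le> q * (real (d - (fst x + snd x)) * real (d - (fst y + snd y)) *
    u ^ ((d - (fst x + snd x)) - (d - (fst y + snd y))))"
proof (cases "fst x + snd x < d \<and> fst y + snd y < d")
  case False
  then have "cross_term x y = 0" unfolding cross_term_def by auto
  then show ?thesis using q_pos u_pos by simp
next
  case True
  define s where "s = fst x + snd x"
  define j where "j = fst y + snd y - s"
  have y: "fst y + snd y = s + j" using assms by (simp add: s_def j_def)
  have j: "(d - s) - (d - (s + j)) = j" using True y by (simp add: s_def)
  have "real (card (crossing (fst x) (snd x) (fst y) (snd y))) \<le> real (CARD('a) ^ (s + 1))"
    unfolding s_def of_nat_le_iff by (rule card_crossing_trivial)
  also have "\<dots> = q ^ (s + 1)" by (simp add: q_eq)
  finally have "real (card (crossing (fst x) (snd x) (fst y) (snd y))) * u ^ (s + (s + j)) \<le> q ^ (s + 1) * u ^ (s + (s + j))"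
    using u_pos by (intro mult_right_mono) auto
  also have "\<dots> = q * (q ^ s * u ^ (2 * s)) * u ^ j" unfolding mult_2 power_add by (simp only: power_one_right mult_ac)
  also have "\<dots> = q * u ^ j" by (simp add: q_u_power)
  finally have "(real (d - s) * real (d - (s + j))) * (real (card (crossing (fst x) (snd x) (fst y) (snd y))) * u ^ (s + (s + j)))
      \<le> (real (d - s) * real (d - (s + j))) * (q * u ^ j)"
    by (intro mult_left_mono) auto
  then show ?thesis unfolding cross_term_def y s_def[symmetric] j by (simp only: mult_ac)
qed

text \<open>\<open>K + 1\<close> powers of \<open>d\<close> come from the count, two from the gaps,
  and one more is spent to leave \<open>1 / d\<close>, as about \<open>d^4\<close> such terms will
  be added. Since \<open>d < e'^3\<close>, these \<open>K + 4\<close> powers are absorbed by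
  \<open>u ^ e'\<close>.\<close>

lemma cross_term_nontrivial:
  assumes K: "\<And>n. (\<Sum>N\<in>(monic_polys n :: 'a poly set). tau N ^ 41) \<le> CARD('a) ^ n * (n + 1) ^ K"
    and C: "\<And>n::nat. real n ^ (3 * (K + 4)) * u ^ n \<le> C"
    and le: "fst x + snd x \<le> fst y + snd y" and big: "d < (d - (fst y + snd y)) ^ 3"
  shows "cross_term x y \<le> 2 ^ 40 * 3 ^ (K + 1) * q ^ 4 * C / real d"
proof -
  define e e' where "e = d - (fst x + snd x)" and "e' = d - (fst y + snd y)"
  define A where "A = 2 ^ 40 * 3 ^ (K + 1) * q ^ 4"
  have A: "A \<ge> 0" using q_pos by (simp add: A_def)
  have e: "min e e' = e'" "e \<le> d" "e' \<le> d" using le by (auto simp: e_def e'_def)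
  have "real d \<le> real e' ^ 3" using big unfolding e'_def by (metis less_imp_le of_nat_le_iff of_nat_power)
  then have "real d ^ (K + 4) \<le> (real e' ^ 3) ^ (K + 4)" by (intro power_mono) auto
  then have d_le: "real d ^ (K + 4) \<le> real e' ^ (3 * (K + 4))" by (simp only: power_mult)
  have "cross_term x y = (real e * real e') * (real (card (crossing (fst x) (snd x) (fst y) (snd y))) * u ^ (fst x + snd x + (fst y + snd y)))"
    unfolding cross_term_def e_def e'_def by (simp only: mult_ac)
  also have "\<dots> \<le> (real d * real d) * (2 ^ 40 * (3 * real d) ^ (K + 1) * q ^ 4 * u ^ e')"
  proof (rule mult_mono)
    show "real (card (crossing (fst x) (snd x) (fst y) (snd y))) * u ^ (fst x + snd x + (fst y + snd y)) \<le>
        2 ^ 40 * (3 * real d) ^ (K + 1) * q ^ 4 * u ^ e'"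
      using card_crossing_weight_le[OF K, of "fst x" "snd x" "fst y" "snd y"]
      unfolding e_def[symmetric] e'_def[symmetric] e(1) .
    show "real e * real e' \<le> real d * real d" using e by (intro mult_mono) auto
  qed (use u_pos in auto)
  also have "\<dots> = A * (real d ^ (K + 3) * u ^ e')"
    by (simp add: A_def power_add power_mult_distrib power3_eq_cube mult_ac)
  finally have "cross_term x y * real d \<le> A * (real d ^ (K + 3) * u ^ e') * real d"
    by (rule mult_right_mono) simp
  also have "\<dots> = A * (real d ^ (K + 4) * u ^ e')"
  proof -
    have "real d ^ (K + 4) = real d ^ (K + 3) * real d" by (simp add: eval_nat_numeral)
    then show ?thesis by (simp only: mult_ac)
  qed
  also have "\<dots> \<le> A * (real e' ^ (3 * (K + 4)) * u ^ e')"
    using d_le A u_pos by (intro mult_left_mono mult_right_mono) auto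
  also have "\<dots> \<le> A * C" using C A by (intro mult_left_mono) auto
  finally show ?thesis using d_pos unfolding A_def[symmetric] by (simp add: pos_le_divide_eq)
qed

text \<open>By symmetry, at a cost of 2, let the second gap be the smaller. If its cube is at most
  \<open>d\<close>, the trivial bound contributes \<open>O(d)\<close> for fixed second degrees; all
  other terms are \<open>O(1 / d)\<close>.\<close>

theorem sum_cross_term_le:
  assumes K: "\<And>n. (\<Sum>N\<in>(monic_polys n :: 'a poly set). tau N ^ 41) \<le> CARD('a) ^ n * (n + 1) ^ K"
    and C: "\<And>n::nat. real n ^ (3 * (K + 4)) * u ^ n \<le> C"
  shows "(\<Sum>x\<in>{..<d} \<times> {..<d}. \<Sum>y\<in>{..<d} \<times> {..<d}. cross_term x y) \<le>
    2 * (2 * q * (1 / (1 - u))\<^sup>2 + 2 ^ 40 * 3 ^ (K + 1) * q ^ 4 * C) * real d ^ 3"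
proof -
  let ?I = "{..<d} \<times> {..<d}"
  let ?G = "(1 / (1 - u))\<^sup>2"
  define B where "B = 2 ^ 40 * 3 ^ (K + 1) * q ^ 4 * C"
  define s where "s x = fst x + snd x" for x :: "nat \<times> nat"
  \<comment> \<open>The trivial bound as a function of the gaps alone, cut off outside the range
    where it is used.\<close>
  define g where "g e e' = (if 1 \<le> e' \<and> e' \<le> e \<and> e' ^ 3 \<le> d then q * (real e * real e' * u ^ (e - e')) else 0)" for e e'
  define h where "h x y = (if s x \<le> s y then cross_term x y else 0)" for x y
  have C0: "C \<ge> 0" using C[of 0] by (simp add: power_0_left)
  have B0: "B \<ge> 0" using C0 q_pos by (simp add: B_def)
  have g0: "g e e' \<ge> 0" for e e' using q_pos u_pos by (simp add: g_def)
  have g_zero: "g 0 e' = 0" for e' by (simp add: g_def)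
  have h_le: "h x y \<le> g (d - s x) (d - s y) + B / real d" for x y
  proof (cases "s x \<le> s y")
    case True
    show ?thesis
    proof (cases "s y < d")
      case False
      then have "cross_term x y = 0" by (simp add: cross_term_def s_def)
      then show ?thesis using g0[of "d - s x" "d - s y"] B0 by (simp add: h_def)
    next
      case sy: True
      show ?thesis
      proof (cases "(d - s y) ^ 3 \<le> d")
        case le: True
        have "cross_term x y \<le> g (d - s x) (d - s y)"
          using cross_term_trivial[of x y] True le sy unfolding g_def s_def by auto
        then show ?thesis using True B0 by (simp add: h_def add_increasing2)
      next
        case False
        then have "cross_term x y \<le> B / real d"
          unfolding B_def using True by (intro cross_term_nontrivial K C) (auto simp: s_def)
        then show ?thesis using True g0[of "d - s x" "d - s y"] by (simp add: h_def)
      qed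
    qed
  next
    case False
    then show ?thesis using g0[of "d - s x" "d - s y"] B0 by (simp add: h_def)
  qed
  have g_sum: "(\<Sum>e\<in>{1..d}. \<Sum>e'\<in>{1..d}. g e e') \<le> 2 * q * ?G * real d"
  proof -
    have "(\<Sum>e\<in>{1..d}. \<Sum>e'\<in>{1..d}. g e e') = (\<Sum>e'\<in>{1..d}. \<Sum>e\<in>{1..d}. g e e')" by (rule sum.swap)
    also have "\<dots> \<le> (\<Sum>e'\<in>{1..d}. if e' ^ 3 \<le> d then 2 * q * ?G * real (e'\<^sup>2) else 0)"
    proof (rule sum_mono)
      fix e' assume e': "e' \<in> {1..d}"
      show "(\<Sum>e\<in>{1..d}. g e e') \<le> (if e' ^ 3 \<le> d then 2 * q * ?G * real (e'\<^sup>2) else 0)"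
      proof (cases "e' ^ 3 \<le> d")
        case True
        have "(\<Sum>e\<in>{1..d}. g e e') = (\<Sum>e\<in>{e'..d}. q * real e' * (real e * u ^ (e - e')))"
          by (rule sum.mono_neutral_cong_right) (use e' True in \<open>auto simp: g_def\<close>)
        also have "\<dots> = q * real e' * (\<Sum>e\<in>{e'..d}. real e * u ^ (e - e'))" by (rule sum_distrib_left[symmetric])
        also have "\<dots> \<le> q * real e' * (real (Suc e') * ?G)"
          using sum_arith_geometric_shift_le[of u e' d] u_pos u_lt_1 q_pos by (intro mult_left_mono) auto
        also have "\<dots> \<le> q * real e' * ((2 * real e') * ?G)"
          using e' q_pos by (intro mult_left_mono mult_right_mono) auto
        also have "\<dots> = 2 * q * ?G * real (e'\<^sup>2)" by (simp add: power2_eq_square)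
        finally show ?thesis using True by simp
      qed (simp add: g_def)
    qed
    also have "\<dots> = (\<Sum>e' | e' \<in> {1..d} \<and> e' ^ 3 \<le> d. 2 * q * ?G * real (e'\<^sup>2))"
      by (rule sum.inter_filter[symmetric]) simp
    also have "\<dots> = 2 * q * ?G * real (\<Sum>e' | e' \<in> {1..d} \<and> e' ^ 3 \<le> d. e'\<^sup>2)"
      by (simp only: of_nat_sum sum_distrib_left)
    also have "{e'. e' \<in> {1..d} \<and> e' ^ 3 \<le> d} = {e'. 1 \<le> e' \<and> e' ^ 3 \<le> d}"
    proof -
      have "e \<le> e ^ 3" for e :: nat by (cases e) (simp_all add: power3_eq_cube)
      then show ?thesis using order_trans by auto
    qed
    also have "2 * q * ?G * real (\<Sum>e' | 1 \<le> e' \<and> e' ^ 3 \<le> d. e'\<^sup>2) \<le> 2 * q * ?G * real d"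
      using sum_squares_cube_le[of d] q_pos by (intro mult_left_mono) (auto simp only: of_nat_le_iff, simp)
    finally show ?thesis .
  qed
  have "(\<Sum>x\<in>?I. \<Sum>y\<in>?I. g (d - s x) (d - s y)) \<le> (real d)\<^sup>2 * (2 * q * ?G * real d)"
  proof -
    \<comment> \<open>The degrees of the second entries move outside, so that each inner sum runs
      over distinct gaps.\<close>
    have "(\<Sum>x\<in>?I. \<Sum>y\<in>?I. g (d - s x) (d - s y)) =
        (\<Sum>b<d. \<Sum>a<d. \<Sum>b'<d. \<Sum>a'<d. g (d - (a + b)) (d - (a' + b')))"
    proof -
      have "(\<Sum>x\<in>?I. F (d - s x)) = (\<Sum>b<d. \<Sum>a<d. F (d - (a + b)))" for F :: "nat \<Rightarrow> real"
      proof -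
        have "(\<Sum>x\<in>?I. F (d - s x)) = (\<Sum>a<d. \<Sum>b<d. F (d - (a + b)))"
          by (subst sum.cartesian_product) (simp add: s_def case_prod_beta)
        also have "\<dots> = (\<Sum>b<d. \<Sum>a<d. F (d - (a + b)))" by (rule sum.swap)
        finally show ?thesis .
      qed
      then show ?thesis by simp
    qed
    also have "\<dots> \<le> (\<Sum>b<d. \<Sum>b'<d. 2 * q * ?G * real d)"
    proof (rule sum_mono)
      fix b
      have "(\<Sum>a<d. \<Sum>b'<d. \<Sum>a'<d. g (d - (a + b)) (d - (a' + b'))) =
          (\<Sum>b'<d. \<Sum>a<d. \<Sum>a'<d. g (d - (a + b)) (d - (a' + b')))" by (rule sum.swap)
      also have "\<dots> \<le> (\<Sum>b'<d. 2 * q * ?G * real d)"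
      proof (rule sum_mono)
        fix b'
        have "(\<Sum>a<d. \<Sum>a'<d. g (d - (a + b)) (d - (a' + b'))) \<le> (\<Sum>a<d. \<Sum>e'\<in>{1..d}. g (d - (a + b)) e')"
          by (rule sum_mono, rule sum_degree_gap_le) (use g0 in \<open>auto simp: g_def\<close>)
        also have "\<dots> \<le> (\<Sum>e\<in>{1..d}. \<Sum>e'\<in>{1..d}. g e e')"
          by (rule sum_degree_gap_le[where \<phi> = "\<lambda>e. \<Sum>e'\<in>{1..d}. g e e'"])
            (use g0 g_zero in \<open>simp_all add: sum_nonneg\<close>)
        also have "\<dots> \<le> 2 * q * ?G * real d" by (rule g_sum)
        finally show "(\<Sum>a<d. \<Sum>a'<d. g (d - (a + b)) (d - (a' + b'))) \<le> 2 * q * ?G * real d" .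
      qed
      finally show "(\<Sum>a<d. \<Sum>b'<d. \<Sum>a'<d. g (d - (a + b)) (d - (a' + b'))) \<le> (\<Sum>b'<d. 2 * q * ?G * real d)" .
    qed
    also have "\<dots> = (real d)\<^sup>2 * (2 * q * ?G * real d)" by (simp add: power2_eq_square)
    finally show ?thesis .
  qed
  then have g_total: "(\<Sum>x\<in>?I. \<Sum>y\<in>?I. g (d - s x) (d - s y)) \<le> 2 * q * ?G * real d ^ 3"
    by (simp add: power2_eq_square power3_eq_cube mult_ac)
  have "(\<Sum>x\<in>?I. \<Sum>y\<in>?I. h x y) \<le> (\<Sum>x\<in>?I. \<Sum>y\<in>?I. g (d - s x) (d - s y) + B / real d)"
    by (intro sum_mono h_le)
  also have "\<dots> = (\<Sum>x\<in>?I. \<Sum>y\<in>?I. g (d - s x) (d - s y)) + B * real d ^ 3"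
    using d_pos by (simp add: sum.distrib power3_eq_cube)
  also have "\<dots> \<le> (2 * q * ?G + B) * real d ^ 3" using g_total by (simp add: algebra_simps)
  finally have h_total: "(\<Sum>x\<in>?I. \<Sum>y\<in>?I. h x y) \<le> (2 * q * ?G + B) * real d ^ 3" .
  have "(\<Sum>x\<in>?I. \<Sum>y\<in>?I. cross_term x y) \<le> (\<Sum>x\<in>?I. \<Sum>y\<in>?I. h x y + h y x)"
  proof (intro sum_mono)
    fix x y
    show "cross_term x y \<le> h x y + h y x"
      using cross_term_nonneg[of x y] cross_term_swap[of x y] by (auto simp: h_def)
  qed
  also have "\<dots> = (\<Sum>x\<in>?I. \<Sum>y\<in>?I. h x y) + (\<Sum>x\<in>?I. \<Sum>y\<in>?I. h y x)"
    by (simp only: sum.distrib)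
  also have "(\<Sum>x\<in>?I. \<Sum>y\<in>?I. h y x) = (\<Sum>x\<in>?I. \<Sum>y\<in>?I. h x y)" by (rule sum.swap)
  finally show ?thesis using h_total unfolding B_def by (simp add: algebra_simps)
qed

end

section \<open>The diagonal and the main term\<close>

text \<open>Truncated subtraction confines the sum to \<open>a + b < d\<close>; it is then a sum of
  sums of consecutive squares. The leading coefficient \<open>1/12\<close> is the one of the main
  term.\<close>

lemma sum_squared_gaps:
  "(\<Sum>a<d. \<Sum>b<d. (real (d - (a + b)))\<^sup>2) = real d * (real d + 1)\<^sup>2 * (real d + 2) / 12"
proof -
  have inner: "(\<Sum>b<d. (real (n - b))\<^sup>2) = real n * (real n + 1) * (2 * real n + 1) / 6" if "n \<le> d" for n
  proof -
    have "(\<Sum>b<d. (real (n - b))\<^sup>2) = (\<Sum>b<n. (real (n - b))\<^sup>2)"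
      by (rule sum.mono_neutral_right) (use that in auto)
    also have "\<dots> = (\<Sum>b<n. (real (Suc b))\<^sup>2)"
      by (rule sum.reindex_bij_witness[of _ "\<lambda>b. n - Suc b" "\<lambda>b. n - Suc b"]) (auto simp: Suc_diff_Suc)
    also have "\<dots> = real n * (real n + 1) * (2 * real n + 1) / 6"
      by (induction n) (simp_all add: power2_eq_square field_simps)
    finally show ?thesis .
  qed
  have "(\<Sum>a<d. \<Sum>b<d. (real (d - (a + b)))\<^sup>2) = (\<Sum>a<d. \<Sum>b<d. (real ((d - a) - b))\<^sup>2)" by simp
  also have "\<dots> = (\<Sum>a<d. real (d - a) * (real (d - a) + 1) * (2 * real (d - a) + 1) / 6)"
    by (intro sum.cong refl inner) simp
  also have "\<dots> = (\<Sum>a<d. real (Suc a) * (real (Suc a) + 1) * (2 * real (Suc a) + 1) / 6)"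
    by (rule sum.reindex_bij_witness[of _ "\<lambda>b. d - Suc b" "\<lambda>b. d - Suc b"]) (auto simp: Suc_diff_Suc)
  also have "\<dots> = real d * (real d + 1)\<^sup>2 * (real d + 2) / 12"
    by (induction d) (simp_all add: power2_eq_square field_simps)
  finally show ?thesis .
qed

context irreducible_modulus_weight
begin

definition box_bound :: real where "box_bound = (1 / (1 - u))\<^sup>2"

lemma box_bound_nonneg [simp]: "box_bound \<ge> 0" by (simp add: box_bound_def)

text \<open>After subtracting the degrees of \<open>p\<close> from \<open>n\<close> and
  \<open>m\<close>, the sum is dominated by a product of two geometric series, uniformly in
  \<open>p\<close> and \<open>d\<close>.\<close>

lemma box_correction_bounds: "0 \<le> box_correction p" "box_correction p \<le> box_bound"
proof -
  let ?J = "{(n, m). degree (fst p) \<le> n \<and> degree (snd p) \<le> m \<and> n + m + 2 \<le> d}"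
  let ?f = "\<lambda>(n, m). (n - degree (fst p), m - degree (snd p))"
  show "0 \<le> box_correction p" unfolding box_correction_def using u_pos by (intro sum_nonneg) auto
  have "box_correction p \<le> (\<Sum>x\<in>?J. (\<lambda>(i, k). u ^ i * u ^ k) (?f x))"
    unfolding box_correction_def
  proof (rule sum_mono)
    fix x assume x: "x \<in> ?J"
    obtain n m where nm: "x = (n, m)" by (cases x)
    have "u ^ (n + m + 2 - height p) \<le> u ^ ((n - degree (fst p)) + (m - degree (snd p)))"
      by (rule u_power_antimono) (use x nm in \<open>auto simp: height_def\<close>)
    then show "(case x of (n, m) \<Rightarrow> u ^ (n + m + 2 - height p)) \<le> (\<lambda>(i, k). u ^ i * u ^ k) (?f x)"
      by (simp add: nm power_add)
  qed
  also have "\<dots> = (\<Sum>(i, k)\<in>?f ` ?J. u ^ i * u ^ k)"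
    by (rule sum.reindex[symmetric, unfolded o_def]) (auto simp: inj_on_def)
  also have "\<dots> \<le> (\<Sum>(i, k)\<in>{..<d} \<times> {..<d}. u ^ i * u ^ k)"
    by (rule sum_mono2) (use u_pos in auto)
  also have "\<dots> = (\<Sum>i<d. u ^ i) * (\<Sum>i<d. u ^ i)"
    by (simp add: sum_product sum.cartesian_product)
  also have "\<dots> \<le> (1 / (1 - u)) * (1 / (1 - u))"
    using geometric_partial_sum_le[of u d] u_pos u_lt_1 by (intro mult_mono) (auto intro: sum_nonneg)
  finally show "box_correction p \<le> box_bound" by (simp add: box_bound_def power2_eq_square)
qed

lemma gap_pos: "p \<in> primitive_pairs \<Longrightarrow> gap p \<ge> 1"
  by (auto simp: primitive_pairs_def gap_def height_def)

text \<open>As the gap is at least 1, it absorbs the bounded correction. This forgets whether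
  \<open>A\<close> is monic, a loss of a constant factor that is acceptable off the
  diagonal.\<close>

lemma abs_coefficient_le:
  assumes "p \<in> primitive_pairs"
  shows "\<bar>coefficient p\<bar> \<le> (1 + box_bound) * real (gap p)"
proof -
  have "\<bar>coefficient p\<bar> \<le> real (gap p) + box_bound"
    using box_correction_bounds[of p] box_bound_nonneg unfolding coefficient_def by (auto simp: abs_le_iff)
  also have "box_bound \<le> box_bound * real (gap p)"
    using gap_pos[OF assms] box_bound_nonneg mult_left_mono[of 1 "real (gap p)" box_bound] by simp
  finally show ?thesis by (simp add: algebra_simps)
qed

text \<open>\<open>p\<close> lies over exactly one residue, and \<open>p'\<close> lies over the same
  one iff the determinant is a multiple of \<open>Q\<close>.\<close>

lemma sum_residues_primitive_over:
  assumes "p \<in> primitive_pairs" "p' \<in> primitive_pairs"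
  shows "(\<Sum>r\<in>res. if p \<in> primitive_over r \<and> p' \<in> primitive_over r then x else 0) =
    (if Q dvd fst p * snd p' - fst p' * snd p then x else (0::real))"
proof -
  obtain s where s: "s \<in> res" "p \<in> primitive_over s" and uniq: "\<And>r. r \<in> res \<Longrightarrow> p \<in> primitive_over r \<Longrightarrow> r = s"
    using primitive_over_ex1[OF assms(1)] by blast
  have "(\<Sum>r\<in>res. if p \<in> primitive_over r \<and> p' \<in> primitive_over r then x else 0) =
      (\<Sum>r\<in>res. if r = s then (if p' \<in> primitive_over s then x else 0) else 0)"
  proof (rule sum.cong[OF refl])
    fix r assume r: "r \<in> res"
    show "(if p \<in> primitive_over r \<and> p' \<in> primitive_over r then x else 0) =
        (if r = s then (if p' \<in> primitive_over s then x else 0) else 0)"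
    proof (cases "r = s")
      case True
      then show ?thesis using s(2) by simp
    next
      case False
      then have "p \<notin> primitive_over r" using uniq[OF r] by blast
      then show ?thesis using False by simp
    qed
  qed
  also have "\<dots> = (if p' \<in> primitive_over s then x else 0)" using s by (simp add: sum.delta)
  finally show ?thesis unfolding primitive_over_iff_cross[OF s(2) assms(2)] .
qed

lemma sum_primitive_over: "(\<Sum>p\<in>primitive_over r. f p) = (\<Sum>p\<in>primitive_pairs. if p \<in> primitive_over r then f p else (0::real))"
proof -
  have "primitive_over r = {p \<in> primitive_pairs. p \<in> primitive_over r}" by (auto simp: primitive_over_def)
  then have "(\<Sum>p\<in>primitive_over r. f p) = (\<Sum>p\<in>{p \<in> primitive_pairs. p \<in> primitive_over r}. f p)" by simp
  also have "\<dots> = (\<Sum>p\<in>primitive_pairs. if p \<in> primitive_over r then f p else 0)"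
    by (rule sum.inter_filter) simp
  finally show ?thesis .
qed

lemma sum_short_sum: "(\<Sum>r\<in>res. short_sum r) = (\<Sum>p\<in>primitive_pairs. coefficient p * u ^ height p)"
proof -
  have "(\<Sum>r\<in>res. short_sum r) = (\<Sum>r\<in>res. \<Sum>p\<in>primitive_pairs. if p \<in> primitive_over r \<and> p \<in> primitive_over r then coefficient p * u ^ height p else 0)"
    unfolding short_sum_def sum_primitive_over by simp
  also have "\<dots> = (\<Sum>p\<in>primitive_pairs. \<Sum>r\<in>res. if p \<in> primitive_over r \<and> p \<in> primitive_over r then coefficient p * u ^ height p else 0)"
    by (rule sum.swap)
  also have "\<dots> = (\<Sum>p\<in>primitive_pairs. coefficient p * u ^ height p)"
    by (intro sum.cong refl) (subst sum_residues_primitive_over, auto)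
  finally show ?thesis .
qed

definition pair_term :: "'a poly \<times> 'a poly \<Rightarrow> 'a poly \<times> 'a poly \<Rightarrow> real" where
  "pair_term p p' = (coefficient p * u ^ height p) * (coefficient p' * u ^ height p')"

definition related :: "'a poly \<times> 'a poly \<Rightarrow> 'a poly \<times> 'a poly \<Rightarrow> bool" where
  "related p p' \<longleftrightarrow> p \<noteq> p' \<and> Q dvd fst p * snd p' - fst p' * snd p"

lemma sum_short_sum_square:
  "(\<Sum>r\<in>res. (short_sum r)\<^sup>2) = (\<Sum>p\<in>primitive_pairs. pair_term p p) +
    (\<Sum>p\<in>primitive_pairs. \<Sum>p'\<in>primitive_pairs. if related p p' then pair_term p p' else 0)"
proof -
  have "(\<Sum>r\<in>res. (short_sum r)\<^sup>2) = (\<Sum>r\<in>res. \<Sum>p\<in>primitive_pairs. \<Sum>p'\<in>primitive_pairs.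
      if p \<in> primitive_over r \<and> p' \<in> primitive_over r then pair_term p p' else 0)"
    unfolding short_sum_def sum_primitive_over power2_eq_square sum_product pair_term_def
    by (intro sum.cong refl) auto
  also have "\<dots> = (\<Sum>p\<in>primitive_pairs. \<Sum>r\<in>res. \<Sum>p'\<in>primitive_pairs.
      if p \<in> primitive_over r \<and> p' \<in> primitive_over r then pair_term p p' else 0)"
    by (rule sum.swap)
  also have "\<dots> = (\<Sum>p\<in>primitive_pairs. \<Sum>p'\<in>primitive_pairs. \<Sum>r\<in>res.
      if p \<in> primitive_over r \<and> p' \<in> primitive_over r then pair_term p p' else 0)"
    by (intro sum.cong refl sum.swap)
  also have "\<dots> = (\<Sum>p\<in>primitive_pairs. \<Sum>p'\<in>primitive_pairs.
      (if p = p' then pair_term p p' else 0) + (if related p p' then pair_term p p' else 0))"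
    by (intro sum.cong refl) (subst sum_residues_primitive_over, auto simp: related_def)
  also have "\<dots> = (\<Sum>p\<in>primitive_pairs. pair_term p p) +
    (\<Sum>p\<in>primitive_pairs. \<Sum>p'\<in>primitive_pairs. if related p p' then pair_term p p' else 0)"
    by (simp add: sum.distrib sum.delta)
  finally show ?thesis .
qed

text \<open>Grouped by the four degrees, the related pairs are the sets \<open>crossing\<close>, on
  which gaps and heights are constant.\<close>

lemma sum_related_le:
  "\<bar>\<Sum>p\<in>primitive_pairs. \<Sum>p'\<in>primitive_pairs. if related p p' then pair_term p p' else 0\<bar> \<le>
    (1 + box_bound)\<^sup>2 * (\<Sum>x\<in>{..<d} \<times> {..<d}. \<Sum>y\<in>{..<d} \<times> {..<d}. cross_term x y)"
proof -
  let ?I = "{..<d} \<times> {..<d}"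
  define X where "X = {(p, p'). p \<in> primitive_pairs \<and> p' \<in> primitive_pairs \<and> related p p'}"
  define g where "g z = real (gap (fst z)) * real (gap (snd z)) * u ^ (height (fst z) + height (snd z))" for z
  define dg where "dg z = ((degree (fst (fst z)), degree (snd (fst z))), (degree (fst (snd z)), degree (snd (snd z))))"
    for z :: "('a poly \<times> 'a poly) \<times> ('a poly \<times> 'a poly)"
  have finX: "finite X" by (rule finite_subset[of _ "primitive_pairs \<times> primitive_pairs"]) (auto simp: X_def)
  have "\<bar>\<Sum>p\<in>primitive_pairs. \<Sum>p'\<in>primitive_pairs. if related p p' then pair_term p p' else 0\<bar> \<le>
      (\<Sum>p\<in>primitive_pairs. \<Sum>p'\<in>primitive_pairs. if related p p' then (1 + box_bound)\<^sup>2 * g (p, p') else 0)"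
  proof (rule order_trans[OF sum_abs], rule sum_mono, rule order_trans[OF sum_abs], rule sum_mono)
    fix p p' assume p: "p \<in> primitive_pairs" "p' \<in> primitive_pairs"
    have "\<bar>pair_term p p'\<bar> = (\<bar>coefficient p\<bar> * \<bar>coefficient p'\<bar>) * u ^ (height p + height p')"
      using u_pos by (simp add: pair_term_def abs_mult power_add)
    also have "\<dots> \<le> (((1 + box_bound) * real (gap p)) * ((1 + box_bound) * real (gap p'))) * u ^ (height p + height p')"
      using abs_coefficient_le[OF p(1)] abs_coefficient_le[OF p(2)] u_pos box_bound_nonneg
      by (intro mult_right_mono mult_mono) auto
    also have "\<dots> = (1 + box_bound)\<^sup>2 * g (p, p')" unfolding g_def power2_eq_square by (simp only: fst_conv snd_conv mult_ac)
    finally show "\<bar>if related p p' then pair_term p p' else 0\<bar> \<le> (if related p p' then (1 + box_bound)\<^sup>2 * g (p, p') else 0)"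
      by simp
  qed
  also have "\<dots> = (\<Sum>z\<in>primitive_pairs \<times> primitive_pairs. if related (fst z) (snd z) then (1 + box_bound)\<^sup>2 * g z else 0)"
    by (subst sum.cartesian_product) (simp add: case_prod_beta cong: if_cong)
  also have "\<dots> = (\<Sum>z\<in>{z \<in> primitive_pairs \<times> primitive_pairs. related (fst z) (snd z)}. (1 + box_bound)\<^sup>2 * g z)"
    by (rule sum.inter_filter[symmetric]) simp
  also have "{z \<in> primitive_pairs \<times> primitive_pairs. related (fst z) (snd z)} = X" by (auto simp: X_def)
  also have "(\<Sum>z\<in>X. (1 + box_bound)\<^sup>2 * g z) = (1 + box_bound)\<^sup>2 * (\<Sum>z\<in>X. g z)" by (rule sum_distrib_left[symmetric])
  also have "(\<Sum>z\<in>X. g z) = (\<Sum>w\<in>?I \<times> ?I. \<Sum>z\<in>{z \<in> X. dg z = w}. g z)"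
    by (rule sum.group[symmetric]) (use finX in \<open>auto simp: X_def dg_def primitive_pairs_def\<close>)
  also have "\<dots> = (\<Sum>w\<in>?I \<times> ?I. cross_term (fst w) (snd w))"
  proof (rule sum.cong[OF refl])
    fix w assume "w \<in> ?I \<times> ?I"
    have "{z \<in> X. dg z = w} = crossing (fst (fst w)) (snd (fst w)) (fst (snd w)) (snd (snd w))"
      by (auto simp: X_def dg_def crossing_def related_def)
    moreover have "g z = real (d - (fst (fst w) + snd (fst w))) * real (d - (fst (snd w) + snd (snd w))) *
        u ^ (fst (fst w) + snd (fst w) + (fst (snd w) + snd (snd w)))" if "z \<in> {z \<in> X. dg z = w}" for z
      using that by (auto simp: g_def dg_def gap_def height_def)
    ultimately show "(\<Sum>z\<in>{z \<in> X. dg z = w}. g z) = cross_term (fst w) (snd w)"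
      unfolding cross_term_def by simp
  qed
  also have "\<dots> = (\<Sum>x\<in>?I. \<Sum>y\<in>?I. cross_term x y)"
    by (subst sum.cartesian_product) (simp add: case_prod_beta)
  finally show ?thesis .
qed

definition pairs_of_degree :: "nat \<Rightarrow> nat \<Rightarrow> ('a poly \<times> 'a poly) set" where
  "pairs_of_degree a b = {p \<in> primitive_pairs. degree (fst p) = a \<and> degree (snd p) = b}"

lemma sum_primitive_pairs_degrees:
  "(\<Sum>p\<in>primitive_pairs. f p) = (\<Sum>a<d. \<Sum>b<d. \<Sum>p\<in>pairs_of_degree a b. f p :: real)"
proof -
  have "(\<Sum>p\<in>primitive_pairs. f p) = (\<Sum>x\<in>{..<d} \<times> {..<d}.
      \<Sum>p\<in>{p \<in> primitive_pairs. (degree (fst p), degree (snd p)) = x}. f p)"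
    by (rule sum.group[symmetric]) (simp_all, auto simp: primitive_pairs_def)
  also have "\<dots> = (\<Sum>x\<in>{..<d} \<times> {..<d}. \<Sum>p\<in>pairs_of_degree (fst x) (snd x). f p)"
    by (intro sum.cong refl) (auto simp: pairs_of_degree_def)
  also have "\<dots> = (\<Sum>a<d. \<Sum>b<d. \<Sum>p\<in>pairs_of_degree a b. f p)"
    by (subst sum.cartesian_product) (simp add: case_prod_beta)
  finally show ?thesis .
qed

lemma pairs_of_degree_empty: "\<not> a + b < d \<Longrightarrow> pairs_of_degree a b = {}"
  by (auto simp: pairs_of_degree_def primitive_pairs_def)

lemma card_pairs_of_degree_le: "real (card (pairs_of_degree a b)) \<le> q * q ^ (a + b)"
proof -
  have "real (card (pairs_of_degree a b)) \<le> real (CARD('a) ^ (a + b + 1))"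
    unfolding pairs_of_degree_def of_nat_le_iff by (rule card_primitive_degrees_le)
  then show ?thesis by (simp add: q_eq)
qed

lemma pairs_of_degree_monic:
  "a + b < d \<Longrightarrow> {p \<in> pairs_of_degree a b. lead_coeff (fst p) = 1} = coprime_monic a b"
  by (auto simp: pairs_of_degree_def coprime_monic_def primitive_pairs_def monic_polys_def)

text \<open>For fixed degrees the correction is a constant \<open>\<gamma>\<close>. Monic
  \<open>A\<close> contribute \<open>\<rho> * (e - \<gamma>)\<^sup>2\<close> and the others
  \<open>\<sigma> * \<gamma>\<^sup>2\<close>. For positive degrees \<open>\<rho>\<close> is exactly
  \<open>1 - 1/q\<close> and the error is \<open>O(e)\<close>; for \<open>a = 0\<close> or
  \<open>b = 0\<close> the crude bound \<open>O(e\<^sup>2)\<close> is affordable.\<close>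

lemma diagonal_degree_bound:
  assumes ab: "a + b < d"
  shows "\<bar>(\<Sum>p\<in>pairs_of_degree a b. pair_term p p) - (1 - 1 / q) * (real (d - (a + b)))\<^sup>2\<bar> \<le>
    ((1 + box_bound)\<^sup>2 + q * box_bound\<^sup>2 + 2 * box_bound + box_bound\<^sup>2 + 1) * (if a = 0 \<or> b = 0 then (real d)\<^sup>2 else real d)"
proof -
  define e where "e = real (d - (a + b))"
  define w where "w = u ^ (2 * (a + b))"
  define \<gamma> where "\<gamma> = (\<Sum>(n, m) | a \<le> n \<and> b \<le> m \<and> n + m + 2 \<le> d. u ^ (n + m + 2 - (a + b)))"
  let ?P = "pairs_of_degree a b"
  let ?M = "coprime_monic a b :: ('a poly \<times> 'a poly) set"
  have finP: "finite ?P" by (simp add: pairs_of_degree_def)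
  have e: "1 \<le> e" "e \<le> real d" using ab by (auto simp: e_def)
  have \<gamma>: "box_correction p = \<gamma>" if "p \<in> ?P" for p
    using that by (simp add: box_correction_def \<gamma>_def pairs_of_degree_def height_def)
  have w: "w \<ge> 0" "q ^ (a + b) * w = 1" using u_pos q_u_power[of "a + b"] by (auto simp: w_def)
  have MP: "?M \<subseteq> ?P" unfolding pairs_of_degree_monic[OF ab, symmetric] by blast
  define \<rho> where "\<rho> = real (card ?M) * w"
  define \<sigma> where "\<sigma> = real (card (?P - ?M)) * w"
  have term_monic: "pair_term p p = w * (e - \<gamma>)\<^sup>2" if "p \<in> ?M" for p
  proof -
    have "p \<in> ?P" "lead_coeff (fst p) = 1" using that pairs_of_degree_monic[OF ab] by auto
    then show ?thesis
      using \<gamma>[of p] by (auto simp: pair_term_def coefficient_def w_def e_def gap_def height_def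
        pairs_of_degree_def power2_eq_square mult_2 power_add mult_ac)
  qed
  have term_other: "pair_term p p = w * \<gamma>\<^sup>2" if "p \<in> ?P - ?M" for p
  proof -
    have "p \<in> ?P" "lead_coeff (fst p) \<noteq> 1" using that pairs_of_degree_monic[OF ab] by auto
    then show ?thesis
      using \<gamma>[of p] by (auto simp: pair_term_def coefficient_def w_def height_def
        pairs_of_degree_def power2_eq_square mult_2 power_add mult_ac)
  qed
  have "(\<Sum>p\<in>?P. pair_term p p) = (\<Sum>p\<in>?P - ?M. pair_term p p) + (\<Sum>p\<in>?M. pair_term p p)"
    by (rule sum.subset_diff[OF MP finP])
  then have S: "(\<Sum>p\<in>?P. pair_term p p) = \<rho> * (e - \<gamma>)\<^sup>2 + \<sigma> * \<gamma>\<^sup>2"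
    by (simp add: term_monic term_other \<rho>_def \<sigma>_def mult.assoc)
  have \<rho>: "0 \<le> \<rho>" "\<rho> \<le> 1"
  proof -
    have "real (card ?M) \<le> real (CARD('a) ^ (a + b))" using card_coprime_monic_le of_nat_le_iff by blast
    then have "\<rho> \<le> q ^ (a + b) * w" unfolding \<rho>_def using w by (intro mult_right_mono) (auto simp: q_eq)
    then show "\<rho> \<le> 1" using w by simp
  qed (use w in \<open>simp add: \<rho>_def\<close>)
  have \<sigma>: "0 \<le> \<sigma>" "\<sigma> \<le> q"
  proof -
    have "real (card (?P - ?M)) \<le> real (card ?P)" using finP by (simp add: card_mono)
    then have "real (card (?P - ?M)) \<le> q * q ^ (a + b)" using card_pairs_of_degree_le[of a b] by linarith
    then have "\<sigma> \<le> q * q ^ (a + b) * w" unfolding \<sigma>_def using w by (intro mult_right_mono)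
    then show "\<sigma> \<le> q" using w by (simp add: mult.assoc)
  qed (use w in \<open>simp add: \<sigma>_def\<close>)
  have "0 \<le> \<gamma> \<and> \<gamma> \<le> box_bound"
  proof -
    \<comment> \<open>The correction depends only on degrees, so a pair of monomials transfers its
      bounds to \<open>\<gamma>\<close>.\<close>
    have "box_correction (monom 1 a, monom 1 b) = \<gamma>"
      by (simp add: box_correction_def \<gamma>_def height_def degree_monom_eq)
    then show ?thesis using box_correction_bounds[of "(monom 1 a, monom 1 b)"] by simp
  qed
  then have \<gamma>b: "0 \<le> \<gamma>" "\<gamma> \<le> box_bound" by auto
  have \<gamma>2: "\<gamma>\<^sup>2 \<le> box_bound\<^sup>2" using \<gamma>b by (intro power_mono) auto
  have \<sigma>\<gamma>: "0 \<le> \<sigma> * \<gamma>\<^sup>2" "\<sigma> * \<gamma>\<^sup>2 \<le> q * box_bound\<^sup>2" using \<sigma> \<gamma>2 by (auto intro!: mult_mono)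
  define c where "c = (1 + box_bound)\<^sup>2 + q * box_bound\<^sup>2 + 2 * box_bound + box_bound\<^sup>2 + 1"
  have c0: "c \<ge> 0" unfolding c_def using q_pos by simp
  have ee: "e \<le> e\<^sup>2" "1 \<le> e\<^sup>2" using e(1) by (auto simp: power2_eq_square intro: order_trans[OF e(1)])
  have q1: "0 \<le> 1 - 1 / q" "1 - 1 / q \<le> 1" using q_ge_2 by auto
  have "\<bar>\<rho> * (e - \<gamma>)\<^sup>2 + \<sigma> * \<gamma>\<^sup>2 - (1 - 1 / q) * e\<^sup>2\<bar> \<le> c * (if a = 0 \<or> b = 0 then (real d)\<^sup>2 else real d)"
  proof (cases "a = 0 \<or> b = 0")
    case True
    have "(e - \<gamma>)\<^sup>2 \<le> ((1 + box_bound) * e)\<^sup>2"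
    proof (rule power2_le_iff_abs_le[THEN iffD2])
      have "box_bound \<le> box_bound * e" using mult_left_mono[OF e(1) box_bound_nonneg] by simp
      then show "\<bar>e - \<gamma>\<bar> \<le> (1 + box_bound) * e" using \<gamma>b e by (simp add: algebra_simps abs_le_iff)
      show "0 \<le> (1 + box_bound) * e" using e by simp
    qed
    then have "\<rho> * (e - \<gamma>)\<^sup>2 \<le> 1 * ((1 + box_bound) * e)\<^sup>2" using \<rho> by (intro mult_mono) auto
    then have 1: "0 \<le> \<rho> * (e - \<gamma>)\<^sup>2" "\<rho> * (e - \<gamma>)\<^sup>2 \<le> (1 + box_bound)\<^sup>2 * e\<^sup>2" using \<rho> by (auto simp: power_mult_distrib)
    have 2: "q * box_bound\<^sup>2 \<le> q * box_bound\<^sup>2 * e\<^sup>2" using ee q_pos mult_left_mono[of 1 "e\<^sup>2" "q * box_bound\<^sup>2"] by simp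
    have 3: "0 \<le> (1 - 1 / q) * e\<^sup>2" "(1 - 1 / q) * e\<^sup>2 \<le> 1 * e\<^sup>2"
      by (rule mult_nonneg_nonneg, rule q1, simp) (rule mult_right_mono, rule q1, simp)
    have 4: "0 \<le> (2 * box_bound + box_bound\<^sup>2) * e\<^sup>2" by simp
    have "\<bar>\<rho> * (e - \<gamma>)\<^sup>2 + \<sigma> * \<gamma>\<^sup>2 - (1 - 1 / q) * e\<^sup>2\<bar> \<le> (1 + box_bound)\<^sup>2 * e\<^sup>2 + q * box_bound\<^sup>2 * e\<^sup>2 + (2 * box_bound + box_bound\<^sup>2) * e\<^sup>2 + e\<^sup>2"
      using 1 2 3 4 \<sigma>\<gamma> unfolding abs_le_iff by linarith
    also have "\<dots> = c * e\<^sup>2" by (simp add: c_def algebra_simps)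
    also have "\<dots> \<le> c * (real d)\<^sup>2" using e c0 by (intro mult_left_mono power_mono) auto
    finally show ?thesis using True by simp
  next
    case False
    then obtain a' b' where ab': "a = Suc a'" "b = Suc b'" by (metis not0_implies_Suc)
    have "real (card ?M) + q ^ (a' + b' + 1) = q ^ (a + b)"
      using arg_cong[OF card_coprime_monic_Suc[where 'a = 'a, of a' b'], of real] by (simp add: ab' q_eq)
    moreover have "q * (q ^ (a' + b' + 1) * w) = 1" using w(2) by (simp add: ab' mult_ac)
    then have "q ^ (a' + b' + 1) * w = 1 / q" using q_pos by (simp add: field_simps)
    ultimately have \<rho>_eq: "\<rho> = 1 - 1 / q" using w(2) unfolding \<rho>_def by (metis add_diff_cancel_right' left_diff_distrib)
    have eq: "\<rho> * (e - \<gamma>)\<^sup>2 + \<sigma> * \<gamma>\<^sup>2 - (1 - 1 / q) * e\<^sup>2 = \<rho> * \<gamma>\<^sup>2 + \<sigma> * \<gamma>\<^sup>2 - \<rho> * (2 * e * \<gamma>)"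
      unfolding \<rho>_eq[symmetric] by (simp add: power2_eq_square algebra_simps)
    have 1: "0 \<le> \<rho> * \<gamma>\<^sup>2" using \<rho> by simp
    have 5: "\<rho> * \<gamma>\<^sup>2 \<le> 1 * box_bound\<^sup>2" using \<rho> \<gamma>2 by (intro mult_mono) auto
    have "\<rho> * (2 * e * \<gamma>) \<le> 1 * (2 * e * box_bound)" using \<rho> \<gamma>b e by (intro mult_mono) auto
    then have 2: "0 \<le> \<rho> * (2 * e * \<gamma>)" "\<rho> * (2 * e * \<gamma>) \<le> 2 * box_bound * e" using \<rho> \<gamma>b e by (auto simp: mult_ac)
    have 3: "box_bound\<^sup>2 \<le> box_bound\<^sup>2 * e" "q * box_bound\<^sup>2 \<le> q * box_bound\<^sup>2 * e"
      using e q_pos mult_left_mono[of 1 e "box_bound\<^sup>2"] mult_left_mono[of 1 e "q * box_bound\<^sup>2"] by auto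
    have 4: "0 \<le> ((1 + box_bound)\<^sup>2 + 1) * e" using e by simp
    have "\<bar>\<rho> * (e - \<gamma>)\<^sup>2 + \<sigma> * \<gamma>\<^sup>2 - (1 - 1 / q) * e\<^sup>2\<bar> \<le> ((1 + box_bound)\<^sup>2 + 1) * e + q * box_bound\<^sup>2 * e + 2 * box_bound * e + box_bound\<^sup>2 * e"
      unfolding eq using 1 2 3 4 5 \<sigma>\<gamma> unfolding abs_le_iff by linarith
    also have "\<dots> = c * e" by (simp add: c_def algebra_simps)
    also have "\<dots> \<le> c * real d" using e c0 by (intro mult_left_mono) auto
    finally show ?thesis using False by simp
  qed
  then show ?thesis unfolding S c_def e_def .
qed

text \<open>The factor 3 collects the \<open>d^2\<close> degree pairs with error
  \<open>c * d\<close>, and the edges \<open>a = 0\<close> and \<open>b = 0\<close>, each with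
  \<open>d\<close> pairs of error \<open>c * d^2\<close>.\<close>

lemma diagonal_bound:
  "\<bar>(\<Sum>p\<in>primitive_pairs. pair_term p p) - (1 - 1 / q) * (real d * (real d + 1)\<^sup>2 * (real d + 2) / 12)\<bar> \<le>
    3 * ((1 + box_bound)\<^sup>2 + q * box_bound\<^sup>2 + 2 * box_bound + box_bound\<^sup>2 + 1) * real d ^ 3"
proof -
  define c where "c = (1 + box_bound)\<^sup>2 + q * box_bound\<^sup>2 + 2 * box_bound + box_bound\<^sup>2 + 1"
  have c0: "c \<ge> 0" unfolding c_def using q_pos by simp
  have "(\<Sum>p\<in>primitive_pairs. pair_term p p) - (1 - 1 / q) * (real d * (real d + 1)\<^sup>2 * (real d + 2) / 12) =
      (\<Sum>a<d. \<Sum>b<d. (\<Sum>p\<in>pairs_of_degree a b. pair_term p p) - (1 - 1 / q) * (real (d - (a + b)))\<^sup>2)"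
    unfolding sum_primitive_pairs_degrees sum_squared_gaps[symmetric] sum_distrib_left sum_subtractf ..
  also have "\<bar>\<dots>\<bar> \<le> (\<Sum>a<d. \<Sum>b<d. c * real d + (if a = 0 then c * (real d)\<^sup>2 else 0) + (if b = 0 then c * (real d)\<^sup>2 else 0))"
  proof (rule order_trans[OF sum_abs], rule sum_mono, rule order_trans[OF sum_abs], rule sum_mono)
    fix a b
    show "\<bar>(\<Sum>p\<in>pairs_of_degree a b. pair_term p p) - (1 - 1 / q) * (real (d - (a + b)))\<^sup>2\<bar> \<le>
      c * real d + (if a = 0 then c * (real d)\<^sup>2 else 0) + (if b = 0 then c * (real d)\<^sup>2 else 0)"
    proof (cases "a + b < d")
      case True
      show ?thesis
        using diagonal_degree_bound[OF True, folded c_def] c0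
        by (auto split: if_splits intro: order_trans)
    next
      case False
      then have "pairs_of_degree a b = {}" "d - (a + b) = 0" using pairs_of_degree_empty by auto
      then show ?thesis using c0 by simp
    qed
  qed
  also have "\<dots> = 3 * c * real d ^ 3"
    using d_pos by (simp add: sum.distrib sum.delta flip: sum_distrib_left)
      (simp add: power2_eq_square power3_eq_cube algebra_simps)
  finally show ?thesis unfolding c_def .
qed

text \<open>Pairs of height \<open>h\<close> have total weight at most
  \<open>q * (q u) ^ h = q * (1 / u) ^ h\<close>, so the sum is dominated by heights near
  \<open>d\<close>; relative to \<open>(1 / u) ^ d\<close> it converges in the gap, and one free
  degree leaves the factor \<open>d\<close>.\<close>

lemma sum_short_sum_abs_le: "\<bar>\<Sum>r\<in>res. short_sum r\<bar> \<le> (1 + box_bound) * q * box_bound * real d * (1 / u) ^ d"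
proof -
  have "\<bar>\<Sum>r\<in>res. short_sum r\<bar> \<le> (\<Sum>p\<in>primitive_pairs. (1 + box_bound) * real (gap p) * u ^ height p)"
    unfolding sum_short_sum
  proof (rule order_trans[OF sum_abs], rule sum_mono)
    fix p assume "p \<in> primitive_pairs"
    then show "\<bar>coefficient p * u ^ height p\<bar> \<le> (1 + box_bound) * real (gap p) * u ^ height p"
      using abs_coefficient_le u_pos by (simp add: abs_mult mult_right_mono)
  qed
  also have "\<dots> = (\<Sum>b<d. \<Sum>a<d. \<Sum>p\<in>pairs_of_degree a b. (1 + box_bound) * real (gap p) * u ^ height p)"
    unfolding sum_primitive_pairs_degrees by (rule sum.swap)
  also have "\<dots> \<le> (\<Sum>b<d. \<Sum>a<d. (1 + box_bound) * q * (1 / u) ^ d * (real (d - (a + b)) * u ^ (d - (a + b))))"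
  proof (intro sum_mono)
    fix a b
    let ?e = "d - (a + b)"
    have "(\<Sum>p\<in>pairs_of_degree a b. (1 + box_bound) * real (gap p) * u ^ height p) =
        real (card (pairs_of_degree a b)) * ((1 + box_bound) * real ?e * u ^ (a + b))"
      by (simp add: pairs_of_degree_def gap_def height_def)
    also have "\<dots> \<le> (1 + box_bound) * q * (1 / u) ^ d * (real ?e * u ^ ?e)"
    proof (cases "a + b < d")
      case True
      have "q * u = 1 / u" using q_u_u u_pos by (simp add: field_simps)
      then have "(q * u) ^ (a + b) = (1 / u) ^ (a + b)" by simp
      also have "\<dots> = (1 / u) ^ d * u ^ ?e"
      proof -
        have "d = (a + b) + ?e" using True by simp
        then have "(1 / u) ^ d = (1 / u) ^ (a + b) * (1 / u) ^ ?e" by (metis power_add)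
        then show ?thesis using u_pos by (simp add: power_divide)
      qed
      finally have quw: "q ^ (a + b) * u ^ (a + b) = (1 / u) ^ d * u ^ ?e" by (simp add: power_mult_distrib)
      have "real (card (pairs_of_degree a b)) * ((1 + box_bound) * real ?e * u ^ (a + b)) \<le>
          (q * q ^ (a + b)) * ((1 + box_bound) * real ?e * u ^ (a + b))"
        using card_pairs_of_degree_le u_pos by (intro mult_right_mono) auto
      also have "\<dots> = (1 + box_bound) * q * real ?e * (q ^ (a + b) * u ^ (a + b))" by (simp only: mult_ac)
      also have "\<dots> = (1 + box_bound) * q * (1 / u) ^ d * (real ?e * u ^ ?e)" unfolding quw by (simp only: mult_ac)
      finally show ?thesis .
    qed simp
    finally show "(\<Sum>p\<in>pairs_of_degree a b. (1 + box_bound) * real (gap p) * u ^ height p) \<le>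
        (1 + box_bound) * q * (1 / u) ^ d * (real ?e * u ^ ?e)" .
  qed
  also have "\<dots> = (1 + box_bound) * q * (1 / u) ^ d * (\<Sum>b<d. \<Sum>a<d. real (d - (a + b)) * u ^ (d - (a + b)))"
    by (simp only: sum_distrib_left)
  also have "\<dots> \<le> (1 + box_bound) * q * (1 / u) ^ d * (\<Sum>b<d. box_bound)"
  proof (intro mult_left_mono sum_mono)
    fix b
    have "(\<Sum>a<d. real (d - (a + b)) * u ^ (d - (a + b))) \<le> (\<Sum>e\<in>{1..d}. real e * u ^ e)"
      by (rule sum_degree_gap_le) (use u_pos in auto)
    also have "\<dots> \<le> (\<Sum>e\<in>{1..d}. real (Suc e) * u ^ e)"
      using u_pos by (intro sum_mono mult_right_mono) auto
    also have "\<dots> \<le> (\<Sum>e<Suc d. real (Suc e) * u ^ e)"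
      by (rule sum_mono2) (use u_pos in auto)
    also have "\<dots> \<le> box_bound" unfolding box_bound_def by (rule arith_geometric_partial_sum_le) (use u_pos u_lt_1 in auto)
    finally show "(\<Sum>a<d. real (d - (a + b)) * u ^ (d - (a + b))) \<le> box_bound" .
  qed (use q_pos u_pos in simp)
  also have "\<dots> = (1 + box_bound) * q * box_bound * real d * (1 / u) ^ d" by simp
  finally show ?thesis .
qed

text \<open>The square of \<open>(1 / u) ^ d\<close> is \<open>q ^ d\<close>, at most twice
  \<open>card res\<close>. What remains is \<open>O(d^2)\<close>.\<close>

lemma trivial_character_contribution_le:
  "(\<Sum>r\<in>res. short_sum r)\<^sup>2 / real (card res) \<le> 2 * ((1 + box_bound) * q * box_bound)\<^sup>2 * real d ^ 3"
proof -
  define c where "c = (1 + box_bound) * q * box_bound"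
  have "(\<Sum>r\<in>res. short_sum r)\<^sup>2 \<le> (c * real d * (1 / u) ^ d)\<^sup>2"
    using power_mono[OF sum_short_sum_abs_le, of 2] by (simp add: c_def)
  also have "\<dots> = (c * real d)\<^sup>2 * q ^ d"
  proof -
    have "((1 / u) ^ d)\<^sup>2 = (1 / (u * u)) ^ d" by (simp add: power2_eq_square power_divide power_mult_distrib)
    also have "1 / (u * u) = q" using u_square by simp
    finally show ?thesis by (simp only: power_mult_distrib)
  qed
  finally have sq: "(\<Sum>r\<in>res. short_sum r)\<^sup>2 \<le> (c * real d)\<^sup>2 * q ^ d" .
  have "q ^ 1 \<le> q ^ d" using d_pos q_ge_2 by (intro power_increasing) auto
  then have "q ^ d \<ge> 2" using q_ge_2 by simp
  moreover have "real (card res) = q ^ d - 1" by (simp add: card_res q_eq of_nat_diff)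
  ultimately have N: "q ^ d \<le> 2 * real (card res)" by linarith
  have "(\<Sum>r\<in>res. short_sum r)\<^sup>2 \<le> (c * real d)\<^sup>2 * (2 * real (card res))"
    by (rule order_trans[OF sq mult_left_mono[OF N]]) simp
  then have "(\<Sum>r\<in>res. short_sum r)\<^sup>2 / real (card res) \<le> (c * real d)\<^sup>2 * 2"
    using card_res_pos by (simp add: divide_le_eq mult_ac)
  also have "\<dots> \<le> 2 * c\<^sup>2 * real d ^ 3"
  proof -
    have "(real d)\<^sup>2 \<le> real d ^ 3" using d_pos by (intro power_increasing) auto
    then show ?thesis using mult_left_mono[of "(real d)\<^sup>2" "real d ^ 3" "2 * c\<^sup>2"] by (simp add: power_mult_distrib mult_ac)
  qed
  finally show ?thesis unfolding c_def .
qed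

theorem fourth_moment_bound:
  assumes K: "\<And>n. (\<Sum>N\<in>(monic_polys n :: 'a poly set). tau N ^ 41) \<le> CARD('a) ^ n * (n + 1) ^ K"
    and C: "\<And>n::nat. real n ^ (3 * (K + 4)) * u ^ n \<le> C"
  shows "\<bar>1 / real (poly_phi Q) *
      (\<Sum>\<psi> | dirichlet_character Q \<psi> \<and> \<psi> \<noteq> trivial_character Q. cmod (dirichlet_L \<psi> (1/2)) ^ 4)
      - (q - 1) / (12 * q) * real d ^ 4\<bar> \<le>
    ((1 + box_bound)\<^sup>2 * (2 * (2 * q * box_bound + 2 ^ 40 * 3 ^ (K + 1) * q ^ 4 * C)) +
     3 * ((1 + box_bound)\<^sup>2 + q * box_bound\<^sup>2 + 2 * box_bound + box_bound\<^sup>2 + 1) + 2 * ((1 + box_bound) * q * box_bound)\<^sup>2 + 1) * real d ^ 3"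
proof -
  define M where "M = (\<Sum>\<psi> | dirichlet_character Q \<psi> \<and> \<psi> \<noteq> trivial_character Q. cmod (dirichlet_L \<psi> (1/2)) ^ 4)"
  define N where "N = real (card res)"
  define D where "D = (\<Sum>p\<in>primitive_pairs. pair_term p p)"
  define R where "R = (\<Sum>p\<in>primitive_pairs. \<Sum>p'\<in>primitive_pairs. if related p p' then pair_term p p' else 0)"
  define T where "T = (\<Sum>r\<in>res. short_sum r)\<^sup>2 / N"
  define c1 where "c1 = (1 + box_bound)\<^sup>2 * (2 * (2 * q * box_bound + 2 ^ 40 * 3 ^ (K + 1) * q ^ 4 * C))"
  define c2 where "c2 = 3 * ((1 + box_bound)\<^sup>2 + q * box_bound\<^sup>2 + 2 * box_bound + box_bound\<^sup>2 + 1)"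
  define c3 where "c3 = 2 * ((1 + box_bound) * q * box_bound)\<^sup>2"
  define P where "P = real d * (real d + 1)\<^sup>2 * (real d + 2) / 12"
  have N: "N > 0" using card_res_pos by (simp add: N_def)
  have "M = N * (\<Sum>r\<in>res. (short_sum r)\<^sup>2) - (\<Sum>r\<in>res. short_sum r)\<^sup>2"
    unfolding M_def N_def by (rule fourth_moment_eq[OF pair_weight_eq])
  then have "1 / N * M = D + R - T"
    unfolding sum_short_sum_square D_def[symmetric] R_def[symmetric] T_def using N by (simp add: field_simps)
  moreover have "\<bar>R\<bar> \<le> c1 * real d ^ 3"
  proof -
    have "(1 + box_bound)\<^sup>2 * (\<Sum>x\<in>{..<d} \<times> {..<d}. \<Sum>y\<in>{..<d} \<times> {..<d}. cross_term x y) \<le>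
        (1 + box_bound)\<^sup>2 * (2 * (2 * q * box_bound + 2 ^ 40 * 3 ^ (K + 1) * q ^ 4 * C) * real d ^ 3)"
      by (rule mult_left_mono[OF sum_cross_term_le[OF K C, folded box_bound_def]]) simp
    then show ?thesis using sum_related_le unfolding R_def c1_def by (simp only: mult.assoc)
  qed
  moreover have "\<bar>D - (1 - 1 / q) * P\<bar> \<le> c2 * real d ^ 3"
    unfolding D_def P_def c2_def by (rule diagonal_bound)
  moreover have "0 \<le> T" "T \<le> c3 * real d ^ 3"
    using N trivial_character_contribution_le unfolding T_def c3_def N_def by auto
  moreover have "\<bar>(1 - 1 / q) * P - (q - 1) / (12 * q) * real d ^ 4\<bar> \<le> real d ^ 3"
  proof -
    have "(q - 1) / (12 * q) * real d ^ 4 = (1 - 1 / q) * (real d ^ 4 / 12)" using q_pos by (simp add: field_simps)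
    then have eq: "(1 - 1 / q) * P - (q - 1) / (12 * q) * real d ^ 4 = (1 - 1 / q) * (P - real d ^ 4 / 12)"
      by (simp add: right_diff_distrib)
    have Pd: "P - real d ^ 4 / 12 = (4 * real d ^ 3 + 5 * (real d)\<^sup>2 + 2 * real d) / 12"
      by (simp add: P_def field_simps power2_eq_square power3_eq_cube power4_eq_xxxx)
    have "(real d)\<^sup>2 \<le> real d ^ 3" "real d ^ 1 \<le> real d ^ 3" using d_pos by (intro power_increasing; simp)+
    \<comment> \<open>The lower coefficients of \<open>d (d + 1)^2 (d + 2)\<close> are 4, 5 and 2,
      with sum 11, below the denominator 12.\<close>
    moreover have arith: "0 \<le> x \<Longrightarrow> 0 \<le> y \<Longrightarrow> 0 \<le> z \<Longrightarrow> 0 \<le> (4 * x + 5 * y + 2 * z) / 12"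
      "y \<le> x \<Longrightarrow> z \<le> x \<Longrightarrow> (4 * x + 5 * y + 2 * z) / 12 \<le> x" if "0 \<le> x" for x y z :: real
      using that by auto
    moreover have "0 \<le> real d" "0 \<le> (real d)\<^sup>2" "0 \<le> real d ^ 3" by simp_all
    ultimately have PP: "0 \<le> P - real d ^ 4 / 12" "P - real d ^ 4 / 12 \<le> real d ^ 3"
      unfolding Pd power_one_right by (simp_all only: arith)
    have q1: "0 \<le> 1 - 1 / q" "1 - 1 / q \<le> 1" using q_ge_2 by auto
    have "(1 - 1 / q) * (P - real d ^ 4 / 12) \<le> 1 * real d ^ 3"
      by (rule mult_mono[OF q1(2) PP(2) _ PP(1)]) simp
    moreover have "0 \<le> (1 - 1 / q) * (P - real d ^ 4 / 12)"
      by (rule mult_nonneg_nonneg[OF q1(1) PP(1)])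
    ultimately show ?thesis unfolding eq by (simp only: abs_of_nonneg mult_1)
  qed
  ultimately have "\<bar>1 / N * M - (q - 1) / (12 * q) * real d ^ 4\<bar> \<le> c1 * real d ^ 3 + c2 * real d ^ 3 + c3 * real d ^ 3 + real d ^ 3"
    by linarith
  then show ?thesis
    unfolding poly_phi_eq_card_res M_def[symmetric] N_def[symmetric] c1_def[symmetric] c2_def[symmetric] c3_def[symmetric]
    by (simp add: distrib_right)
qed

end

theorem theorem1p2:
  shows "\<exists>C::real. \<forall>Q :: 'a::{field,finite} poly. irreducible Q \<longrightarrow>
    \<bar>1 / real (poly_phi Q) *
        (\<Sum>\<psi> | dirichlet_character Q \<psi> \<and> \<psi> \<noteq> trivial_character Q. cmod (dirichlet_L \<psi> (1/2)) ^ 4)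
      - (real CARD('a) - 1) / (12 * real CARD('a)) * real (degree Q) ^ 4\<bar>
    \<le> C * real (degree Q) ^ 3"
proof -
  define q where "q = real CARD('a)"
  define u where "u = 1 / sqrt q"
  have "q \<ge> 2" using card_field_ge_2[where 'a = 'a] by (simp add: q_def)
  then have u: "0 \<le> u" "u < 1" by (simp_all add: u_def)
  \<comment> \<open>\<open>K\<close> and \<open>C\<close> are fixed before \<open>Q\<close>, and
    \<open>box_bound\<close> unfolds to an expression in \<open>u\<close>, so the final constant
    depends on \<open>q\<close> alone.\<close>
  obtain K where K: "\<And>n. (\<Sum>N\<in>(monic_polys n :: 'a poly set). tau N ^ 41) \<le> CARD('a) ^ n * (n + 1) ^ K"
    using sum_tau_power_bound[where 'a = 'a and J = 41] by blast
  obtain C where C: "\<And>n::nat. real n ^ (3 * (K + 4)) * u ^ n \<le> C"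
    using power_times_geometric_bounded[OF u, of "3 * (K + 4)"] by blast
  show ?thesis
  proof (intro exI allI impI)
    fix Q :: "'a poly" assume "irreducible Q"
    then interpret irreducible_modulus_weight Q q u
      by unfold_locales (simp_all add: q_def u_def)
    show "\<bar>1 / real (poly_phi Q) *
        (\<Sum>\<psi> | dirichlet_character Q \<psi> \<and> \<psi> \<noteq> trivial_character Q. cmod (dirichlet_L \<psi> (1/2)) ^ 4)
      - (real CARD('a) - 1) / (12 * real CARD('a)) * real (degree Q) ^ 4\<bar> \<le>
      ((1 + (1 / (1 - u))\<^sup>2)\<^sup>2 * (2 * (2 * q * (1 / (1 - u))\<^sup>2 + 2 ^ 40 * 3 ^ (K + 1) * q ^ 4 * C)) +
       3 * ((1 + (1 / (1 - u))\<^sup>2)\<^sup>2 + q * ((1 / (1 - u))\<^sup>2)\<^sup>2 + 2 * (1 / (1 - u))\<^sup>2 + ((1 / (1 - u))\<^sup>2)\<^sup>2 + 1) +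
       2 * ((1 + (1 / (1 - u))\<^sup>2) * q * (1 / (1 - u))\<^sup>2)\<^sup>2 + 1) * real (degree Q) ^ 3"
      using fourth_moment_bound[OF K C] unfolding box_bound_def q_def .
  qed
qed

end
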